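(* Let $(\Omega,\mathcal B,\mathbb P)$ be a probability space, $\mathbf T:\Omega\to\Omega$ an ergodic transformation, and $\mathbf F:\Omega\to\mathrm{Sym}_W(\mathbb R)$ a measurable function with $\mathbb E\log_+\|\mathbf F\|<\infty$. Let $\Phi_{n,\omega}(z)$ be the associated matrix Schrödinger cocycle, $\gamma_j(z)$ its Lyapunov exponents, and $\Gamma_k=\gamma_1+\cdots+\gamma_k$ (see context). Let $1\le k\le W$. Then almost* surely $$\forall z\in\mathbb C:\quad \limsup_{n\to\infty}\left[\sum_{j=1}^k\frac1n\log s_j(\Phi_{n,\omega}(z))-\Gamma_k(z)\right]\le0.$$ Moreover, if $\Gamma_k$ is continuous on a compact set $K\subset\mathbb C$, then almost* surely $$\limsup_{n\to\infty}\sup_{z\in K}\left[\sum_{j=1}^k\frac1n\log s_j(\Phi_{n,\omega}(z))-\Gamma_k(z)\right]\le0.$$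
   Context: Setting. $W\ge1$ is an integer and $\mathrm{Sym}_W(\mathbb R)$ is the space of real symmetric $W\times W$ matrices. Put $V_{n,\omega}=\mathbf F(\mathbf T^n\omega)$, $n\ge0$, and for $z\in\mathbb C$ let $$T_{n,\omega}(z)=\begin{pmatrix} z\mathbf 1-V_{n,\omega} & -\mathbf 1\\ \mathbf 1&0\end{pmatrix},\qquad \Phi_{n,\omega}(z)=T_{n,\omega}(z)T_{n-1,\omega}(z)\cdots T_{1,\omega}(z)$$ ($2W\times 2W$ matrices). $s_j(\cdot)$ denotes the $j$-th largest singular value. The Lyapunov exponents are $\gamma_j(z)=\lim_{n\to\infty}\frac1n\mathbb E\log s_j(\Phi_{n,\omega}(z))$, $1\le j\le 2W$ (these are finite), and $\Gamma_k(z)=\gamma_1(z)+\cdots+\gamma_k(z)$. Terminology. A property holds "almost* surely" if it holds for $\mathbb P$-almost every $\omega$ under the general assumptions ($\mathbf T$ ergodic, $\mathbf F$ measurable, $\mathbb E\log_+\|\mathbf F\|<\infty$) and, moreover, for all $\omega\in\Omega$ in the uniquely ergodic case, i.e. when $\Omega$ is a compact metrisable topological space, $\mathbf T$ is continuous and uniquely ergodic, and $\mathbf F:\Omega\to\mathrm{Sym}_W(\mathbb R)$ is continuous. *)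

theory Defs
  imports "HOL-Probability.Probability" "HOL-Computational_Algebra.Polynomial"
begin

section \<open>Singular values\<close>

definition conj_transpose :: "complex^'n^'m \<Rightarrow> complex^'m^'n" where
  "conj_transpose A = (\<chi> i j. cnj (A $ j $ i))"

definition charpoly :: "complex^'n^'n \<Rightarrow> complex poly" where
  "charpoly A = det (\<chi> i j. (if i = j then [:0, 1:] else 0) - [:A $ i $ j:])"

text \<open>
  The square roots of the eigenvalues of \<open>A\<^sup>* A\<close>, each repeated according to its multiplicity,
  in decreasing order. These eigenvalues are real and nonnegative, so taking the
  real part discards nothing.
\<close>
definition singular_values :: "complex^'n^'n \<Rightarrow> real list" where
  "singular_values A =
     rev (sorted_list_of_multiset
       (image_mset (\<lambda>x. sqrt (Re x)) (proots (charpoly (conj_transpose A ** A)))))"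

text \<open>The index \<open>j\<close> starts at 1, so \<open>singular_value 1 A\<close> is the largest singular value.\<close>
definition singular_value :: "nat \<Rightarrow> complex^'n^'n \<Rightarrow> real" where
  "singular_value j A = singular_values A ! (j - 1)"


section \<open>Ergodicity and unique ergodicity\<close>

definition measure_preserving_map :: "'a measure \<Rightarrow> ('a \<Rightarrow> 'a) \<Rightarrow> bool" where
  "measure_preserving_map M T \<longleftrightarrow> T \<in> M \<rightarrow>\<^sub>M M \<and> distr M M T = M"

definition ergodic_map :: "'a measure \<Rightarrow> ('a \<Rightarrow> 'a) \<Rightarrow> bool" where
  "ergodic_map M T \<longleftrightarrow> measure_preserving_map M T \<and>
     (\<forall>A\<in>sets M. T -` A \<inter> space M = A \<longrightarrow> measure M A = 0 \<or> measure M A = 1)"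

definition borel_sets_of :: "'a topology \<Rightarrow> 'a set set" where
  "borel_sets_of X = sigma_sets (topspace X) {U. openin X U}"

definition uniquely_ergodic :: "'a topology \<Rightarrow> ('a \<Rightarrow> 'a) \<Rightarrow> bool" where
  "uniquely_ergodic X T \<longleftrightarrow>
     (\<exists>!N. prob_space N \<and> space N = topspace X \<and> sets N = borel_sets_of X
        \<and> measure_preserving_map N T)"

text \<open>
  Here \<open>M\<close> is a probability measure preserved by \<open>T\<close>, so the requirement that it live on the Borel
  sets of \<open>X\<close> makes it the unique invariant measure.
\<close>
definition uniquely_ergodic_case ::
    "'a topology \<Rightarrow> 'a measure \<Rightarrow> ('a \<Rightarrow> 'a) \<Rightarrow> ('a \<Rightarrow> real^'w^'w) \<Rightarrow> bool" where
  "uniquely_ergodic_case X M T F \<longleftrightarrow>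
     topspace X = space M \<and> sets M = borel_sets_of X \<and>
     compact_space X \<and> metrizable_space X \<and>
     continuous_map X X T \<and> uniquely_ergodic X T \<and> continuous_map X euclidean F"

definition almost_star_surely ::
    "'a measure \<Rightarrow> ('a \<Rightarrow> 'a) \<Rightarrow> ('a \<Rightarrow> real^'w^'w) \<Rightarrow> ('a \<Rightarrow> bool) \<Rightarrow> bool" where
  "almost_star_surely M T F P \<longleftrightarrow>
     (AE \<omega> in M. P \<omega>) \<and>
     ((\<exists>X. uniquely_ergodic_case X M T F) \<longrightarrow> (\<forall>\<omega>\<in>space M. P \<omega>))"


section \<open>The matrix Schroedinger cocycle\<close>

definition sym_matrices :: "(real^'w^'w) set" where
  "sym_matrices = {A. transpose A = A}"

definition block_matrix ::
    "'c^'w^'w \<Rightarrow> 'c^'w^'w \<Rightarrow> 'c^'w^'w \<Rightarrow> 'c^'w^'w \<Rightarrow> 'c^('w + 'w)^('w + 'w)" where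
  "block_matrix A B C D = (\<chi> i j.
     case (i, j) of
       (Inl a, Inl b) \<Rightarrow> A $ a $ b
     | (Inl a, Inr b) \<Rightarrow> B $ a $ b
     | (Inr a, Inl b) \<Rightarrow> C $ a $ b
     | (Inr a, Inr b) \<Rightarrow> D $ a $ b)"

definition potential :: "('a \<Rightarrow> 'a) \<Rightarrow> ('a \<Rightarrow> real^'w^'w) \<Rightarrow> nat \<Rightarrow> 'a \<Rightarrow> real^'w^'w" where
  "potential T F n \<omega> = F ((T ^^ n) \<omega>)"

definition transfer_matrix ::
    "('a \<Rightarrow> 'a) \<Rightarrow> ('a \<Rightarrow> real^'w^'w) \<Rightarrow> nat \<Rightarrow> 'a \<Rightarrow> complex \<Rightarrow> complex^('w + 'w)^('w + 'w)" where
  "transfer_matrix T F n \<omega> z =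
     block_matrix (mat z - (\<chi> i j. complex_of_real (potential T F n \<omega> $ i $ j))) (- mat 1)
                  (mat 1) 0"

primrec cocycle ::
    "('a \<Rightarrow> 'a) \<Rightarrow> ('a \<Rightarrow> real^'w^'w) \<Rightarrow> nat \<Rightarrow> 'a \<Rightarrow> complex \<Rightarrow> complex^('w + 'w)^('w + 'w)" where
  "cocycle T F 0 \<omega> z = mat 1"
| "cocycle T F (Suc n) \<omega> z = transfer_matrix T F (Suc n) \<omega> z ** cocycle T F n \<omega> z"

definition lyapunov_exponent ::
    "'a measure \<Rightarrow> ('a \<Rightarrow> 'a) \<Rightarrow> ('a \<Rightarrow> real^'w^'w) \<Rightarrow> nat \<Rightarrow> complex \<Rightarrow> real" where
  "lyapunov_exponent M T F j z =
     lim (\<lambda>n. 1 / real n * (LINT \<omega>|M. ln (singular_value j (cocycle T F n \<omega> z))))"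

definition lyapunov_sum ::
    "'a measure \<Rightarrow> ('a \<Rightarrow> 'a) \<Rightarrow> ('a \<Rightarrow> real^'w^'w) \<Rightarrow> nat \<Rightarrow> complex \<Rightarrow> real" where
  "lyapunov_sum M T F k z = (\<Sum>j=1..k. lyapunov_exponent M T F j z)"

definition log_plus :: "real \<Rightarrow> real" where
  "log_plus x = (if x \<le> 1 then 0 else ln x)"

end

theory Submission
  imports Defs "HOL-Computational_Algebra.Fundamental_Theorem_Algebra"
begin

text \<open>
  The quantity \<open>log (s\<^sub>1 \<cdots> s\<^sub>k)\<close> of the products is subadditive along orbits up to a bounded error,
  and so is its supremum over a compact set of parameters \<open>z\<close>. Upper bounds for subadditive
  sequences are therefore locally uniform in \<open>z\<close>, and this gives both claims together.

  In detail, let \<open>e\<^sub>k(A)\<close> be the sum of the squared moduli of all \<open>k \<times> k\<close> minors of \<open>A\<close>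
  (\<open>minor_sq_sum\<close>). The Cauchy--Binet formula and the Cauchy--Schwarz inequality give
  \<open>e\<^sub>k(A B) \<le> e\<^sub>k(A) e\<^sub>k(B)\<close>. On the other hand \<open>e\<^sub>k(A)\<close> is up to sign a coefficient of the
  characteristic polynomial of \<open>A\<^sup>* A\<close>, hence the \<open>k\<close>-th elementary symmetric function of the squared
  singular values, so it is comparable with \<open>(s\<^sub>1 \<cdots> s\<^sub>k)\<^sup>2\<close> (\<open>minor_sq_sum_bounds\<close>). A transfer matrix
  has a determinant of modulus 1, which makes all these logarithms nonnegative.

  For a compact set \<open>B\<close> of parameters let \<open>G\<^sub>n(\<omega>)\<close> be the supremum over \<open>z \<in> B\<close> of half the logarithm of
  \<open>e\<^sub>k\<close> of the \<open>n\<close>-step product. Then \<open>G\<^sub>m\<^sub>+\<^sub>n(\<omega>) \<le> G\<^sub>m(\<omega>) + G\<^sub>n(T\<^sup>m \<omega>)\<close>. Cutting an orbit segment of length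
  \<open>n\<close> into blocks of length \<open>m\<close> and averaging over the offset of the first block shows that
  \<open>limsup G\<^sub>n(\<omega>) / n \<le> (1/m) \<integral> G\<^sub>m\<close> at every \<open>\<omega>\<close> at which the Birkhoff averages of \<open>G\<^sub>m\<close> and \<open>G\<^sub>1\<close> converge
  to the integrals (\<open>subadditive_array_limsup\<close>). It suffices to know this for the countably many closed
  discs \<open>B\<close> with centres in a countable dense set and radii \<open>1/(j+1)\<close>; call such points \<open>\<omega>\<close> generic.
  When \<open>B\<close> shrinks to a point \<open>z\<close>, the integral of \<open>G\<^sub>m\<close> tends to the value for \<open>B = {z}\<close>, and
  \<open>1/m\<close> times this value tends to \<open>\<Gamma>\<^sub>k(z)\<close>. Thus at a generic \<open>\<omega>\<close> every \<open>z\<close> has a neighbourhood on which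
  \<open>G\<^sub>n(\<omega>) / n\<close> is eventually below \<open>\<Gamma>\<^sub>k(z) + \<epsilon>\<close> (\<open>generic_point_local_bound\<close>). The point \<open>z\<close> itself gives the
  first claim; if \<open>\<Gamma>\<^sub>k\<close> is continuous on the compact set \<open>K\<close>, finitely many of these neighbourhoods
  give the second.

  Almost every point is generic by Birkhoff's theorem. In the uniquely ergodic case every point is
  generic, because \<open>G\<^sub>m\<close> is continuous on the phase space and Birkhoff averages of continuous functions
  converge everywhere (\<open>uniquely_ergodic_birkhoff\<close>). The proof of the latter fact needs weak limits of
  empirical measures; a compact metrizable space is a continuous image of a compact set of real
  numbers, so they are provided by Helly's selection theorem on the line.

  The exponents are defined by integrals of \<open>log s\<^sub>j\<close>, so it also has to be shown that these functions are
  integrable, in particular measurable. For this the ordered singular values are proved to be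
  continuous functions of the matrix (\<open>continuous_singular_value\<close>).
\<close>

section \<open>Minors, the Cauchy--Binet formula and the characteristic polynomial\<close>

definition tuples :: "nat \<Rightarrow> (nat \<Rightarrow> 'n::finite) set" where
  "tuples k = {..<k} \<rightarrow>\<^sub>E UNIV"

text \<open>
  Rows and columns are selected by tuples rather than by sets, so that no order on the index type is
  needed to fix signs. Repetitions are harmless, since they make the determinant vanish.
\<close>
definition tuple_minor :: "nat \<Rightarrow> complex^'n^'n \<Rightarrow> (nat \<Rightarrow> 'n) \<Rightarrow> (nat \<Rightarrow> 'n) \<Rightarrow> complex" where
  "tuple_minor k A f g =
     (\<Sum>\<sigma> | \<sigma> permutes {..<k}. of_int (sign \<sigma>) * (\<Prod>i<k. A $ f i $ g (\<sigma> i)))"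

definition principal_minor :: "complex^'n^'n \<Rightarrow> 'n set \<Rightarrow> complex" where
  "principal_minor A S = (\<Sum>\<sigma> | \<sigma> permutes S. of_int (sign \<sigma>) * (\<Prod>i\<in>S. A $ i $ \<sigma> i))"

lemma finite_tuples [simp]: "finite (tuples k :: (nat \<Rightarrow> 'n::finite) set)"
  by (simp add: tuples_def finite_PiE)

lemma sum_tuples_permute:
  fixes \<phi> :: "(nat \<Rightarrow> 'b::finite) \<Rightarrow> 'c::comm_monoid_add"
  assumes "\<sigma> permutes {..<k}"
  shows "(\<Sum>h\<in>tuples k. \<phi> (h \<circ> \<sigma>)) = (\<Sum>h\<in>tuples k. \<phi> h)"
proof (rule sum.reindex_bij_witness[where i = "\<lambda>h. h \<circ> inv \<sigma>" and j = "\<lambda>h. h \<circ> \<sigma>"])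
  have i: "inv \<sigma> permutes {..<k}" using assms by (rule permutes_inv)
  fix h :: "nat \<Rightarrow> 'b"
  show "(h \<circ> \<sigma>) \<circ> inv \<sigma> = h" "(h \<circ> inv \<sigma>) \<circ> \<sigma> = h"
    using permutes_inv_o[OF assms] by (simp_all add: o_assoc[symmetric])
  assume h: "h \<in> tuples k"
  have *: "h \<circ> p \<in> tuples k" if "p permutes {..<k}" for p
    using h that permutes_not_in[OF that]
    by (auto simp: tuples_def PiE_def extensional_def)
  show "h \<circ> \<sigma> \<in> tuples k" "h \<circ> inv \<sigma> \<in> tuples k" using * assms i by blast+
qed simp

lemma prod_permute_lessThan:
  assumes "\<sigma> permutes {..<k::nat}"
  shows "(\<Prod>i<k. \<phi> (\<sigma> i)) = (\<Prod>i<k. \<phi> i)"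
  using prod.permute[OF assms, of \<phi>] by (simp add: o_def)

lemma sign_compose_permutes:
  assumes "\<sigma> permutes {..<k::nat}" "\<tau> permutes {..<k}"
  shows "sign (\<tau> \<circ> \<sigma>) = sign \<tau> * sign \<sigma>"
  using assms by (meson finite_lessThan permutation_permutes sign_compose)

lemma tuple_minor_permute_columns:
  assumes "\<tau> permutes {..<k}"
  shows "tuple_minor k A f (g \<circ> \<tau>) = of_int (sign \<tau>) * tuple_minor k A f g"
proof -
  have "tuple_minor k A f g =
      (\<Sum>\<sigma> | \<sigma> permutes {..<k}. of_int (sign (\<tau> \<circ> \<sigma>)) * (\<Prod>i<k. A $ f i $ g ((\<tau> \<circ> \<sigma>) i)))"
    unfolding tuple_minor_def by (rule setum_permutations_compose_left[OF assms])
  also have "\<dots> = of_int (sign \<tau>) * tuple_minor k A f (g \<circ> \<tau>)"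
    unfolding tuple_minor_def sum_distrib_left
    by (rule sum.cong) (auto simp: sign_compose_permutes assms)
  finally have "of_int (sign \<tau>) * tuple_minor k A f g
      = (of_int (sign \<tau>) * of_int (sign \<tau>)) * tuple_minor k A f (g \<circ> \<tau>)"
    by simp
  thus ?thesis by (simp flip: of_int_mult)
qed

lemma tuple_minor_noninj:
  assumes "\<not> inj_on g {..<k}"
  shows "tuple_minor k A f g = 0"
proof -
  obtain a b where ab: "a < k" "b < k" "a \<noteq> b" "g a = g b"
    using assms by (auto simp: inj_on_def)
  have "g \<circ> Transposition.transpose a b = g" using ab by (auto simp: fun_eq_iff Transposition.transpose_def)
  moreover have "Transposition.transpose a b permutes {..<k}" using ab by (simp add: permutes_swap_id)
  ultimately have "tuple_minor k A f g = - tuple_minor k A f g"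
    using tuple_minor_permute_columns[of "Transposition.transpose a b" k A f g] ab by (simp add: sign_swap_id)
  thus ?thesis by simp
qed

text \<open>
  The Cauchy--Binet formula. Multilinearity in the rows expands the minor of \<open>A B\<close> as a sum over all
  tuples \<open>h\<close>, and antisymmetry in \<open>h\<close> allows averaging over the permutations of \<open>h\<close>, which turns the
  product of entries of \<open>A\<close> into a minor. Every \<open>k\<close>-subset is counted with its \<open>k!\<close> orderings, whence
  the factor.
\<close>
lemma tuple_minor_mult:
  fixes A B :: "complex^'n^'n"
  shows "(\<Sum>h\<in>tuples k. tuple_minor k A f h * tuple_minor k B h g)
       = of_nat (fact k) * tuple_minor k (A ** B) f g"
proof -
  have AB: "tuple_minor k (A ** B) f g =
      (\<Sum>h\<in>tuples k. (\<Prod>i<k. A $ f i $ h i) * tuple_minor k B h g)"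
  proof -
    have "tuple_minor k (A ** B) f g = (\<Sum>\<sigma> | \<sigma> permutes {..<k}. of_int (sign \<sigma>) *
        (\<Prod>i<k. \<Sum>x\<in>UNIV. A $ f i $ x * B $ x $ g (\<sigma> i)))"
      by (simp add: tuple_minor_def matrix_matrix_mult_def)
    also have "\<dots> = (\<Sum>\<sigma> | \<sigma> permutes {..<k}. of_int (sign \<sigma>) *
        (\<Sum>h\<in>tuples k. \<Prod>i<k. A $ f i $ h i * B $ h i $ g (\<sigma> i)))"
      by (subst prod_sum_PiE) (auto simp: tuples_def)
    also have "\<dots> = (\<Sum>h\<in>tuples k. (\<Prod>i<k. A $ f i $ h i) * tuple_minor k B h g)"
      unfolding tuple_minor_def sum_distrib_left
      by (subst sum.swap) (simp add: prod.distrib mult_ac)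
    finally show ?thesis .
  qed
  \<comment> \<open>The sign of \<open>\<sigma>\<close> is absorbed by permuting the rows of the minor of \<open>B\<close>.\<close>
  have summand: "(\<Sum>h\<in>tuples k. (\<Prod>i<k. A $ f i $ h (\<sigma> i)) * (of_int (sign \<sigma>) * tuple_minor k B h g))
      = tuple_minor k (A ** B) f g" if s: "\<sigma> permutes {..<k}" for \<sigma>
  proof -
    have B: "of_int (sign \<sigma>) * tuple_minor k B h g = tuple_minor k B (h \<circ> \<sigma>) g" for h
    proof -
      have "tuple_minor k B h g = (\<Sum>\<tau> | \<tau> permutes {..<k}. of_int (sign \<tau>) *
          (\<Prod>i<k. B $ h (\<sigma> i) $ g (\<tau> (\<sigma> i))))"
        unfolding tuple_minor_def
        by (subst prod_permute_lessThan[OF s, where \<phi> = "\<lambda>i. B $ h i $ g (_ i)"]) simp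
      also have "\<dots> = (\<Sum>\<tau> | \<tau> permutes {..<k}. of_int (sign \<sigma>) * (of_int (sign (\<tau> \<circ> \<sigma>)) *
          (\<Prod>i<k. B $ (h \<circ> \<sigma>) i $ g ((\<tau> \<circ> \<sigma>) i))))"
      proof (rule sum.cong)
        fix \<tau> assume "\<tau> \<in> {\<tau>. \<tau> permutes {..<k}}"
        hence "sign \<tau> = sign \<sigma> * sign (\<tau> \<circ> \<sigma>)"
          by (simp add: sign_compose_permutes[OF s] mult.left_commute)
        hence "(of_int (sign \<tau>) :: complex) = of_int (sign \<sigma>) * of_int (sign (\<tau> \<circ> \<sigma>))"
          by (metis of_int_mult)
        thus "of_int (sign \<tau>) * (\<Prod>i<k. B $ h (\<sigma> i) $ g (\<tau> (\<sigma> i))) = of_int (sign \<sigma>) *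
          (of_int (sign (\<tau> \<circ> \<sigma>)) * (\<Prod>i<k. B $ (h \<circ> \<sigma>) i $ g ((\<tau> \<circ> \<sigma>) i)))"
          by simp
      qed simp
      also have "\<dots> = of_int (sign \<sigma>) * tuple_minor k B (h \<circ> \<sigma>) g"
        unfolding tuple_minor_def sum_distrib_left
        by (rule sum_permutations_compose_right[OF s, symmetric])
      finally show ?thesis by (simp add: mult.assoc[symmetric] flip: of_int_mult)
    qed
    have "(\<Sum>h\<in>tuples k. (\<Prod>i<k. A $ f i $ h (\<sigma> i)) * (of_int (sign \<sigma>) * tuple_minor k B h g))
        = (\<Sum>h\<in>tuples k. (\<lambda>h. (\<Prod>i<k. A $ f i $ h i) * tuple_minor k B h g) (h \<circ> \<sigma>))"
      by (simp add: B)
    also have "\<dots> = tuple_minor k (A ** B) f g"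
      by (subst sum_tuples_permute[OF s]) (simp add: AB)
    finally show ?thesis .
  qed
  have "(\<Sum>h\<in>tuples k. tuple_minor k A f h * tuple_minor k B h g) =
      (\<Sum>\<sigma> | \<sigma> permutes {..<k}. \<Sum>h\<in>tuples k.
         (\<Prod>i<k. A $ f i $ h (\<sigma> i)) * (of_int (sign \<sigma>) * tuple_minor k B h g))"
    by (subst sum.swap) (simp add: tuple_minor_def[of k A] sum_distrib_left sum_distrib_right mult_ac)
  also have "\<dots> = (\<Sum>\<sigma> | \<sigma> permutes {..<k}. tuple_minor k (A ** B) f g)"
    by (rule sum.cong) (auto simp: summand)
  also have "\<dots> = of_nat (fact k) * tuple_minor k (A ** B) f g"
    by (simp add: card_permutations)
  finally show ?thesis .
qed

lemma tuple_minor_conj_transpose: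
  "tuple_minor k (conj_transpose A) f h = cnj (tuple_minor k A h f)"
proof -
  have "tuple_minor k (conj_transpose A) f h =
     (\<Sum>\<sigma> | \<sigma> permutes {..<k}. of_int (sign (inv \<sigma>)) * (\<Prod>i<k. cnj (A $ h (inv \<sigma> i) $ f i)))"
    unfolding tuple_minor_def conj_transpose_def
    by (subst sum_permutations_inverse) simp
  also have "\<dots> = (\<Sum>\<sigma> | \<sigma> permutes {..<k}. of_int (sign \<sigma>) * (\<Prod>i<k. cnj (A $ h i $ f (\<sigma> i))))"
  proof (rule sum.cong)
    fix \<sigma> assume "\<sigma> \<in> {\<sigma>. \<sigma> permutes {..<k}}"
    hence s: "\<sigma> permutes {..<k}" by simp
    have "(\<Prod>i<k. cnj (A $ h (inv \<sigma> i) $ f i)) = (\<Prod>i<k. cnj (A $ h i $ f (\<sigma> i)))"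
      by (subst prod_permute_lessThan[OF s, symmetric]) (simp add: permutes_inverses(2)[OF s])
    moreover have "sign (inv \<sigma>) = sign \<sigma>"
      using s by (meson finite_lessThan permutation_permutes sign_inverse)
    ultimately show "of_int (sign (inv \<sigma>)) * (\<Prod>i<k. cnj (A $ h (inv \<sigma> i) $ f i))
      = of_int (sign \<sigma>) * (\<Prod>i<k. cnj (A $ h i $ f (\<sigma> i)))" by simp
  qed simp
  also have "\<dots> = cnj (tuple_minor k A h f)" by (simp add: tuple_minor_def cnj_sum)
  finally show ?thesis .
qed

lemma tuple_minor_principal:
  assumes f: "inj_on f {..<k}"
  shows "tuple_minor k A f f = principal_minor A (f ` {..<k})"
proof -
  let ?S = "f ` {..<k}"
  let ?m = "map_permutation {..<k} f"
  let ?g = "inv_into {..<k} f"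
  have bf: "bij_betw f {..<k} ?S" using f by (simp add: bij_betw_def)
  have bg: "bij_betw ?g ?S {..<k}" using bf by (rule bij_betw_inv_into)
  show ?thesis unfolding tuple_minor_def principal_minor_def
  proof (rule sum.reindex_bij_witness[where j = ?m and i = "map_permutation ?S ?g"])
    fix \<sigma> assume "\<sigma> \<in> {\<sigma>. \<sigma> permutes {..<k}}"
    hence s: "\<sigma> permutes {..<k}" by simp
    show "map_permutation ?S ?g (?m \<sigma>) = \<sigma>"
      by (rule map_permutation_compose_inv[OF bf s]) (use f in auto)
    show "?m \<sigma> \<in> {\<sigma>. \<sigma> permutes ?S}" using map_permutation_permutes[OF bf s] by simp
    have "(\<Prod>i\<in>?S. A $ i $ ?m \<sigma> i) = (\<Prod>i<k. A $ f i $ f (\<sigma> i))"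
      by (subst prod.reindex[OF f]) (simp add: map_permutation_apply[OF f])
    thus "of_int (sign (?m \<sigma>)) * (\<Prod>i\<in>?S. A $ i $ ?m \<sigma> i)
        = of_int (sign \<sigma>) * (\<Prod>i<k. A $ f i $ f (\<sigma> i))"
      using sign_map_permutation[OF f s] by simp
  next
    fix \<sigma> assume "\<sigma> \<in> {\<sigma>. \<sigma> permutes ?S}"
    hence s: "\<sigma> permutes ?S" by simp
    show "?m (map_permutation ?S ?g \<sigma>) = \<sigma>"
      by (rule map_permutation_compose_inv[OF bg s]) (auto intro: f_inv_into_f)
    show "map_permutation ?S ?g \<sigma> \<in> {\<sigma>. \<sigma> permutes {..<k}}"
      using map_permutation_permutes[OF bg s] by simp
  qed
qed

lemma card_tuples_onto:
  fixes S :: "'n::finite set"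
  assumes S: "card S = k"
  shows "card {f \<in> tuples k. inj_on f {..<k} \<and> f ` {..<k} = S} = fact k"
proof -
  have "{f \<in> tuples k. inj_on f {..<k} \<and> f ` {..<k} = S} = {f \<in> {..<k} \<rightarrow>\<^sub>E S. inj_on f {..<k}}"
  proof (intro equalityI subsetI)
    fix f assume "f \<in> {f \<in> tuples k. inj_on f {..<k} \<and> f ` {..<k} = S}"
    thus "f \<in> {f \<in> {..<k} \<rightarrow>\<^sub>E S. inj_on f {..<k}}"
      by (auto simp: tuples_def PiE_def)
  next
    fix f assume f: "f \<in> {f \<in> {..<k} \<rightarrow>\<^sub>E S. inj_on f {..<k}}"
    have "f ` {..<k} \<subseteq> S" using f by auto
    moreover have "card (f ` {..<k}) = card S" using f S by (simp add: card_image)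
    ultimately have "f ` {..<k} = S" by (simp add: card_subset_eq)
    thus "f \<in> {f \<in> tuples k. inj_on f {..<k} \<and> f ` {..<k} = S}"
      using f by (auto simp: tuples_def PiE_def)
  qed
  also have "card \<dots> = (\<Prod>i<k. k - i)"
    using card_inj_on_subset_funcset[of "{..<k}" S "{..<k}"] S by (simp add: atLeast0LessThan)
  also have "\<dots> = fact k" by (simp add: fact_prod_rev atLeast0LessThan)
  finally show ?thesis .
qed

lemma sum_principal_minors:
  fixes A :: "complex^'n^'n"
  shows "(\<Sum>f\<in>tuples k. tuple_minor k A f f)
       = of_nat (fact k) * (\<Sum>S | card S = k. principal_minor A S)"
proof -
  have "(\<Sum>f\<in>tuples k. tuple_minor k A f f)
      = (\<Sum>f\<in>{f\<in>tuples k. inj_on f {..<k}}. principal_minor A (f ` {..<k}))"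
    by (rule sum.mono_neutral_cong_right) (auto simp: tuple_minor_noninj tuple_minor_principal)
  also have "\<dots> = (\<Sum>S | card S = k. \<Sum>f\<in>{f\<in>{f\<in>tuples k. inj_on f {..<k}}. f ` {..<k} = S}.
      principal_minor A (f ` {..<k}))"
    by (rule sum.group[symmetric]) (auto simp: card_image)
  also have "\<dots> = (\<Sum>S | card S = k. of_nat (fact k) * principal_minor A S)"
  proof (rule sum.cong)
    fix S :: "'n set" assume "S \<in> {S. card S = k}"
    thus "(\<Sum>f\<in>{f\<in>{f\<in>tuples k. inj_on f {..<k}}. f ` {..<k} = S}. principal_minor A (f ` {..<k}))
      = of_nat (fact k) * principal_minor A S"
      using card_tuples_onto[of S k] by (simp add: conj_assoc)
  qed simp
  finally show ?thesis by (simp add: sum_distrib_left)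
qed

text \<open>
  Expanding each factor of the Leibniz formula, \<open>S\<close> is the set of positions where the entry of \<open>A\<close> is
  chosen; at the others the diagonal entry \<open>X\<close> must be chosen, which forces the permutation to fix them.
\<close>
lemma charpoly_expansion:
  fixes A :: "complex^'n^'n"
  shows "charpoly A = (\<Sum>S\<in>UNIV. monom ((-1) ^ card S * principal_minor A S) (CARD('n) - card S))"
proof -
  have "charpoly A = (\<Sum>\<sigma> | \<sigma> permutes (UNIV::'n set). of_int (sign \<sigma>) *
      (\<Prod>i\<in>UNIV. [:- A $ i $ \<sigma> i:] + (if i = \<sigma> i then [:0, 1:] else 0)))"
    by (simp add: charpoly_def det_def diff_conv_add_uminus add.commute del: add_uminus_conv_diff)
  also have "\<dots> = (\<Sum>\<sigma> | \<sigma> permutes (UNIV::'n set). \<Sum>S\<in>UNIV. of_int (sign \<sigma>) *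
      ((\<Prod>i\<in>S. [:- A $ i $ \<sigma> i:]) * (\<Prod>i\<in>-S. if i = \<sigma> i then [:0, 1:] else 0)))"
    by (subst prod_add) (simp_all add: sum_distrib_left Compl_eq_Diff_UNIV)
  also have "\<dots> = (\<Sum>S\<in>UNIV. \<Sum>\<sigma> | \<sigma> permutes (UNIV::'n set). of_int (sign \<sigma>) *
      ((\<Prod>i\<in>S. [:- A $ i $ \<sigma> i:]) * (\<Prod>i\<in>-S. if i = \<sigma> i then [:0, 1:] else 0)))"
    by (rule sum.swap)
  also have "\<dots> = (\<Sum>S\<in>UNIV. monom ((-1) ^ card S * principal_minor A S) (CARD('n) - card S))"
  proof (rule sum.cong)
    fix S :: "'n set"
    have "(\<Sum>\<sigma> | \<sigma> permutes (UNIV::'n set). of_int (sign \<sigma>) *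
      ((\<Prod>i\<in>S. [:- A $ i $ \<sigma> i:]) * (\<Prod>i\<in>-S. if i = \<sigma> i then [:0, 1:] else 0)))
      = (\<Sum>\<sigma> | \<sigma> permutes S. of_int (sign \<sigma>) * ((\<Prod>i\<in>S. [:- A $ i $ \<sigma> i:]) * [:0, 1:] ^ (CARD('n) - card S)))"
    proof (rule sum.mono_neutral_cong_right)
      show "{\<sigma>. \<sigma> permutes S} \<subseteq> {\<sigma>. \<sigma> permutes (UNIV::'n set)}"
        by (auto intro: permutes_subset)
      show "\<forall>\<sigma>\<in>{\<sigma>. \<sigma> permutes (UNIV::'n set)} - {\<sigma>. \<sigma> permutes S}. of_int (sign \<sigma>) *
        ((\<Prod>i\<in>S. [:- A $ i $ \<sigma> i:]) * (\<Prod>i\<in>-S. if i = \<sigma> i then [:0, 1:] else 0)) = 0"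
      proof
        fix \<sigma> assume s: "\<sigma> \<in> {\<sigma>. \<sigma> permutes (UNIV::'n set)} - {\<sigma>. \<sigma> permutes S}"
        then obtain i where "i \<in> -S" "\<sigma> i \<noteq> i" unfolding permutes_def by auto
        hence "\<exists>i\<in>-S. i \<noteq> \<sigma> i" by metis
        hence "(\<Prod>i\<in>-S. if i = \<sigma> i then [:0, 1::complex:] else 0) = 0"
          by (auto intro!: prod_zero)
        thus "of_int (sign \<sigma>) * ((\<Prod>i\<in>S. [:- A $ i $ \<sigma> i:]) *
          (\<Prod>i\<in>-S. if i = \<sigma> i then [:0, 1:] else 0)) = 0" by simp
      qed
    next
      fix \<sigma> assume "\<sigma> \<in> {\<sigma>. \<sigma> permutes S}"
      hence "(\<Prod>i\<in>-S. if i = \<sigma> i then [:0, 1::complex:] else 0) = (\<Prod>i\<in>-S. [:0, 1:])"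
        by (intro prod.cong) (auto simp: permutes_def)
      also have "\<dots> = [:0, 1:] ^ (CARD('n) - card S)" using card_Diff_subset[of S UNIV] by (simp add: Compl_eq_Diff_UNIV[symmetric])
      finally show "of_int (sign \<sigma>) * ((\<Prod>i\<in>S. [:- A $ i $ \<sigma> i:]) * (\<Prod>i\<in>-S. if i = \<sigma> i then [:0, 1:] else 0))
        = of_int (sign \<sigma>) * ((\<Prod>i\<in>S. [:- A $ i $ \<sigma> i:]) * [:0, 1:] ^ (CARD('n) - card S))" by simp
    qed simp
    also have "\<dots> = (\<Sum>\<sigma> | \<sigma> permutes S. monom ((-1) ^ card S * (of_int (sign \<sigma>) * (\<Prod>i\<in>S. A $ i $ \<sigma> i))) (CARD('n) - card S))"
    proof (rule sum.cong)
      fix \<sigma>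
      have "(\<Prod>i\<in>S. [:- A $ i $ \<sigma> i:]) = [:(-1) ^ card S * (\<Prod>i\<in>S. A $ i $ \<sigma> i):]"
        by (induction S rule: infinite_finite_induct) (auto simp: one_pCons)
      moreover have "[:0, 1::complex:] ^ m = monom 1 m" for m
        by (simp add: monom_altdef)
      moreover have "of_int (sign \<sigma>) = [:of_int (sign \<sigma>) :: complex:]" by (simp add: of_int_poly)
      ultimately show "of_int (sign \<sigma>) * ((\<Prod>i\<in>S. [:- A $ i $ \<sigma> i:]) * [:0, 1:] ^ (CARD('n) - card S))
        = monom ((-1) ^ card S * (of_int (sign \<sigma>) * (\<Prod>i\<in>S. A $ i $ \<sigma> i))) (CARD('n) - card S)"
        by (simp add: smult_monom mult_ac)
    qed simp
    also have "\<dots> = monom ((-1) ^ card S * principal_minor A S) (CARD('n) - card S)"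
      by (simp add: principal_minor_def sum_distrib_left monom_sum)
    finally show "(\<Sum>\<sigma> | \<sigma> permutes (UNIV::'n set). of_int (sign \<sigma>) *
      ((\<Prod>i\<in>S. [:- A $ i $ \<sigma> i:]) * (\<Prod>i\<in>-S. if i = \<sigma> i then [:0, 1:] else 0)))
      = monom ((-1) ^ card S * principal_minor A S) (CARD('n) - card S)" .
  qed simp
  finally show ?thesis .
qed

lemma coeff_charpoly:
  fixes A :: "complex^'n^'n"
  assumes "k \<le> CARD('n)"
  shows "coeff (charpoly A) (CARD('n) - k) = (-1) ^ k * (\<Sum>S | card S = k. principal_minor A S)"
proof -
  have "coeff (charpoly A) (CARD('n) - k) =
     (\<Sum>S\<in>UNIV. if card S = k then (-1) ^ k * principal_minor A S else 0)"
    unfolding charpoly_expansion coeff_sum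
  proof (rule sum.cong)
    fix S :: "'n set"
    have "card S \<le> CARD('n)" by (simp add: card_mono)
    thus "coeff (monom ((- 1) ^ card S * principal_minor A S) (CARD('n) - card S)) (CARD('n) - k)
       = (if card S = k then (-1) ^ k * principal_minor A S else 0)"
      using assms by auto
  qed simp
  also have "\<dots> = (\<Sum>S | card S = k. (-1) ^ k * principal_minor A S)"
    by (rule sum.mono_neutral_cong_right) auto
  finally show ?thesis by (simp add: sum_distrib_left)
qed

text \<open>
  The squared Hilbert--Schmidt norm of the \<open>k\<close>-th exterior power of \<open>A\<close>. Each of the two summations runs
  over all \<open>k!\<close> orderings of a \<open>k\<close>-subset, which the denominator compensates.
\<close>
definition minor_sq_sum :: "nat \<Rightarrow> complex^'n^'n \<Rightarrow> real" where
  "minor_sq_sum k A = (\<Sum>f\<in>tuples k. \<Sum>g\<in>tuples k. (cmod (tuple_minor k A f g))\<^sup>2) / (fact k)\<^sup>2"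

text \<open>
  By Cauchy--Binet the principal minors of \<open>A\<^sup>* A\<close> are sums of squared moduli of minors of \<open>A\<close>.
\<close>
lemma coeff_charpoly_gram:
  fixes A :: "complex^'n^'n"
  assumes "k \<le> CARD('n)"
  shows "coeff (charpoly (conj_transpose A ** A)) (CARD('n) - k) = (-1) ^ k * of_real (minor_sq_sum k A)"
proof -
  let ?F = "of_nat (fact k) :: complex"
  have "?F * (?F * (\<Sum>S | card S = k. principal_minor (conj_transpose A ** A) S))
      = (\<Sum>f\<in>tuples k. ?F * tuple_minor k (conj_transpose A ** A) f f)"
    by (simp only: sum_principal_minors[symmetric] sum_distrib_left[symmetric])
  also have "\<dots> = (\<Sum>f\<in>tuples k. \<Sum>h\<in>tuples k. of_real ((cmod (tuple_minor k A h f))\<^sup>2))"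
    unfolding tuple_minor_mult[symmetric] tuple_minor_conj_transpose
    by (simp add: complex_norm_square mult.commute del: of_real_power)
  also have "\<dots> = (\<Sum>h\<in>tuples k. \<Sum>f\<in>tuples k. of_real ((cmod (tuple_minor k A h f))\<^sup>2))"
    by (rule sum.swap)
  also have "\<dots> = ?F * ?F * of_real (minor_sq_sum k A)"
    by (simp add: minor_sq_sum_def power2_eq_square)
  finally have "(\<Sum>S | card S = k. principal_minor (conj_transpose A ** A) S) = of_real (minor_sq_sum k A)"
    by (simp add: mult.assoc)
  thus ?thesis by (simp add: coeff_charpoly[OF assms])
qed

lemma Cauchy_Schwarz_sum_complex:
  fixes a b :: "'i \<Rightarrow> complex"
  shows "(cmod (\<Sum>i\<in>I. a i * b i))\<^sup>2 \<le> (\<Sum>i\<in>I. (cmod (a i))\<^sup>2) * (\<Sum>i\<in>I. (cmod (b i))\<^sup>2)"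
proof -
  have "cmod (\<Sum>i\<in>I. a i * b i) \<le> (\<Sum>i\<in>I. cmod (a i) * cmod (b i))"
    by (rule order_trans[OF norm_sum]) (simp add: norm_mult)
  hence "(cmod (\<Sum>i\<in>I. a i * b i))\<^sup>2 \<le> (\<Sum>i\<in>I. cmod (a i) * cmod (b i))\<^sup>2"
    by (rule power_mono) simp
  also have "\<dots> \<le> (\<Sum>i\<in>I. (cmod (a i))\<^sup>2) * (\<Sum>i\<in>I. (cmod (b i))\<^sup>2)"
    by (rule Cauchy_Schwarz_ineq_sum)
  finally show ?thesis .
qed

text \<open>
  The formula for minors of a product, with the Cauchy--Schwarz inequality applied to each of them.
\<close>
lemma minor_sq_sum_mult_le:
  "minor_sq_sum k (A ** B) \<le> minor_sq_sum k A * minor_sq_sum k B"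
proof -
  let ?T = "tuples k"
  let ?n = "\<lambda>A. \<Sum>f\<in>?T. \<Sum>g\<in>?T. (cmod (tuple_minor k A f g))\<^sup>2"
  have "(fact k)\<^sup>2 * ?n (A ** B) = (\<Sum>f\<in>?T. \<Sum>g\<in>?T. (cmod (of_nat (fact k) * tuple_minor k (A ** B) f g))\<^sup>2)"
    by (simp add: sum_distrib_left norm_mult power_mult_distrib)
  also have "\<dots> = (\<Sum>f\<in>?T. \<Sum>g\<in>?T. (cmod (\<Sum>h\<in>?T. tuple_minor k A f h * tuple_minor k B h g))\<^sup>2)"
    by (simp only: tuple_minor_mult)
  also have "\<dots> \<le> (\<Sum>f\<in>?T. \<Sum>g\<in>?T. (\<Sum>h\<in>?T. (cmod (tuple_minor k A f h))\<^sup>2) * (\<Sum>h\<in>?T. (cmod (tuple_minor k B h g))\<^sup>2))"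
    by (intro sum_mono Cauchy_Schwarz_sum_complex)
  also have "\<dots> = ?n A * (\<Sum>g\<in>?T. \<Sum>h\<in>?T. (cmod (tuple_minor k B h g))\<^sup>2)"
    by (simp only: sum_distrib_left[symmetric] sum_distrib_right[symmetric])
  also have "(\<Sum>g\<in>?T. \<Sum>h\<in>?T. (cmod (tuple_minor k B h g))\<^sup>2) = ?n B"
    by (rule sum.swap)
  finally have *: "(fact k)\<^sup>2 * ?n (A ** B) \<le> ?n A * ?n B" .
  have "minor_sq_sum k (A ** B) = ((fact k)\<^sup>2 * ?n (A ** B)) / ((fact k)\<^sup>2 * (fact k)\<^sup>2)"
    by (simp add: minor_sq_sum_def power2_eq_square)
  also have "\<dots> \<le> (?n A * ?n B) / ((fact k)\<^sup>2 * (fact k)\<^sup>2)"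
    by (rule divide_right_mono[OF *]) simp
  finally show ?thesis by (simp add: minor_sq_sum_def)
qed

section \<open>Singular values and their products\<close>

lemma poly_charpoly: "poly (charpoly A) x = det (mat x - A)"
  unfolding charpoly_def det_def
  by (auto simp: poly_sum poly_prod mat_def intro!: sum.cong prod.cong)

lemma degree_charpoly:
  fixes A :: "complex^'n^'n"
  shows "degree (charpoly A) = CARD('n)"
proof (rule antisym)
  show "degree (charpoly A) \<le> CARD('n)"
    unfolding charpoly_expansion
    by (intro degree_sum_le) (simp_all add: order_trans[OF degree_monom_le])
  have "coeff (charpoly A) (CARD('n) - 0) = 1"
    by (subst coeff_charpoly) (auto simp: principal_minor_def)
  thus "CARD('n) \<le> degree (charpoly A)" by (intro le_degree) auto
qed

lemma lead_coeff_charpoly: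
  fixes A :: "complex^'n^'n"
  shows "lead_coeff (charpoly A) = 1"
  using coeff_charpoly[of 0 A] by (simp add: degree_charpoly principal_minor_def)

text \<open>
  If \<open>A\<^sup>* A v = x v\<close> with \<open>v \<noteq> 0\<close>, then \<open>x \<parallel>v\<parallel>\<^sup>2 = \<parallel>A v\<parallel>\<^sup>2\<close>. Together with the factorization of complex
  polynomials this is all that is used about \<open>A\<^sup>* A\<close>; a diagonalization is avoided.
\<close>
lemma gram_eigenvalue_nonneg:
  fixes A :: "complex^'n^'n"
  assumes "poly (charpoly (conj_transpose A ** A)) x = 0"
  shows "x = of_real (Re x)" "0 \<le> Re x"
proof -
  let ?M = "conj_transpose A ** A"
  have "\<not> invertible (mat x - ?M)"
    using assms by (simp add: poly_charpoly invertible_det_nz)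
  then obtain v where v: "v \<noteq> 0" "(mat x - ?M) *v v = 0"
    using matrix_left_invertible_ker invertible_left_inverse by metis
  have Mv: "?M *v v = x *s v"
  proof -
    have "mat x *v v = x *s v"
      by (simp add: vec_eq_iff matrix_vector_mult_def mat_def if_distrib[where f = "\<lambda>y. y * _"] cong: if_cong)
    thus ?thesis using v(2) by (simp add: matrix_vector_mult_diff_rdistrib)
  qed
  let ?w = "A *v v"
  have "of_real (\<Sum>i\<in>UNIV. (cmod (?w $ i))\<^sup>2) = (\<Sum>i\<in>UNIV. cnj (v $ i) * ((?M *v v) $ i))"
  proof -
    have "(\<Sum>i\<in>UNIV. cnj (v $ i) * ((?M *v v) $ i))
        = (\<Sum>i\<in>UNIV. \<Sum>l\<in>UNIV. cnj (A $ l $ i * v $ i) * ?w $ l)"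
      unfolding matrix_vector_mul_assoc[symmetric] matrix_vector_mult_def[of "conj_transpose A"]
      by (simp add: conj_transpose_def sum_distrib_left mult_ac)
    also have "\<dots> = (\<Sum>l\<in>UNIV. cnj (?w $ l) * ?w $ l)"
      by (subst sum.swap) (simp add: matrix_vector_mult_def sum_distrib_right cnj_sum)
    finally show ?thesis by (simp add: complex_norm_square mult.commute del: of_real_power)
  qed
  also have "\<dots> = x * of_real (\<Sum>i\<in>UNIV. (cmod (v $ i))\<^sup>2)"
    by (simp add: Mv sum_distrib_left complex_norm_square mult_ac del: of_real_power)
  finally have eq: "of_real (\<Sum>i\<in>UNIV. (cmod (?w $ i))\<^sup>2) = x * of_real (\<Sum>i\<in>UNIV. (cmod (v $ i))\<^sup>2)" .
  obtain i where "v $ i \<noteq> 0" using v(1) by (auto simp: vec_eq_iff)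
  hence pos: "(\<Sum>i\<in>UNIV. (cmod (v $ i))\<^sup>2) > 0"
    by (intro sum_pos2[where i = i]) auto
  have x: "x = of_real ((\<Sum>i\<in>UNIV. (cmod (?w $ i))\<^sup>2) / (\<Sum>i\<in>UNIV. (cmod (v $ i))\<^sup>2))"
    using eq pos by (simp only: of_real_divide) (simp add: field_simps del: of_real_sum)
  show "x = of_real (Re x)" by (subst (1 2) x) simp
  show "0 \<le> Re x" by (subst x) (simp add: sum_nonneg pos less_imp_le)
qed

lemma prod_mset_mset_nth:
  "(\<Prod>x\<in>#mset xs. f x) = (\<Prod>i<length xs. f (xs ! i) :: 'b::comm_monoid_mult)"
proof -
  have "(\<Prod>x\<in>#mset xs. f x) = prod_list (map f xs)"
    by (metis mset_map prod_mset_prod_list)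
  thus ?thesis by (simp add: prod.list_conv_set_nth atLeast0LessThan)
qed

lemma singular_values_facts:
  fixes A :: "complex^'n^'n"
  shows length_singular_values: "length (singular_values A) = CARD('n)"
    and sorted_singular_values: "sorted (rev (singular_values A))"
    and singular_values_nonneg: "\<And>x. x \<in> set (singular_values A) \<Longrightarrow> 0 \<le> x"
    and charpoly_gram_factors: "charpoly (conj_transpose A ** A) =
          (\<Prod>i<CARD('n). [:- of_real ((singular_values A ! i)\<^sup>2), 1:])"
proof -
  let ?p = "charpoly (conj_transpose A ** A)"
  have p0: "?p \<noteq> 0" using lead_coeff_charpoly[of "conj_transpose A ** A"] by auto
  have m: "mset (singular_values A) = image_mset (\<lambda>x. sqrt (Re x)) (proots ?p)"
    by (simp add: singular_values_def)
  show len: "length (singular_values A) = CARD('n)"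
    using arg_cong[OF m, of size] by (simp add: size_proots_complex degree_charpoly)
  show "sorted (rev (singular_values A))" by (simp add: singular_values_def)
  have root: "x = of_real (Re x) \<and> 0 \<le> Re x" if "x \<in># proots ?p" for x
    using that p0 gram_eigenvalue_nonneg[of A x] by simp
  show "0 \<le> x" if "x \<in> set (singular_values A)" for x
  proof -
    have "x \<in># image_mset (\<lambda>x. sqrt (Re x)) (proots ?p)" using that m by (metis set_mset_mset)
    thus ?thesis using root by auto
  qed
  have "image_mset (\<lambda>s. of_real (s\<^sup>2)) (mset (singular_values A)) = proots ?p"
  proof -
    have "image_mset (\<lambda>s. of_real (s\<^sup>2)) (mset (singular_values A)) = image_mset (\<lambda>x. x) (proots ?p)"
      unfolding m multiset.map_comp
      by (rule image_mset_cong) (use root in \<open>auto simp del: of_real_power simp flip: of_real_power\<close>)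
    thus ?thesis by simp
  qed
  from this[symmetric] have "(\<Prod>x\<in>#proots ?p. [:-x, 1:])
      = (\<Prod>s\<in>#mset (singular_values A). [:- of_real (s\<^sup>2), 1:])"
    by (simp add: multiset.map_comp comp_def)
  also have "\<dots> = (\<Prod>i<CARD('n). [:- of_real ((singular_values A ! i)\<^sup>2), 1:])"
    by (subst prod_mset_mset_nth) (simp add: len)
  finally show "?p = (\<Prod>i<CARD('n). [:- of_real ((singular_values A ! i)\<^sup>2), 1:])"
    using complex_poly_decompose_multiset[of ?p] by (simp add: lead_coeff_charpoly)
qed

text \<open>
  The converse of the factorization: it identifies the singular values in the closed graph argument
  by which their continuity is proved.
\<close>
lemma singular_values_unique:
  fixes A :: "complex^'n^'n"
  assumes len: "length xs = CARD('n)" and sorted: "sorted (rev xs)"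
    and nonneg: "\<And>x. x \<in> set xs \<Longrightarrow> 0 \<le> x"
    and p: "charpoly (conj_transpose A ** A) = (\<Prod>i<CARD('n). [:- of_real ((xs ! i)\<^sup>2), 1:])"
  shows "singular_values A = xs"
proof -
  have "proots (charpoly (conj_transpose A ** A)) = (\<Sum>i<CARD('n). {#of_real ((xs ! i)\<^sup>2)#})"
    unfolding p by (subst proots_prod) auto
  also have "\<dots> = image_mset (\<lambda>s. of_real (s\<^sup>2)) (mset xs)"
  proof -
    have "(\<Sum>i<length ys. {#f (ys ! i)#}) = image_mset f (mset ys)" for ys and f :: "real \<Rightarrow> complex"
      by (induction ys) (auto simp: sum.lessThan_Suc_shift simp del: sum.lessThan_Suc)
    from this[where ys = xs] len show ?thesis by simp
  qed
  finally have pr: "proots (charpoly (conj_transpose A ** A)) = image_mset (\<lambda>s. of_real (s\<^sup>2)) (mset xs)" .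
  have "image_mset (\<lambda>x. sqrt (Re x)) (proots (charpoly (conj_transpose A ** A)))
      = image_mset (\<lambda>s. s) (mset xs)" unfolding pr
    unfolding multiset.map_comp comp_def using nonneg by (intro image_mset_cong) (auto simp del: of_real_power)
  hence "image_mset (\<lambda>x. sqrt (Re x)) (proots (charpoly (conj_transpose A ** A))) = mset xs" by simp
  hence "singular_values A = rev (sort xs)" by (simp add: singular_values_def)
  also have "sort xs = rev xs" using sorted by (intro properties_for_sort) simp_all
  finally show ?thesis by simp
qed

lemma coeff_prod_linear_factors:
  fixes a :: "nat \<Rightarrow> 'a::comm_ring_1"
  assumes "k \<le> N"
  shows "coeff (\<Prod>i<N. [:- a i, 1:]) (N - k) = (-1) ^ k * (\<Sum>S | S \<subseteq> {..<N} \<and> card S = k. \<Prod>i\<in>S. a i)"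
proof -
  have "(\<Prod>i<N. [:- a i, 1:]) = (\<Prod>i<N. [:- a i:] + [:0, 1:])" by simp
  also have "\<dots> = (\<Sum>S\<in>Pow {..<N}. (\<Prod>i\<in>S. [:- a i:]) * [:0, 1:] ^ card ({..<N} - S))"
    by (subst prod_add) simp_all
  also have "\<dots> = (\<Sum>S\<in>Pow {..<N}. monom ((-1) ^ card S * (\<Prod>i\<in>S. a i)) (N - card S))"
  proof (rule sum.cong)
    fix S assume "S \<in> Pow {..<N}"
    hence "card ({..<N} - S) = N - card S"
      by (subst card_Diff_subset) (auto intro: finite_subset)
    moreover have "(\<Prod>i\<in>S. [:- a i:]) = [:(-1) ^ card S * (\<Prod>i\<in>S. a i):]"
      by (induction S rule: infinite_finite_induct) (auto simp: one_pCons)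
    ultimately show "(\<Prod>i\<in>S. [:- a i:]) * [:0, 1:] ^ card ({..<N} - S)
      = monom ((-1) ^ card S * (\<Prod>i\<in>S. a i)) (N - card S)" by (simp add: monom_altdef)
  qed simp
  also have "coeff \<dots> (N - k) = (\<Sum>S\<in>Pow {..<N}. if card S = k then (-1) ^ k * (\<Prod>i\<in>S. a i) else 0)"
    unfolding coeff_sum
  proof (rule sum.cong)
    fix S assume "S \<in> Pow {..<N}"
    hence "card S \<le> N" using card_mono[of "{..<N}" S] by auto
    thus "coeff (monom ((-1) ^ card S * (\<Prod>i\<in>S. a i)) (N - card S)) (N - k)
        = (if card S = k then (-1) ^ k * (\<Prod>i\<in>S. a i) else 0)"
      using assms by auto
  qed simp
  also have "\<dots> = (\<Sum>S | S \<subseteq> {..<N} \<and> card S = k. (-1) ^ k * (\<Prod>i\<in>S. a i))"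
    by (rule sum.mono_neutral_cong_right) auto
  finally show ?thesis by (simp add: sum_distrib_left)
qed

text \<open>
  Both sides are, up to the same sign, a coefficient of the characteristic polynomial of \<open>A\<^sup>* A\<close>.
\<close>
lemma minor_sq_sum_eq_symmetric_function:
  fixes A :: "complex^'n^'n"
  assumes "k \<le> CARD('n)"
  shows "minor_sq_sum k A =
    (\<Sum>S | S \<subseteq> {..<CARD('n)} \<and> card S = k. \<Prod>i\<in>S. (singular_values A ! i)\<^sup>2)"
proof -
  have "(-1) ^ k * complex_of_real (minor_sq_sum k A) = (-1) ^ k * of_real
    (\<Sum>S | S \<subseteq> {..<CARD('n)} \<and> card S = k. \<Prod>i\<in>S. (singular_values A ! i)\<^sup>2)"
    unfolding coeff_charpoly_gram[OF assms, symmetric] charpoly_gram_factors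
    by (subst coeff_prod_linear_factors[OF assms]) simp
  thus ?thesis by (simp only: mult_cancel_left of_real_eq_iff) simp
qed

lemma prod_le_prod_initial:
  fixes a :: "nat \<Rightarrow> real"
  assumes "antimono a" "\<And>i. 0 \<le> a i" "finite S" "card S = k"
  shows "(\<Prod>i\<in>S. a i) \<le> (\<Prod>i<k. a i)"
  using assms(3,4)
proof (induction k arbitrary: S)
  case (Suc k)
  have ne: "S \<noteq> {}" using Suc.prems by auto
  let ?m = "Max S"
  have m: "?m \<in> S" using Suc.prems ne by auto
  have "S \<subseteq> {..?m}" using Suc.prems by auto
  hence "card S \<le> Suc ?m" by (metis card_atMost card_mono finite_atMost)
  hence km: "k \<le> ?m" using Suc.prems by simp
  have "(\<Prod>i\<in>S. a i) = a ?m * (\<Prod>i\<in>S - {?m}. a i)" using m Suc.prems by (simp add: prod.remove)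
  also have "\<dots> \<le> a k * (\<Prod>i<k. a i)"
  proof (rule mult_mono)
    show "a ?m \<le> a k" using km assms(1) by (auto dest: antimonoD)
    show "(\<Prod>i\<in>S - {?m}. a i) \<le> (\<Prod>i<k. a i)" using Suc.prems m by (intro Suc.IH) auto
  qed (auto intro: prod_nonneg assms)
  finally show ?case by (simp add: mult.commute)
qed simp

definition singular_prod :: "nat \<Rightarrow> complex^'n^'n \<Rightarrow> real" where
  "singular_prod k A = (\<Prod>j=1..k. singular_value j A)"

lemma singular_prod_nth: "singular_prod k A = (\<Prod>i<k. singular_values A ! i)"
  unfolding singular_prod_def singular_value_def
  by (rule prod.reindex_bij_witness[where i = Suc and j = "\<lambda>j. j - 1"]) auto

lemma singular_value_nonneg:
  fixes A :: "complex^'n^'n"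
  assumes "1 \<le> j" "j \<le> CARD('n)"
  shows "0 \<le> singular_value j A"
  unfolding singular_value_def
  by (rule singular_values_nonneg[where A = A]) (use assms in \<open>simp add: length_singular_values\<close>)

lemma singular_values_nth_antimono:
  fixes A :: "complex^'n^'n"
  assumes "i \<le> j" "j < CARD('n)"
  shows "singular_values A ! j \<le> singular_values A ! i"
  using sorted_singular_values[of A] assms by (simp add: sorted_rev_nth_mono length_singular_values)

text \<open>
  In the elementary symmetric function the product of the \<open>k\<close> largest values is one of the terms, and
  it is the largest of at most \<open>2\<^sup>N\<close> terms.
\<close>
lemma minor_sq_sum_bounds:
  fixes A :: "complex^'n^'n"
  assumes k: "k \<le> CARD('n)"
  shows "(singular_prod k A)\<^sup>2 \<le> minor_sq_sum k A"
    and "minor_sq_sum k A \<le> 2 ^ CARD('n) * (singular_prod k A)\<^sup>2"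
proof -
  let ?N = "CARD('n)"
  define a where "a i = (if i < ?N then (singular_values A ! i)\<^sup>2 else 0)" for i
  have nn: "0 \<le> a i" for i by (simp add: a_def)
  have sv0: "0 \<le> singular_values A ! i" if "i < ?N" for i
    by (rule singular_values_nonneg[where A = A]) (simp add: that length_singular_values)
  have anti: "antimono a"
    by (rule antimonoI) (auto simp: a_def sv0 intro!: power_mono singular_values_nth_antimono)
  have e: "minor_sq_sum k A = (\<Sum>S | S \<subseteq> {..<?N} \<and> card S = k. \<Prod>i\<in>S. a i)"
    unfolding minor_sq_sum_eq_symmetric_function[OF k]
    by (intro sum.cong prod.cong) (auto simp: a_def)
  have p: "(singular_prod k A)\<^sup>2 = (\<Prod>i<k. a i)"
    unfolding singular_prod_nth prod_power_distrib using k by (intro prod.cong) (auto simp: a_def)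
  have fin: "finite {S. S \<subseteq> {..<?N} \<and> card S = k}"
    by (rule finite_subset[of _ "Pow {..<?N}"]) auto
  show "(singular_prod k A)\<^sup>2 \<le> minor_sq_sum k A"
    unfolding e p using k
    by (intro member_le_sum[where i = "{..<k}" and f = "\<lambda>S. prod a S"] fin) (auto intro!: prod_nonneg nn)
  have "minor_sq_sum k A \<le> (\<Sum>S | S \<subseteq> {..<?N} \<and> card S = k. \<Prod>i<k. a i)"
    unfolding e
    by (intro sum_mono prod_le_prod_initial anti nn) (auto intro: finite_subset)
  also have "\<dots> = card {S. S \<subseteq> {..<?N} \<and> card S = k} * (singular_prod k A)\<^sup>2" by (simp add: p)
  also have "\<dots> \<le> 2 ^ ?N * (singular_prod k A)\<^sup>2"
  proof (rule mult_right_mono)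
    have "card {S. S \<subseteq> {..<?N} \<and> card S = k} \<le> card (Pow {..<?N})"
      by (rule card_mono) auto
    thus "real (card {S. S \<subseteq> {..<?N} \<and> card S = k}) \<le> 2 ^ ?N" by (simp add: card_Pow) 
  qed simp
  finally show "minor_sq_sum k A \<le> 2 ^ ?N * (singular_prod k A)\<^sup>2" .
qed

lemma det_conj_transpose: "det (conj_transpose A) = cnj (det A)"
proof -
  have "conj_transpose A = (\<chi> i j. cnj (Finite_Cartesian_Product.transpose A $ i $ j))"
    by (simp add: conj_transpose_def Finite_Cartesian_Product.transpose_def)
  hence "det (conj_transpose A) = cnj (det (Finite_Cartesian_Product.transpose A))"
    by (simp add: det_def cnj_sum)
  thus ?thesis by simp
qed

lemma singular_prod_full:
  fixes A :: "complex^'n^'n"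
  shows "singular_prod CARD('n) A = cmod (det A)"
proof -
  have "poly (charpoly (conj_transpose A ** A)) 0 = (-1) ^ CARD('n) * of_real ((singular_prod CARD('n) A)\<^sup>2)"
    unfolding charpoly_gram_factors poly_prod singular_prod_nth prod_power_distrib
    by (simp add: prod_uminus)
  moreover have "poly (charpoly (conj_transpose A ** A)) 0 = (-1) ^ CARD('n) * of_real ((cmod (det A))\<^sup>2)"
  proof -
    have "mat 0 - conj_transpose A ** A = (- mat 1) ** (conj_transpose A ** A)"
      by (simp add: vec_eq_iff mat_def matrix_matrix_mult_def if_distrib[where f = "\<lambda>y. y * _"] sum_negf cong: if_cong)
    moreover have "det (- mat 1 :: complex^'n^'n) = (-1) ^ CARD('n)"
      by (subst det_diagonal) (auto simp: mat_def)
    ultimately show ?thesis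
      by (simp add: poly_charpoly det_mul det_conj_transpose complex_norm_square mult.commute del: of_real_power)
  qed
  ultimately have "(singular_prod CARD('n) A)\<^sup>2 = (cmod (det A))\<^sup>2"
    by (simp del: of_real_power)
  moreover have "0 \<le> singular_prod CARD('n) A"
    unfolding singular_prod_def by (intro prod_nonneg) (auto intro: singular_value_nonneg)
  ultimately show ?thesis by (simp add: power2_eq_iff_nonneg)
qed

text \<open>
  The product of all singular values is 1. If the \<open>k\<close> largest are all at least 1, so is their product;
  otherwise the remaining ones are at most 1, and their product is the reciprocal.
\<close>
lemma unimodular_singular_values:
  fixes A :: "complex^'n^'n"
  assumes det: "cmod (det A) = 1"
  shows singular_value_pos: "1 \<le> j \<Longrightarrow> j \<le> CARD('n) \<Longrightarrow> 0 < singular_value j A"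
    and singular_prod_ge_1: "k \<le> CARD('n) \<Longrightarrow> 1 \<le> singular_prod k A"
proof -
  let ?N = "CARD('n)"
  have p: "(\<Prod>i<?N. singular_values A ! i) = 1"
    using singular_prod_full[of A] det by (simp add: singular_prod_nth)
  have nn: "0 \<le> singular_values A ! i" if "i < ?N" for i
    by (rule singular_values_nonneg[where A = A]) (simp add: that length_singular_values)
  have pos: "0 < singular_values A ! i" if "i < ?N" for i
  proof -
    have "(\<Prod>i<?N. singular_values A ! i) \<noteq> 0" using p by simp
    hence "singular_values A ! i \<noteq> 0" using that by auto
    thus ?thesis using nn[OF that] by simp
  qed
  show "1 \<le> j \<Longrightarrow> j \<le> CARD('n) \<Longrightarrow> 0 < singular_value j A"
    by (simp add: singular_value_def pos)
  show "1 \<le> singular_prod k A" if k: "k \<le> ?N"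
  proof (cases "\<forall>i<k. 1 \<le> singular_values A ! i")
    case True
    thus ?thesis unfolding singular_prod_nth by (intro prod_ge_1) auto
  next
    case False
    then obtain i where i: "i < k" "singular_values A ! i < 1" by force
    have "singular_values A ! l \<le> 1" if "l \<in> {k..<?N}" for l
      using singular_values_nth_antimono[of i l A] that i by auto
    hence "(\<Prod>l\<in>{k..<?N}. singular_values A ! l) \<le> 1"
      by (intro prod_le_1 conjI nn) auto
    moreover have "(\<Prod>l<?N. singular_values A ! l) = singular_prod k A * (\<Prod>l\<in>{k..<?N}. singular_values A ! l)"
      unfolding singular_prod_nth using k
      by (subst prod.union_disjoint[symmetric]) (auto intro!: prod.cong)
    moreover have "0 < singular_prod k A"
      unfolding singular_prod_nth using pos k by (intro prod_pos) auto
    ultimately show ?thesis using p mult_left_le[of "\<Prod>l\<in>{k..<?N}. singular_values A ! l" "singular_prod k A"]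
      by simp
  qed
qed

section \<open>Continuity of the ordered singular values\<close>

lemma continuous_on_det [continuous_intros]:
  fixes f :: "'a::topological_space \<Rightarrow> complex^'n^'n"
  assumes "continuous_on S f"
  shows "continuous_on S (\<lambda>x. det (f x))"
  unfolding det_def by (intro continuous_intros assms)

lemma continuous_on_matrix_mult [continuous_intros]:
  fixes f :: "'a::topological_space \<Rightarrow> complex^'n^'m" and g :: "'a \<Rightarrow> complex^'k^'n"
  assumes "continuous_on S f" "continuous_on S g"
  shows "continuous_on S (\<lambda>x. f x ** g x)"
  unfolding matrix_matrix_mult_def by (intro continuous_intros assms)

lemma continuous_on_conj_transpose [continuous_intros]:
  assumes "continuous_on S f"
  shows "continuous_on S (\<lambda>x. conj_transpose (f x))"
  unfolding conj_transpose_def by (intro continuous_intros assms)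

lemma continuous_on_minor_sq_sum [continuous_intros]:
  assumes "continuous_on S f"
  shows "continuous_on S (\<lambda>x. minor_sq_sum k (f x))"
  unfolding minor_sq_sum_def tuple_minor_def by (intro continuous_intros assms) auto

lemma singular_value_le_minor_sq_sum:
  fixes A :: "complex^'n^'n"
  assumes "i < CARD('n)"
  shows "singular_values A ! i \<le> sqrt (minor_sq_sum 1 A)"
proof -
  have "singular_values A ! i \<le> singular_values A ! 0"
    by (rule singular_values_nth_antimono) (use assms in auto)
  also have "\<dots> \<le> sqrt (minor_sq_sum 1 A)"
    using minor_sq_sum_bounds(1)[of 1 A] by (intro real_le_rsqrt) (simp add: singular_prod_nth)
  finally show ?thesis .
qed

text \<open>
  On a ball the singular values are bounded, so the closed graph theorem for a compact target applies
  to the vector of ordered singular values. Its graph is closed because it is described by closed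
  conditions: the factorization of the characteristic polynomial of \<open>A\<^sup>* A\<close>, evaluated at every
  \<open>x\<close>, and the ordering.
\<close>
lemma continuous_on_singular_value_cball:
  fixes j :: nat
  assumes j: "1 \<le> j" "j \<le> CARD('n)"
  shows "continuous_on (cball 0 R) (singular_value j :: complex^'n^'n \<Rightarrow> real)"
proof -
  let ?N = "CARD('n)"
  let ?S = "cball 0 R :: (complex^'n^'n) set"
  \<comment> \<open>The target has to be a Euclidean space, so the positions \<open>0, \<dots>, N - 1\<close> are renamed to the index type.\<close>
  obtain b where b: "bij_betw b (UNIV :: 'n set) {..<?N}"
    using ex_bij_betw_finite_nat[of "UNIV :: 'n set"] by (auto simp: atLeast0LessThan)
  let ?c = "inv_into UNIV b"
  have bN: "b i < ?N" for i using b by (auto simp: bij_betw_def)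
  have bc: "b (?c m) = m" if "m < ?N" for m
    using b that by (simp add: bij_betw_inv_into_right)
  have cb: "?c (b i) = i" for i using b by (simp add: bij_betw_inv_into_left)
  define f :: "complex^'n^'n \<Rightarrow> real^'n" where "f A = (\<chi> i. singular_values A ! b i)" for A
  have "compact ((\<lambda>A. minor_sq_sum 1 A) ` ?S)"
    by (intro compact_continuous_image continuous_intros) auto
  then obtain B where B: "\<And>A. A \<in> ?S \<Longrightarrow> minor_sq_sum 1 A \<le> B"
    by (meson bounded_imp_bdd_above compact_imp_bounded bdd_above.E imageI)
  let ?T = "cbox 0 (\<chi> i. sqrt B) :: (real^'n) set"
  have fT: "f A \<in> ?T" if "A \<in> ?S" for A
  proof -
    have "0 \<le> singular_values A ! b i" for i
      by (rule singular_values_nonneg[where A = A]) (simp add: bN length_singular_values)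
    moreover have "singular_values A ! b i \<le> sqrt B" for i
      using singular_value_le_minor_sq_sum[OF bN, of A i] B[OF that]
      by (meson order_trans real_sqrt_le_mono)
    ultimately show ?thesis by (simp add: f_def mem_box_cart)
  qed
  define G where "G = {(A, v :: real^'n) | A v. A \<in> ?S \<and> v \<in> ?T \<and>
     (\<forall>x. det (mat x - conj_transpose A ** A) = (\<Prod>i\<in>UNIV. x - of_real ((v $ i)\<^sup>2))) \<and>
     (\<forall>i j. b i \<le> b j \<longrightarrow> v $ j \<le> v $ i)}"
  have G_eq: "(\<lambda>A. (A, f A)) ` ?S = G"
  proof (intro equalityI subsetI)
    fix p assume "p \<in> (\<lambda>A. (A, f A)) ` ?S"
    then obtain A where A: "A \<in> ?S" "p = (A, f A)" by auto
    have "det (mat x - conj_transpose A ** A) = (\<Prod>i\<in>UNIV. x - of_real ((f A $ i)\<^sup>2))" for x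
    proof -
      have "det (mat x - conj_transpose A ** A) = (\<Prod>m<?N. x - of_real ((singular_values A ! m)\<^sup>2))"
        by (simp add: poly_charpoly[symmetric] charpoly_gram_factors poly_prod)
      also have "\<dots> = (\<Prod>i\<in>UNIV. x - of_real ((f A $ i)\<^sup>2))"
        unfolding f_def by (simp add: prod.reindex_bij_betw[OF b, symmetric])
      finally show ?thesis .
    qed
    moreover have "f A $ j \<le> f A $ i" if "b i \<le> b j" for i j
      using that bN by (simp add: f_def singular_values_nth_antimono)
    ultimately show "p \<in> G" using A fT by (auto simp: G_def)
  next
    fix p assume "p \<in> G"
    then obtain A v where p: "p = (A, v)" "A \<in> ?S" "v \<in> ?T"
      and det: "\<And>x. det (mat x - conj_transpose A ** A) = (\<Prod>i\<in>UNIV. x - of_real ((v $ i)\<^sup>2))"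
      and mono: "\<And>i j. b i \<le> b j \<Longrightarrow> v $ j \<le> v $ i"
      unfolding G_def by auto
    define xs where "xs = map (\<lambda>m. v $ ?c m) [0..<?N]"
    have "singular_values A = xs"
    proof (rule singular_values_unique)
      show "length xs = ?N" by (simp add: xs_def)
      show "sorted (rev xs)"
        unfolding sorted_rev_iff_nth_mono by (auto simp: xs_def bc intro!: mono)
      show "0 \<le> x" if "x \<in> set xs" for x
        using that p(3) by (auto simp: xs_def mem_box_cart)
      show "charpoly (conj_transpose A ** A) = (\<Prod>i<?N. [:- of_real ((xs ! i)\<^sup>2), 1:])"
      proof (rule poly_eq_poly_eq_iff[THEN iffD1, OF ext])
        fix x
        have "poly (charpoly (conj_transpose A ** A)) x = (\<Prod>i\<in>UNIV. x - of_real ((v $ i)\<^sup>2))"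
          by (simp add: poly_charpoly det)
        also have "\<dots> = (\<Prod>m<?N. x - of_real ((v $ ?c m)\<^sup>2))"
          by (subst prod.reindex_bij_betw[OF b, symmetric]) (simp add: cb)
        also have "\<dots> = poly (\<Prod>i<?N. [:- of_real ((xs ! i)\<^sup>2), 1:]) x"
          by (simp add: poly_prod xs_def)
        finally show "poly (charpoly (conj_transpose A ** A)) x
          = poly (\<Prod>i<?N. [:- of_real ((xs ! i)\<^sup>2), 1:]) x" .
      qed
    qed
    hence "f A = v" by (simp add: f_def xs_def vec_eq_iff bN cb)
    thus "p \<in> (\<lambda>A. (A, f A)) ` ?S" using p by auto
  qed
  have "closed G"
  proof -
    have "G = (?S \<times> ?T) \<inter> (\<Inter>x. {p. det (mat x - conj_transpose (fst p) ** fst p)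
        = (\<Prod>i\<in>UNIV. x - of_real ((snd p $ i)\<^sup>2))})
      \<inter> (\<Inter>(i, j)\<in>{(i, j). b i \<le> b j}. {p. snd p $ j \<le> snd p $ i})"
      by (auto simp: G_def)
    moreover have "closed {p :: (complex^'n^'n) \<times> (real^'n). det (mat x - conj_transpose (fst p) ** fst p)
        = (\<Prod>i\<in>UNIV. x - of_real ((snd p $ i)\<^sup>2))}" for x
      by (intro closed_Collect_eq continuous_intros)
    moreover have "closed {p :: (complex^'n^'n) \<times> (real^'n). snd p $ j \<le> snd p $ i}" for i j
      by (intro closed_Collect_le continuous_intros)
    ultimately show ?thesis
      by (auto intro!: closed_Int closed_INT closed_Times)
  qed
  moreover have "G \<subseteq> ?S \<times> ?T" by (auto simp: G_def)
  ultimately have "closedin (top_of_set (?S \<times> ?T)) ((\<lambda>A. (A, f A)) ` ?S)"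
    unfolding G_eq by (simp add: closed_subset)
  hence "continuous_on ?S f"
    by (subst continuous_closed_graph_eq[of ?T]) (use fT in auto)
  hence "continuous_on ?S (\<lambda>A. f A $ ?c (j - 1))" by (intro continuous_intros)
  moreover have "f A $ ?c (j - 1) = singular_value j A" for A
    using j by (simp add: f_def singular_value_def bc)
  ultimately show ?thesis by simp
qed

text \<open>
  Continuity is local, so the previous lemma for all balls suffices.
\<close>
lemma continuous_singular_value:
  assumes j: "1 \<le> j" "j \<le> CARD('n)"
  shows "continuous_on UNIV (singular_value j :: complex^'n^'n \<Rightarrow> real)"
proof (rule continuous_at_imp_continuous_on, rule ballI)
  fix A :: "complex^'n^'n"
  have "continuous_on (ball 0 (norm A + 1)) (singular_value j :: complex^'n^'n \<Rightarrow> real)"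
    using continuous_on_singular_value_cball[OF j] by (rule continuous_on_subset) (rule ball_subset_cball)
  thus "isCont (singular_value j) A"
    by (subst (asm) continuous_on_eq_continuous_at) auto
qed

lemma minor_sq_sum_le_entries:
  fixes A :: "complex^'n^'n"
  assumes c: "\<And>i j. cmod (A $ i $ j) \<le> c"
  shows "minor_sq_sum k A \<le> (real CARD('n) * c) ^ (2 * k)"
proof -
  have c0: "0 \<le> c" using c[of undefined undefined] norm_ge_zero order_trans by blast
  have m: "cmod (tuple_minor k A f g) \<le> fact k * c ^ k" for f g
  proof -
    have "cmod (tuple_minor k A f g) \<le> (\<Sum>\<sigma> | \<sigma> permutes {..<k}. c ^ k)"
      unfolding tuple_minor_def
    proof (rule sum_norm_le)
      fix \<sigma> :: "nat \<Rightarrow> nat"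
      have "cmod (of_int (sign \<sigma>)) = 1" by (simp add: sign_def)
      moreover have "(\<Prod>i<k. cmod (A $ f i $ g (\<sigma> i))) \<le> (\<Prod>i<k. c)"
        by (intro prod_mono) (simp add: c)
      ultimately show "cmod (of_int (sign \<sigma>) * (\<Prod>i<k. A $ f i $ g (\<sigma> i))) \<le> c ^ k"
        by (simp add: norm_mult prod_norm[symmetric])
    qed
    thus ?thesis by (simp add: card_permutations)
  qed
  have card: "real (card (tuples k :: (nat \<Rightarrow> 'n) set)) = real CARD('n) ^ k"
    by (simp add: tuples_def card_PiE)
  have "(\<Sum>f\<in>tuples k. \<Sum>g\<in>tuples k. (cmod (tuple_minor k A f g))\<^sup>2)
      \<le> (\<Sum>f\<in>(tuples k :: (nat \<Rightarrow> 'n) set). \<Sum>g\<in>(tuples k :: (nat \<Rightarrow> 'n) set). (fact k * c ^ k)\<^sup>2)"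
    by (intro sum_mono power_mono m) auto
  also have "\<dots> = (real CARD('n) ^ k)\<^sup>2 * (fact k * c ^ k)\<^sup>2"
    by (simp add: card power2_eq_square)
  finally have "minor_sq_sum k A \<le> (real CARD('n) ^ k)\<^sup>2 * (fact k * c ^ k)\<^sup>2 / (fact k)\<^sup>2"
    unfolding minor_sq_sum_def by (rule divide_right_mono) simp
  also have "\<dots> = (real CARD('n) * c) ^ (2 * k)"
    by (simp add: power_mult_distrib power_mult power2_eq_square power_mult[symmetric] mult.commute[of 2] )
  finally show ?thesis .
qed

section \<open>Products of transfer matrices\<close>

text \<open>
  The cocycle is rewritten as a function of the sequence of potentials alone. On the space of
  sequences, with the product topology, continuity statements can be made once and then be used both
  for measurability in general and for continuity in the uniquely ergodic case.
\<close>
definition tmatrix :: "complex \<Rightarrow> real^'w^'w \<Rightarrow> complex^('w + 'w)^('w + 'w)" where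
  "tmatrix z V = block_matrix (mat z - (\<chi> i j. complex_of_real (V $ i $ j))) (- mat 1) (mat 1) 0"

primrec tproduct :: "(nat \<Rightarrow> real^'w^'w) \<Rightarrow> nat \<Rightarrow> complex \<Rightarrow> complex^('w + 'w)^('w + 'w)" where
  "tproduct v 0 z = mat 1"
| "tproduct v (Suc n) z = tmatrix z (v (Suc n)) ** tproduct v n z"

lemma cocycle_eq_tproduct: "cocycle T F n \<omega> z = tproduct (\<lambda>i. F ((T ^^ i) \<omega>)) n z"
  by (induction n) (simp_all add: transfer_matrix_def potential_def tmatrix_def)

lemma tproduct_add: "tproduct v (n + m) z = tproduct (\<lambda>i. v (i + m)) n z ** tproduct v m z"
  by (induction n) (simp_all add: matrix_mul_assoc)

lemma sum_UNIV_Plus: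
  "(\<Sum>x\<in>(UNIV :: ('a::finite + 'b::finite) set). f x) = (\<Sum>a\<in>UNIV. f (Inl a)) + (\<Sum>b\<in>UNIV. f (Inr b))"
  by (subst UNIV_Plus_UNIV[symmetric], subst sum.Plus) simp_all

lemma block_matrix_mult:
  fixes A B C D A' B' C' D' :: "complex^'w^'w"
  shows "block_matrix A B C D ** block_matrix A' B' C' D' =
    block_matrix (A ** A' + B ** C') (A ** B' + B ** D') (C ** A' + D ** C') (C ** B' + D ** D')"
  by (simp add: vec_eq_iff matrix_matrix_mult_def block_matrix_def sum_UNIV_Plus split: sum.split)

lemma block_matrix_one: "block_matrix (mat 1) 0 0 (mat 1) = (mat 1 :: complex^('w::finite + 'w)^('w + 'w))"
  by (simp add: vec_eq_iff block_matrix_def mat_def split: sum.split)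

text \<open>
  Let \<open>S\<close> be the block matrix that exchanges the two halves of the space. Then \<open>S\<close> and \<open>S T\<close> are
  involutions for every transfer matrix \<open>T\<close>, so that \<open>(det T)\<^sup>2 = 1\<close>.
\<close>
lemma cmod_det_tmatrix: 
  fixes V :: "real^'w^'w"
  shows "cmod (det (tmatrix z V)) = 1"
proof -
  let ?A = "mat z - (\<chi> i j. complex_of_real (V $ i $ j)) :: complex^'w^'w"
  let ?S = "block_matrix 0 (mat 1) (mat 1) 0 :: complex^('w + 'w)^('w + 'w)"
  have neg: "(- mat 1 :: complex^'w^'w) ** B = - B" "B ** (- mat 1 :: complex^'w^'w) = - B" for B
    by (simp_all add: vec_eq_iff matrix_matrix_mult_def mat_def if_distrib[where f = "\<lambda>y. y * _"]
        if_distrib[where f = "\<lambda>y. _ * y"] sum_negf cong: if_cong)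
  have S: "?S ** ?S = mat 1"
    by (simp add: block_matrix_mult block_matrix_one)
  have ST: "?S ** tmatrix z V = block_matrix (mat 1) 0 ?A (- mat 1)"
    by (simp add: tmatrix_def block_matrix_mult)
  have "(?S ** tmatrix z V) ** (?S ** tmatrix z V) = mat 1"
    unfolding ST by (simp add: block_matrix_mult neg block_matrix_one)
  hence "det ((?S ** tmatrix z V) ** (?S ** tmatrix z V)) = 1" by simp
  moreover have "det (?S ** ?S) = 1" by (simp only: S det_I)
  ultimately have "det ?S * det ?S = 1" "(det ?S * det ?S) * (det (tmatrix z V))\<^sup>2 = 1"
    by (simp_all add: det_mul power2_eq_square mult_ac)
  hence "(det (tmatrix z V))\<^sup>2 = 1" by simp
  thus ?thesis by (auto simp: power2_eq_1_iff)
qed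

lemma cmod_det_tproduct: "cmod (det (tproduct v n z)) = 1"
  by (induction n) (simp_all add: det_mul norm_mult cmod_det_tmatrix)

lemma continuous_on_if_const:
  assumes "continuous_on S f" "continuous_on S g"
  shows "continuous_on S (\<lambda>x. if b then f x else g x)"
  using assms by (cases b) simp_all

lemma continuous_on_tmatrix [continuous_intros]:
  fixes f :: "'a::topological_space \<Rightarrow> complex" and g :: "'a \<Rightarrow> real^'w^'w"
  assumes "continuous_on S f" "continuous_on S g"
  shows "continuous_on S (\<lambda>x. tmatrix (f x) (g x))"
proof -
  have "continuous_on S (\<lambda>x. tmatrix (f x) (g x) $ i $ j)" for i j
    by (cases i; cases j)
       (auto simp: tmatrix_def block_matrix_def mat_def if_distrib[where f = "\<lambda>y. y - _"]
          intro!: continuous_intros assms continuous_on_if_const)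
  hence "continuous_on S (\<lambda>x. \<chi> i j. tmatrix (f x) (g x) $ i $ j)"
    by (intro continuous_on_vec_lambda) blast
  moreover have "(\<chi> i j. tmatrix (f x) (g x) $ i $ j) = tmatrix (f x) (g x)" for x
    by (simp add: vec_eq_iff)
  ultimately show ?thesis by simp
qed

lemma continuous_on_tproduct [continuous_intros]:
  fixes f :: "'a::topological_space \<Rightarrow> nat \<Rightarrow> real^'w^'w"
  assumes "continuous_on S f" "continuous_on S g"
  shows "continuous_on S (\<lambda>x. tproduct (f x) n (g x))"
  by (induction n) 
    (auto intro!: continuous_intros assms continuous_on_product_then_coordinatewise[OF assms(1)])

lemma tmatrix_entry_le:
  fixes V :: "real^'w^'w"
  shows "cmod (tmatrix z V $ i $ j) \<le> (cmod z + 2) * max 1 (onorm ((*v) V))"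
proof -
  let ?m = "max 1 (onorm ((*v) V))"
  have le: "cmod z + ?m \<le> (cmod z + 2) * ?m"
  proof -
    have "cmod z * 1 \<le> cmod z * ?m" by (intro mult_left_mono) auto
    thus ?thesis by (simp add: algebra_simps)
  qed
  have V: "\<bar>V $ a $ b\<bar> \<le> ?m" for a b
    using matrix_component_le_onorm[of V a b] by simp
  have "cmod (mat z $ a $ b - complex_of_real (V $ a $ b)) \<le> cmod z + ?m" for a b
  proof -
    have "cmod (mat z $ a $ b - complex_of_real (V $ a $ b)) \<le> cmod (mat z $ a $ b) + cmod (complex_of_real (V $ a $ b))"
      by (rule norm_triangle_ineq4)
    also have "\<dots> \<le> cmod z + ?m" by (rule add_mono) (use V in \<open>auto simp: mat_def\<close>)
    finally show ?thesis .
  qed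
  moreover have "1 \<le> cmod z + ?m" by (simp add: add_increasing)
  moreover have "0 \<le> cmod z + ?m" by (simp add: add_increasing)
  ultimately have "cmod (tmatrix z V $ i $ j) \<le> cmod z + ?m"
    by (cases i; cases j) (auto simp: tmatrix_def block_matrix_def mat_def)
  thus ?thesis using le by linarith
qed

text \<open>
  The logarithm of the Hilbert--Schmidt norm of the \<open>k\<close>-th exterior power of the product. It is used in place of
  \<open>ln (s\<^sub>1 \<cdots> s\<^sub>k)\<close> because it is exactly subadditive and visibly continuous.
\<close>
definition wedge_log :: "nat \<Rightarrow> nat \<Rightarrow> (nat \<Rightarrow> real^'w^'w) \<Rightarrow> complex \<Rightarrow> real" where
  "wedge_log k n v z = ln (minor_sq_sum k (tproduct v n z)) / 2"

context
  fixes k :: nat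
  assumes k: "k \<le> CARD('w::finite)"
begin

lemma k_le: "k \<le> CARD('w + 'w)" using k by simp

lemma minor_sq_sum_tproduct_ge_1:
  fixes v :: "nat \<Rightarrow> real^'w^'w"
  shows "1 \<le> minor_sq_sum k (tproduct v n z)"
proof -
  have "1 \<le> singular_prod k (tproduct v n z)"
    by (rule singular_prod_ge_1[OF cmod_det_tproduct k_le])
  hence "1 \<le> (singular_prod k (tproduct v n z))\<^sup>2" by (rule one_le_power)
  thus ?thesis using minor_sq_sum_bounds(1)[OF k_le] order_trans by blast
qed

lemma wedge_log_nonneg:
  fixes v :: "nat \<Rightarrow> real^'w^'w"
  shows "0 \<le> wedge_log k n v z"
  using minor_sq_sum_tproduct_ge_1[of v n z] by (simp add: wedge_log_def)

lemma wedge_log_subadditive: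
  fixes v :: "nat \<Rightarrow> real^'w^'w"
  shows "wedge_log k (n + m) v z \<le> wedge_log k n (\<lambda>i. v (i + m)) z + wedge_log k m v z"
proof -
  let ?a = "minor_sq_sum k (tproduct (\<lambda>i. v (i + m)) n z)" and ?b = "minor_sq_sum k (tproduct v m z)"
  have pos: "0 < ?a" "0 < ?b" "0 < minor_sq_sum k (tproduct v (n + m) z)"
    using minor_sq_sum_tproduct_ge_1 by (meson less_le_trans zero_less_one)+
  have "ln (minor_sq_sum k (tproduct v (n + m) z)) \<le> ln (?a * ?b)"
    by (rule ln_mono) (use minor_sq_sum_mult_le pos in \<open>auto simp: tproduct_add\<close>)
  also have "\<dots> = ln ?a + ln ?b" using pos by (intro ln_mult_pos) auto
  finally show ?thesis by (simp add: wedge_log_def)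
qed

lemma continuous_on_wedge_log:
  fixes f :: "'a::topological_space \<Rightarrow> nat \<Rightarrow> real^'w^'w"
  assumes "continuous_on S f" "continuous_on S g"
  shows "continuous_on S (\<lambda>x. wedge_log k n (f x) (g x))"
proof -
  have "minor_sq_sum k (tproduct (f x) n (g x)) \<noteq> 0" for x
    using minor_sq_sum_tproduct_ge_1[of "f x" n "g x"] by auto
  thus ?thesis unfolding wedge_log_def by (intro continuous_intros assms) auto
qed

lemma wedge_log_singular_prod:
  fixes v :: "nat \<Rightarrow> real^'w^'w"
  shows ln_singular_prod_nonneg: "0 \<le> ln (singular_prod k (tproduct v n z))"
    and ln_singular_prod_le: "ln (singular_prod k (tproduct v n z)) \<le> wedge_log k n v z"
    and wedge_log_le: "wedge_log k n v z \<le> CARD('w) * ln 2 + ln (singular_prod k (tproduct v n z))"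
proof -
  let ?p = "singular_prod k (tproduct v n z)" and ?e = "minor_sq_sum k (tproduct v n z)"
  have p: "1 \<le> ?p" by (rule singular_prod_ge_1[OF cmod_det_tproduct k_le])
  have e: "1 \<le> ?e" by (rule minor_sq_sum_tproduct_ge_1)
  show "0 \<le> ln ?p" using p by simp
  have "2 * ln ?p = ln (?p\<^sup>2)" using p by (simp add: ln_realpow)
  also have "\<dots> \<le> ln ?e" by (rule ln_mono) (use p e minor_sq_sum_bounds(1)[OF k_le] in auto)
  finally show "ln ?p \<le> wedge_log k n v z" by (simp add: wedge_log_def)
  have "ln ?e \<le> ln (2 ^ CARD('w + 'w) * ?p\<^sup>2)"
    by (rule ln_mono) (use p e minor_sq_sum_bounds(2)[OF k_le, of "tproduct v n z"] in auto)
  also have "\<dots> = ln (2 ^ CARD('w + 'w)) + ln (?p\<^sup>2)" using p by (intro ln_mult_pos) auto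
  also have "\<dots> = 2 * CARD('w) * ln 2 + 2 * ln ?p" using p by (simp add: ln_realpow)
  finally show "wedge_log k n v z \<le> CARD('w) * ln 2 + ln ?p" by (simp add: wedge_log_def)
qed

text \<open>
  This bound is where the logarithmic moment of the potential enters: it makes the supremum over a
  bounded set of parameters integrable.
\<close>
lemma wedge_log_one_le:
  fixes v :: "nat \<Rightarrow> real^'w^'w" and R :: real
  assumes "cmod z \<le> R"
  shows "wedge_log k 1 v z \<le> k * (ln (2 * CARD('w) * (R + 2)) + log_plus (onorm ((*v) (v 1))))"
proof -
  let ?m = "max 1 (onorm ((*v) (v 1)))"
  have R0: "0 \<le> R" using assms norm_ge_zero order_trans by blast
  have "minor_sq_sum k (tproduct v 1 z) \<le> (real CARD('w + 'w) * ((R + 2) * ?m)) ^ (2 * k)"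
  proof (rule minor_sq_sum_le_entries)
    fix i j
    have "cmod (tproduct v 1 z $ i $ j) \<le> (cmod z + 2) * ?m"
      using tmatrix_entry_le[of z "v 1" i j] by simp
    also have "\<dots> \<le> (R + 2) * ?m" by (rule mult_right_mono) (use assms in auto)
    finally show "cmod (tproduct v 1 z $ i $ j) \<le> (R + 2) * ?m" .
  qed
  hence "ln (minor_sq_sum k (tproduct v 1 z)) \<le> ln ((real CARD('w + 'w) * ((R + 2) * ?m)) ^ (2 * k))"
    using minor_sq_sum_tproduct_ge_1[of v 1 z] by (intro ln_mono) auto
  also have "real CARD('w + 'w) * ((R + 2) * ?m) = (2 * CARD('w) * (R + 2)) * ?m" by simp
  also have "ln (((2 * CARD('w) * (R + 2)) * ?m) ^ (2 * k)) = 2 * k * ln ((2 * CARD('w) * (R + 2)) * ?m)"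
    using R0 by (subst ln_realpow) (auto intro!: mult_pos_pos)
  also have "ln ((2 * CARD('w) * (R + 2)) * ?m) = ln (2 * CARD('w) * (R + 2)) + ln ?m"
    using R0 by (intro ln_mult_pos) auto
  also have "ln ?m = log_plus (onorm ((*v) (v 1)))" by (simp add: log_plus_def max_def)
  finally show ?thesis by (simp add: wedge_log_def)
qed

end

section \<open>The Birkhoff theorem for ergodic maps\<close>

definition orbit_sum :: "('a \<Rightarrow> 'a) \<Rightarrow> ('a \<Rightarrow> real) \<Rightarrow> nat \<Rightarrow> 'a \<Rightarrow> real" where
  "orbit_sum T f n \<omega> = (\<Sum>i<n. f ((T ^^ i) \<omega>))"

lemma orbit_sum_Suc_shift: "orbit_sum T f (Suc n) \<omega> = f \<omega> + orbit_sum T f n (T \<omega>)"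
  unfolding orbit_sum_def by (simp add: sum.lessThan_Suc_shift funpow_Suc_right del: sum.lessThan_Suc funpow.simps)

lemma measure_preserving_iterate:
  assumes T: "measure_preserving_map M T"
  shows "measure_preserving_map M (T ^^ n)"
proof (induction n)
  case 0
  show ?case by (simp add: measure_preserving_map_def distr_id2)
next
  case (Suc n)
  have "distr M M (T \<circ> (T ^^ n)) = distr (distr M M (T ^^ n)) M T"
    using T Suc by (subst distr_distr) (auto simp: measure_preserving_map_def)
  thus ?case using T Suc by (auto simp: measure_preserving_map_def o_def)
qed

lemma measure_preserving_integrable:
  fixes f :: "'a \<Rightarrow> real"
  assumes "measure_preserving_map M T" "integrable M f"
  shows "integrable M (\<lambda>\<omega>. f (T \<omega>))"
  using assms unfolding measure_preserving_map_def by (metis integrable_distr)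

lemma measure_preserving_integral:
  fixes f :: "'a \<Rightarrow> real"
  assumes "measure_preserving_map M T" "f \<in> borel_measurable M"
  shows "(LINT \<omega>|M. f (T \<omega>)) = (LINT \<omega>|M. f \<omega>)"
  using assms unfolding measure_preserving_map_def by (metis integral_distr)

text \<open>
  This is the maximum of the orbit sums of lengths \<open>0, \<dots>, n\<close>; the recursion is the identity on which
  the proof of the ergodic theorem rests.
\<close>
primrec max_orbit_sum :: "('a \<Rightarrow> 'a) \<Rightarrow> ('a \<Rightarrow> real) \<Rightarrow> nat \<Rightarrow> 'a \<Rightarrow> real" where
  "max_orbit_sum T f 0 \<omega> = 0"
| "max_orbit_sum T f (Suc n) \<omega> = max 0 (f \<omega> + max_orbit_sum T f n (T \<omega>))"

lemma max_orbit_sum_nonneg: "0 \<le> max_orbit_sum T f n \<omega>"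
  by (cases n) auto

lemma max_orbit_sum_le_Suc: "max_orbit_sum T f n \<omega> \<le> max_orbit_sum T f (Suc n) \<omega>"
proof (induction n arbitrary: \<omega>)
  case (Suc n)
  show ?case using Suc[of "T \<omega>"] by (simp only: max_orbit_sum.simps(2))
qed simp

lemma orbit_sum_le_max: "m \<le> n \<Longrightarrow> orbit_sum T f m \<omega> \<le> max_orbit_sum T f n \<omega>"
proof (induction n arbitrary: m \<omega>)
  case 0
  thus ?case by (simp add: orbit_sum_def)
next
  case (Suc n)
  show ?case
  proof (cases m)
    case 0
    thus ?thesis by (simp add: orbit_sum_def)
  next
    case (Suc m')
    thus ?thesis using Suc.IH[of m' "T \<omega>"] Suc.prems by (simp add: orbit_sum_Suc_shift)
  qed
qed

lemma max_orbit_sum_integrable: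
  assumes T: "measure_preserving_map M T" and f: "integrable M f"
  shows "integrable M (max_orbit_sum T f n)"
proof (induction n)
  case 0
  show ?case by (simp add: fun_eq_iff[symmetric] cong: integrable_cong)
next
  case (Suc n)
  have "integrable M (\<lambda>\<omega>. max 0 (f \<omega> + max_orbit_sum T f n (T \<omega>)))"
    by (intro integrable_max integrable_zero Bochner_Integration.integrable_add f measure_preserving_integrable[OF T Suc])
  thus ?case by simp
qed

text \<open>
  The set \<open>A\<close> where the orbit sums are unbounded above is invariant, so it has measure 0 or 1. Let \<open>F\<^sub>n\<close>
  be the running maximum. The differences \<open>F\<^sub>n\<^sub>+\<^sub>1 - F\<^sub>n \<circ> T = max (- F\<^sub>n \<circ> T) f\<close> have nonnegative integrals,
  because \<open>F\<^sub>n\<close> increases with \<open>n\<close> and \<open>T\<close> preserves the measure. On \<open>A\<close> they tend to \<open>f\<close> and they are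
  dominated by \<open>\<bar>f\<bar>\<close>; if \<open>A\<close> had measure 1, the integral of \<open>f\<close> would be nonnegative.
\<close>
lemma orbit_sum_bounded_above:
  assumes "prob_space M" "ergodic_map M T" and f: "integrable M f" and neg: "(LINT \<omega>|M. f \<omega>) < 0"
  shows "AE \<omega> in M. \<exists>C::nat. \<forall>n. orbit_sum T f n \<omega> \<le> C"
proof -
  interpret prob_space M by fact
  have T: "measure_preserving_map M T" and
    erg: "\<And>A. A \<in> sets M \<Longrightarrow> T -` A \<inter> space M = A \<Longrightarrow> measure M A = 0 \<or> measure M A = 1"
    using assms(2) by (auto simp: ergodic_map_def)
  have Tm [measurable]: "T \<in> M \<rightarrow>\<^sub>M M" using T by (simp add: measure_preserving_map_def)
  have [measurable]: "T ^^ i \<in> M \<rightarrow>\<^sub>M M" for i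
    using measure_preserving_iterate[OF T, of i] by (simp add: measure_preserving_map_def)
  have [measurable]: "f \<in> borel_measurable M" using f by simp
  have [measurable]: "orbit_sum T f n \<in> borel_measurable M" for n
    unfolding orbit_sum_def by measurable
  define A where "A = {\<omega>\<in>space M. \<forall>C::nat. \<exists>n. C < orbit_sum T f n \<omega>}"
  have A: "A \<in> sets M" unfolding A_def by measurable
  have "T \<omega> \<in> A \<longleftrightarrow> \<omega> \<in> A" if \<omega>: "\<omega> \<in> space M" for \<omega>
  proof -
    have T\<omega>: "T \<omega> \<in> space M" using Tm \<omega> by (rule measurable_space)
    have "(\<forall>C::nat. \<exists>n. C < orbit_sum T f n (T \<omega>)) \<longleftrightarrow> (\<forall>C::nat. \<exists>n. C < orbit_sum T f n \<omega>)"
    proof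
      assume L: "\<forall>C::nat. \<exists>n. C < orbit_sum T f n (T \<omega>)"
      show "\<forall>C::nat. \<exists>n. C < orbit_sum T f n \<omega>"
      proof
        fix C :: nat
        obtain D :: nat where D: "real C - f \<omega> \<le> D" using real_arch_simple by blast
        obtain n where "D < orbit_sum T f n (T \<omega>)" using L by blast
        hence "C < orbit_sum T f (Suc n) \<omega>" using D by (simp add: orbit_sum_Suc_shift)
        thus "\<exists>n. C < orbit_sum T f n \<omega>" ..
      qed
    next
      assume R: "\<forall>C::nat. \<exists>n. C < orbit_sum T f n \<omega>"
      show "\<forall>C::nat. \<exists>n. C < orbit_sum T f n (T \<omega>)"
      proof
        fix C :: nat
        obtain D :: nat where D: "real C + f \<omega> \<le> D" using real_arch_simple by blast
        obtain n where n: "D < orbit_sum T f n \<omega>" using R by blast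
        have "n \<noteq> 0" using n by (intro notI) (simp add: orbit_sum_def)
        then obtain m where "n = Suc m" using not0_implies_Suc by blast
        hence "C < orbit_sum T f m (T \<omega>)" using n D by (simp add: orbit_sum_Suc_shift)
        thus "\<exists>n. C < orbit_sum T f n (T \<omega>)" ..
      qed
    qed
    thus ?thesis using \<omega> T\<omega> by (simp add: A_def)
  qed
  hence "T -` A \<inter> space M = A" by (auto simp: A_def)
  hence "measure M A = 0 \<or> measure M A = 1" using erg A by blast
  moreover have "measure M A \<noteq> 1"
  proof
    assume "measure M A = 1"
    hence AE_A: "AE \<omega> in M. \<omega> \<in> A" using A by (simp add: prob_eq_1)
    let ?F = "max_orbit_sum T f"
    define D where "D n \<omega> = ?F (Suc n) \<omega> - ?F n (T \<omega>)" for n \<omega>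
    have F: "integrable M (?F n)" for n by (rule max_orbit_sum_integrable[OF T f])
    have FT: "integrable M (\<lambda>\<omega>. ?F n (T \<omega>))" for n by (rule measure_preserving_integrable[OF T F])
    have D_int: "0 \<le> (LINT \<omega>|M. D n \<omega>)" for n
    proof -
      have "(LINT \<omega>|M. D n \<omega>) = (LINT \<omega>|M. ?F (Suc n) \<omega>) - (LINT \<omega>|M. ?F n (T \<omega>))"
        unfolding D_def by (rule Bochner_Integration.integral_diff[OF F FT])
      also have "(LINT \<omega>|M. ?F n (T \<omega>)) = (LINT \<omega>|M. ?F n \<omega>)"
        by (rule measure_preserving_integral[OF T]) (use F in auto)
      finally show ?thesis using integral_mono[OF F F max_orbit_sum_le_Suc, of n] by simp
    qed
    have "(\<lambda>n. LINT \<omega>|M. D n \<omega>) \<longlonglongrightarrow> (LINT \<omega>|M. f \<omega>)"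
    proof (rule integral_dominated_convergence[where w = "\<lambda>\<omega>. \<bar>f \<omega>\<bar>"])
      show "D n \<in> borel_measurable M" for n
        unfolding D_def using F FT by (intro borel_measurable_diff borel_measurable_integrable)
      show "AE \<omega> in M. norm (D n \<omega>) \<le> \<bar>f \<omega>\<bar>" for n
      proof (rule AE_I2)
        fix \<omega>
        show "norm (D n \<omega>) \<le> \<bar>f \<omega>\<bar>"
          using max_orbit_sum_nonneg[of T f n "T \<omega>"] by (simp add: D_def abs_if max_def)
      qed
      show "AE \<omega> in M. (\<lambda>n. D n \<omega>) \<longlonglongrightarrow> f \<omega>"
        using AE_A
      proof eventually_elim
        case (elim \<omega>)
        have "T \<omega> \<in> A" using elim \<open>T -` A \<inter> space M = A\<close> by auto
        obtain C :: nat where C: "- f \<omega> \<le> C" using real_arch_simple by blast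
        obtain m where m: "C < orbit_sum T f m (T \<omega>)" using \<open>T \<omega> \<in> A\<close> by (auto simp: A_def)
        have "D n \<omega> = f \<omega>" if "n \<ge> m" for n
          using orbit_sum_le_max[OF that, of T f "T \<omega>"] m C by (simp add: D_def)
        hence "\<forall>\<^sub>F n in sequentially. D n \<omega> = f \<omega>" by (auto simp: eventually_sequentially)
        thus ?case by (rule tendsto_eventually)
      qed
    qed (use f in auto)
    hence "0 \<le> (LINT \<omega>|M. f \<omega>)" by (rule LIMSEQ_le_const) (use D_int in auto)
    thus False using neg by simp
  qed
  ultimately have "measure M A = 0" by blast
  hence "AE \<omega> in M. \<omega> \<notin> A" using A by (subst (asm) prob_eq_0) auto
  moreover have "AE \<omega> in M. \<omega> \<in> space M" by simp
  ultimately show ?thesis by eventually_elim (auto simp: A_def not_less)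
qed

text \<open>
  The functions \<open>f - \<integral> f - 1/(j+1)\<close> have negative integrals, so their orbit sums are bounded above almost
  everywhere.
\<close>
theorem birkhoff_ergodic_upper:
  assumes "prob_space M" "ergodic_map M T" and f: "integrable M f"
  shows "AE \<omega> in M. \<forall>e>0. \<forall>\<^sub>F n in sequentially. orbit_sum T f n \<omega> / n < (LINT \<omega>|M. f \<omega>) + e"
proof -
  interpret prob_space M by fact
  let ?I = "LINT \<omega>|M. f \<omega>"
  have "AE \<omega> in M. \<forall>j::nat. \<exists>C::nat. \<forall>n. orbit_sum T (\<lambda>\<omega>. f \<omega> - ?I - 1 / Suc j) n \<omega> \<le> C"
  proof (subst AE_all_countable, rule allI)
    fix j :: nat
    have "(LINT \<omega>|M. f \<omega> - ?I - 1 / Suc j) = - (1 / Suc j)"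
      using f by (simp add: prob_space)
    thus "AE \<omega> in M. \<exists>C::nat. \<forall>n. orbit_sum T (\<lambda>\<omega>. f \<omega> - ?I - 1 / Suc j) n \<omega> \<le> C"
      by (intro orbit_sum_bounded_above assms) (use f in auto)
  qed
  thus ?thesis
  proof eventually_elim
    case (elim \<omega>)
    show ?case
    proof (intro allI impI)
      fix e :: real assume e: "0 < e"
      obtain j :: nat where j: "1 / Suc j < e / 2" using e nat_approx_posE[of "e / 2"] by auto
      obtain C :: nat where C: "\<And>n. orbit_sum T (\<lambda>\<omega>. f \<omega> - ?I - 1 / Suc j) n \<omega> \<le> C"
        using elim by blast
      have "\<forall>\<^sub>F n :: nat in sequentially. real C / n < e / 2 \<and> real n > 0"
      proof (intro eventually_conj)
        have "(\<lambda>n. real C / n) \<longlonglongrightarrow> 0" by (rule lim_const_over_n)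
        thus "\<forall>\<^sub>F n :: nat in sequentially. real C / n < e / 2" using e by (intro order_tendstoD) auto
        show "\<forall>\<^sub>F n :: nat in sequentially. real n > 0"
          using eventually_gt_at_top[of "0::nat"] by simp
      qed
      thus "\<forall>\<^sub>F n in sequentially. orbit_sum T f n \<omega> / n < ?I + e"
      proof eventually_elim
        case (elim n)
        have "orbit_sum T f n \<omega> \<le> C + n * (?I + 1 / Suc j)"
          using C[of n] by (simp add: orbit_sum_def sum_subtractf algebra_simps)
        hence "orbit_sum T f n \<omega> / n \<le> (C + n * (?I + 1 / Suc j)) / n"
          by (rule divide_right_mono) simp
        also have "\<dots> = C / n + (?I + 1 / Suc j)" using elim by (simp add: add_divide_distrib)
        finally have "orbit_sum T f n \<omega> / n \<le> C / n + (?I + 1 / Suc j)" .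
        thus ?case using elim j by linarith
      qed
    qed
  qed
qed

theorem birkhoff_ergodic:
  assumes "prob_space M" "ergodic_map M T" and f: "integrable M f"
  shows "AE \<omega> in M. (\<lambda>n. orbit_sum T f n \<omega> / n) \<longlonglongrightarrow> (LINT \<omega>|M. f \<omega>)"
proof -
  have "integrable M (\<lambda>\<omega>. - f \<omega>)" using f by simp
  from birkhoff_ergodic_upper[OF assms(1,2) this] birkhoff_ergodic_upper[OF assms]
  show ?thesis
  proof eventually_elim
    case (elim \<omega>)
    have neg: "orbit_sum T (\<lambda>\<omega>. - f \<omega>) n \<omega> = - orbit_sum T f n \<omega>" for n
      by (simp add: orbit_sum_def sum_negf)
    show ?case
    proof (rule order_tendstoI)
      fix a assume "a < (LINT \<omega>|M. f \<omega>)"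
      thus "\<forall>\<^sub>F n in sequentially. a < orbit_sum T f n \<omega> / n"
        using elim(1)[rule_format, of "(LINT \<omega>|M. f \<omega>) - a"] by (simp add: neg)
    next
      fix a assume "(LINT \<omega>|M. f \<omega>) < a"
      thus "\<forall>\<^sub>F n in sequentially. orbit_sum T f n \<omega> / n < a"
        using elim(2)[rule_format, of "a - (LINT \<omega>|M. f \<omega>)"] by simp
    qed
  qed
qed

section \<open>Compact metrizable spaces as images of compact sets of reals\<close>

definition digit_series :: "(nat \<Rightarrow> real) \<Rightarrow> (nat \<Rightarrow> bool) \<Rightarrow> real" where
  "digit_series w a = (\<Sum>n. if a n then w n else 0)"

lemma summable_digit_series:
  fixes w :: "nat \<Rightarrow> real"
  assumes "summable w" "\<And>n. 0 \<le> w n"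
  shows "summable (\<lambda>n. if a n then w n else 0)"
  by (rule summable_comparison_test'[where g = w and N = 0]) (simp_all add: assms)

lemma continuous_digit_series:
  assumes "summable w" "\<And>n. 0 \<le> w n"
  shows "continuous_on UNIV (digit_series w)"
proof (rule uniform_limit_theorem)
  show "uniform_limit UNIV (\<lambda>n a. \<Sum>i<n. if a i then w i else 0) (digit_series w) sequentially"
    unfolding digit_series_def[abs_def]
    by (rule Weierstrass_m_test[OF _ assms(1)]) (simp add: assms(2))
  have "continuous_on UNIV (\<lambda>a :: nat \<Rightarrow> bool. if a i then w i else 0)" for i
    by (rule continuous_on_compose2[of UNIV "\<lambda>b. if b then w i else 0" UNIV "\<lambda>a. a i"])
       (auto intro: continuous_on_discrete)
  thus "\<forall>\<^sub>F n in sequentially. continuous_on UNIV (\<lambda>a :: nat \<Rightarrow> bool. \<Sum>i<n. if a i then w i else 0)"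
    by (intro always_eventually allI continuous_on_sum) auto
qed simp

text \<open>
  The usual homeomorphism of the space of binary sequences onto the ternary Cantor set.
\<close>
definition cantor_code :: "(nat \<Rightarrow> bool) \<Rightarrow> real" where
  "cantor_code = digit_series (\<lambda>n. 2 / 3 ^ Suc n)"

lemma summable_cantor: "summable (\<lambda>n. 2 / 3 ^ Suc n :: real)"
  using summable_mult[OF summable_geometric[of "1/3 :: real"], of "2/3"] by (simp add: power_divide)

lemma suminf_cantor: "(\<Sum>n. 2 / 3 ^ Suc n :: real) = 1"
proof -
  have "(\<lambda>n. 2/3 * (1/3) ^ n :: real) sums (2/3 * (1 / (1 - 1/3)))"
    by (intro sums_mult geometric_sums) simp
  thus ?thesis by (simp add: power_divide sums_iff)
qed

lemma cantor_code_bounds: "0 \<le> cantor_code a" "cantor_code a \<le> 1"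
proof -
  have s: "summable (\<lambda>n. if a n then 2 / 3 ^ Suc n else 0 :: real)"
    by (rule summable_digit_series[OF summable_cantor]) simp
  show "0 \<le> cantor_code a" unfolding cantor_code_def digit_series_def
    by (rule suminf_nonneg[OF s]) simp
  have "cantor_code a \<le> (\<Sum>n. 2 / 3 ^ Suc n)" unfolding cantor_code_def digit_series_def
    by (rule suminf_le[OF _ s summable_cantor]) simp
  thus "cantor_code a \<le> 1" by (simp only: suminf_cantor)
qed

lemma cantor_code_rec: "cantor_code a = ((if a 0 then 2 else 0) + cantor_code (\<lambda>n. a (Suc n))) / 3"
proof -
  let ?f = "\<lambda>n. if a n then 2 / 3 ^ Suc n else 0 :: real"
  have s: "summable ?f" by (rule summable_digit_series[OF summable_cantor]) simp
  have s': "summable (\<lambda>n. if a (Suc n) then 2 / 3 ^ Suc n else 0 :: real)"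
    by (rule summable_digit_series[OF summable_cantor]) simp
  have "cantor_code a = ?f 0 + (\<Sum>n. ?f (Suc n))"
    unfolding cantor_code_def digit_series_def using suminf_split_head[OF s] by simp
  also have "(\<Sum>n. ?f (Suc n)) = (\<Sum>n. (if a (Suc n) then 2 / 3 ^ Suc n else 0) / 3)"
    by (rule suminf_cong) simp
  also have "\<dots> = cantor_code (\<lambda>n. a (Suc n)) / 3"
    unfolding cantor_code_def digit_series_def by (rule suminf_divide[OF s'])
  finally show ?thesis by (simp add: add_divide_distrib)
qed

text \<open>
  The first digit can be read off, since the part of the code contributed by the later digits is at
  most \<open>1/3\<close>; then the recursion moves on to the next digit.
\<close>
lemma cantor_code_inject: "cantor_code a = cantor_code b \<Longrightarrow> a n = b n"
proof (induction n arbitrary: a b)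
  case 0
  show ?case
    using 0 cantor_code_rec[of a] cantor_code_rec[of b] cantor_code_bounds[of "\<lambda>n. a (Suc n)"]
      cantor_code_bounds[of "\<lambda>n. b (Suc n)"]
    by (cases "a 0"; cases "b 0") auto
next
  case (Suc n)
  have "cantor_code (\<lambda>n. a (Suc n)) = cantor_code (\<lambda>n. b (Suc n))"
    using Suc.prems cantor_code_rec[of a] cantor_code_rec[of b] cantor_code_bounds[of "\<lambda>n. a (Suc n)"]
      cantor_code_bounds[of "\<lambda>n. b (Suc n)"]
    by (cases "a 0"; cases "b 0") auto
  thus ?case by (rule Suc.IH)
qed

lemma inj_cantor_code: "inj cantor_code"
  by (intro injI ext cantor_code_inject)

lemma binary_expansion:
  assumes "0 \<le> x" "x < 1"
  shows "digit_series (\<lambda>n. 1 / 2 ^ Suc n) (\<lambda>n. odd \<lfloor>2 ^ Suc n * x\<rfloor>) = x"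
proof -
  let ?f = "\<lambda>n. if odd \<lfloor>2 ^ Suc n * x\<rfloor> then 1 / 2 ^ Suc n else 0 :: real"
  have partial: "(\<Sum>i<n. ?f i) = \<lfloor>2 ^ n * x\<rfloor> / 2 ^ n" for n
  proof (induction n)
    case 0
    have "\<lfloor>x\<rfloor> = 0" using assms by (simp add: floor_eq_iff)
    thus ?case by simp
  next
    case (Suc n)
    let ?y = "2 ^ n * x"
    have "\<lfloor>2 * ?y\<rfloor> = 2 * \<lfloor>?y\<rfloor> \<or> \<lfloor>2 * ?y\<rfloor> = 2 * \<lfloor>?y\<rfloor> + 1" by linarith
    hence "real_of_int \<lfloor>2 * ?y\<rfloor> = 2 * \<lfloor>?y\<rfloor> + (if odd \<lfloor>2 * ?y\<rfloor> then 1 else 0)" by auto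
    thus ?case using Suc by (auto simp: field_simps)
  qed
  have "(\<lambda>n. \<Sum>i<n. ?f i) \<longlonglongrightarrow> x"
  proof (rule real_tendsto_sandwich)
    show "\<forall>\<^sub>F n in sequentially. x - (1/2) ^ n \<le> (\<Sum>i<n. ?f i)"
    proof (intro always_eventually allI)
      fix n
      have "2 ^ n * x - 1 \<le> \<lfloor>2 ^ n * x\<rfloor>" by linarith
      hence "(2 ^ n * x - 1) / 2 ^ n \<le> \<lfloor>2 ^ n * x\<rfloor> / 2 ^ n" by (rule divide_right_mono) simp
      thus "x - (1/2) ^ n \<le> (\<Sum>i<n. ?f i)" unfolding partial by (simp add: diff_divide_distrib power_divide)
    qed
    show "\<forall>\<^sub>F n in sequentially. (\<Sum>i<n. ?f i) \<le> x"
    proof (intro always_eventually allI)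
      fix n
      have "\<lfloor>2 ^ n * x\<rfloor> \<le> 2 ^ n * x" by linarith
      thus "(\<Sum>i<n. ?f i) \<le> x" unfolding partial by (simp add: field_simps)
    qed
    have "(\<lambda>n. x - (1/2) ^ n) \<longlonglongrightarrow> x - 0" by (intro tendsto_intros LIMSEQ_power_zero) simp
    thus "(\<lambda>n. x - (1/2) ^ n) \<longlonglongrightarrow> x" by simp
  qed simp
  hence "?f sums x" by (simp add: sums_def)
  thus ?thesis unfolding digit_series_def by (rule sums_unique[symmetric])
qed

lemma compact_bool_sequences: "compact (UNIV :: (nat \<Rightarrow> bool) set)"
proof -
  have "compact_space (euclidean :: bool topology)"
    using finite_imp_compact[of "UNIV :: bool set"] by (simp add: compact_space_def)
  hence "compact_space (product_topology (\<lambda>i::nat. euclidean :: bool topology) UNIV)"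
    by (simp add: compact_space_product_topology)
  thus ?thesis by (simp add: euclidean_product_topology compact_space_def)
qed

text \<open>
  A binary sequence is split into countably many sequences by the pairing of natural numbers, and each of
  them is read as a binary expansion. Composing with the inverse of the Cantor code gives a
  continuous map on the Cantor set.
\<close>
lemma compact_real_parametrizes_cube:
  obtains C :: "real set" and \<psi> :: "real \<Rightarrow> nat \<Rightarrow> real"
  where "compact C" "continuous_on C \<psi>"
    "\<And>y. (\<And>m. 0 \<le> y m \<and> y m < 1) \<Longrightarrow> \<exists>t\<in>C. \<psi> t = y"
proof -
  define C where "C = range cantor_code"
  define decode where "decode = inv cantor_code"
  define bin where "bin = digit_series (\<lambda>n. 1 / 2 ^ Suc n :: real)"
  define \<psi> where "\<psi> t m = bin (\<lambda>n. decode t (prod_encode (m, n)))" for t m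
  have cc: "continuous_on UNIV cantor_code"
    unfolding cantor_code_def by (rule continuous_digit_series[OF summable_cantor]) simp
  have "summable (\<lambda>n. 1 / 2 ^ Suc n :: real)"
    using summable_mult[OF summable_geometric[of "1/2 :: real"], of "1/2"] by (simp add: power_divide)
  hence cb: "continuous_on UNIV bin" unfolding bin_def by (rule continuous_digit_series) simp
  have cd: "continuous_on C decode"
    unfolding C_def decode_def
    by (rule continuous_on_inv[OF cc compact_bool_sequences]) (simp add: inv_f_f inj_cantor_code)
  show ?thesis
  proof
    show "compact C" unfolding C_def by (rule compact_continuous_image[OF cc compact_bool_sequences])
    show "continuous_on C \<psi>"
    proof (rule continuous_on_coordinatewise_then_product)
      fix m
      have "continuous_on C (\<lambda>t n. decode t (prod_encode (m, n)))"
        by (intro continuous_on_coordinatewise_then_product continuous_on_product_then_coordinatewise[OF cd])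
      thus "continuous_on C (\<lambda>t. \<psi> t m)"
        unfolding \<psi>_def by (rule continuous_on_compose2[OF cb]) simp
    qed
    fix y :: "nat \<Rightarrow> real" assume y: "\<And>m. 0 \<le> y m \<and> y m < 1"
    define a where "a p = (case prod_decode p of (m, n) \<Rightarrow> odd \<lfloor>2 ^ Suc n * y m\<rfloor>)" for p
    have "\<psi> (cantor_code a) m = y m" for m
      using binary_expansion[of "y m"] y[of m]
      by (simp add: \<psi>_def decode_def inv_f_f inj_cantor_code bin_def a_def)
    thus "\<exists>t\<in>C. \<psi> t = y" by (intro bexI[of _ "cantor_code a"]) (auto simp: C_def)
  qed
qed

text \<open>
  The coordinates are the distances to the points of a countable dense set, truncated at 1. They are
  halved to stay below 1, where every number has a binary expansion with the digits used above.
\<close>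
lemma compact_metrizable_embeds_in_cube:
  assumes X: "compact_space X" "metrizable_space X" and ne: "topspace X \<noteq> {}"
  obtains \<phi> :: "'a \<Rightarrow> nat \<Rightarrow> real"
  where "continuous_map X euclidean \<phi>" "inj_on \<phi> (topspace X)" "\<And>x m. 0 \<le> \<phi> x m \<and> \<phi> x m < 1"
proof -
  obtain M d where "Metric_space M d" and X_eq: "X = Metric_space.mtopology M d"
    using X(2) by (auto simp: metrizable_space_def)
  then interpret Metric_space M d by simp
  have tb: "mtotally_bounded M"
    using X(1) compactin_imp_mtotally_bounded[of M] unfolding X_eq compact_space_def by simp
  have "\<forall>n::nat. \<exists>K. finite K \<and> K \<subseteq> M \<and> M \<subseteq> (\<Union>x\<in>K. mball x (1 / Suc n))"
    using tb unfolding mtotally_bounded_def by simp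
  then obtain K where K: "\<And>n::nat. finite (K n) \<and> K n \<subseteq> M \<and> M \<subseteq> (\<Union>x\<in>K n. mball x (1 / Suc n))"
    by metis
  have cK: "countable (\<Union>n. K n)" using K by (auto intro: countable_finite)
  have neK: "(\<Union>n. K n) \<noteq> {}" using K[of 0] ne X_eq by auto
  define q where "q = from_nat_into (\<Union>n. K n)"
  have qM: "q m \<in> M" for m using from_nat_into[OF neK, of m] K by (auto simp: q_def)
  define \<phi> where "\<phi> x m = min 1 (d x (q m)) / 2" for x m
  show ?thesis
  proof
    show "0 \<le> \<phi> x m \<and> \<phi> x m < 1" for x m by (auto simp: \<phi>_def min_def)
    have "continuous_map mtopology euclideanreal (\<lambda>x. d x (q m))" for m
      unfolding continuous_map_def
    proof (intro conjI allI impI)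
      fix U :: "real set" assume "openin euclideanreal U"
      hence U: "open U" by simp
      show "openin mtopology {x \<in> topspace mtopology. d x (q m) \<in> U}"
        unfolding openin_mtopology
      proof (intro conjI allI impI)
        fix x assume x: "x \<in> {x \<in> topspace mtopology. d x (q m) \<in> U}"
        then obtain e where e: "0 < e" "\<And>y. dist y (d x (q m)) < e \<Longrightarrow> y \<in> U"
          using U unfolding open_dist by auto
        have "mball x e \<subseteq> {x \<in> topspace mtopology. d x (q m) \<in> U}"
        proof
          fix y assume y: "y \<in> mball x e"
          have "\<bar>d y (q m) - d x (q m)\<bar> \<le> d y x"
            using y x qM[of m] mdist_reverse_triangle[of y "q m" x] commute[of "q m" x] by auto
          thus "y \<in> {x \<in> topspace mtopology. d x (q m) \<in> U}"
            using y e(2)[of "d y (q m)"] commute[of x y] by (auto simp: dist_real_def)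
        qed
        thus "\<exists>r>0. mball x r \<subseteq> {x \<in> topspace mtopology. d x (q m) \<in> U}" using e(1) by blast
      qed auto
    qed auto
    hence "continuous_map mtopology euclideanreal (\<lambda>x. \<phi> x m)" for m
      unfolding \<phi>_def by (intro continuous_intros) auto
    hence "continuous_map X (product_topology (\<lambda>i. euclidean) UNIV) \<phi>"
      unfolding X_eq by (intro continuous_map_coordinatewise_then_product) auto
    thus "continuous_map X euclidean \<phi>" by (simp add: euclidean_product_topology)
    show "inj_on \<phi> (topspace X)"
    proof (rule inj_onI, rule ccontr)
      fix x y assume xy: "x \<in> topspace X" "y \<in> topspace X" "\<phi> x = \<phi> y" "x \<noteq> y"
      hence M: "x \<in> M" "y \<in> M" by (auto simp: X_eq)
      hence "0 < d x y" using xy by simp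
      then obtain n :: nat where n: "1 / Suc n < d x y / 2" "1 / Suc n \<le> 1"
        using nat_approx_posE[of "d x y / 2"] by (metis half_gt_zero divide_le_eq_1_pos of_nat_0_less_iff of_nat_Suc le_add_same_cancel2 of_nat_0_le_iff zero_less_Suc add.commute)
      obtain p where p: "p \<in> K n" "x \<in> mball p (1 / Suc n)" using K[of n] M by blast
      then obtain m where m: "p = q m"
        using from_nat_into_surj[OF cK, of p] by (auto simp: q_def)
      have dx: "d x (q m) < 1 / Suc n" using p m commute by auto
      moreover have "min 1 (d x (q m)) = min 1 (d y (q m))"
        using fun_cong[OF xy(3), of m] by (simp add: \<phi>_def)
      moreover have "d x (q m) < 1" using dx n(2) by linarith
      ultimately have "d y (q m) < 1 / Suc n" by (simp add: min_def split: if_splits)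
      moreover have "d x y \<le> d x (q m) + d y (q m)"
        using triangle[of x "q m" y] M qM[of m] commute[of y "q m"] by simp
      ultimately show False using dx n(1) by linarith
    qed
  qed
qed

section \<open>Weak limits of empirical measures\<close>

lemma borel_sets_of_sigma:
  "space (sigma (topspace X) {U. openin X U}) = topspace X"
  "sets (sigma (topspace X) {U. openin X U}) = borel_sets_of X"
proof -
  have "{U. openin X U} \<subseteq> Pow (topspace X)" by (auto dest: openin_subset)
  thus "space (sigma (topspace X) {U. openin X U}) = topspace X"
    "sets (sigma (topspace X) {U. openin X U}) = borel_sets_of X"
    by (simp_all add: space_measure_of sets_measure_of borel_sets_of_def)
qed

lemma openin_borel_sets_of: "openin X U \<Longrightarrow> U \<in> borel_sets_of X"
  unfolding borel_sets_of_def by (rule sigma_sets.Basic) simp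

lemma closedin_borel_sets_of:
  assumes "closedin X U"
  shows "U \<in> borel_sets_of X"
proof -
  have "topspace X - (topspace X - U) \<in> borel_sets_of X"
    unfolding borel_sets_of_def using assms by (intro sigma_sets.Compl sigma_sets.Basic) auto
  thus ?thesis using closedin_subset[OF assms] by (simp add: double_diff)
qed

lemma continuous_map_borel_measurable:
  fixes g :: "'a \<Rightarrow> 'b::topological_space"
  assumes "space N = topspace X" "sets N = borel_sets_of X" "continuous_map X euclidean g"
  shows "g \<in> borel_measurable N"
proof (rule borel_measurableI)
  fix S :: "'b set" assume "open S"
  hence "openin X {x \<in> topspace X. g x \<in> S}"
    using assms(3) by (simp add: continuous_map_def)
  moreover have "{x \<in> topspace X. g x \<in> S} = g -` S \<inter> space N" using assms(1) by auto
  ultimately show "g -` S \<inter> space N \<in> sets N" using assms(2) openin_borel_sets_of by auto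
qed

lemma continuous_map_bounded:
  fixes g :: "'a \<Rightarrow> real"
  assumes "compact_space X" "continuous_map X euclidean g"
  obtains B where "0 \<le> B" "\<And>x. x \<in> topspace X \<Longrightarrow> \<bar>g x\<bar> \<le> B"
proof -
  have "compactin euclidean (g ` topspace X)"
    using assms image_compactin compact_space_def by blast
  hence "bounded (g ` topspace X)" by (simp add: compact_imp_bounded)
  then obtain B where "\<And>x. x \<in> topspace X \<Longrightarrow> \<bar>g x\<bar> \<le> B" by (auto simp: bounded_real)
  hence "\<And>x. x \<in> topspace X \<Longrightarrow> \<bar>g x\<bar> \<le> max 0 B" by (simp add: max.coboundedI2)
  thus ?thesis using that[of "max 0 B"] by simp
qed

text \<open>
  A closed set is the zero set of a continuous function \<open>h \<ge> 0\<close>, found with the help of the embedding into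
  the metric space of sequences; its indicator is the limit of the functions \<open>max 0 (1 - n h)\<close>. So
  the measures agree on closed sets, and these generate the Borel sets.
\<close>
lemma measure_eqI_continuous_integrals:
  assumes X: "compact_space X" "metrizable_space X"
    and N1: "prob_space N1" "space N1 = topspace X" "sets N1 = borel_sets_of X"
    and N2: "prob_space N2" "space N2 = topspace X" "sets N2 = borel_sets_of X"
    and eq: "\<And>g :: 'a \<Rightarrow> real. continuous_map X euclidean g \<Longrightarrow> (LINT x|N1. g x) = (LINT x|N2. g x)"
  shows "N1 = N2"
proof -
  interpret N1: prob_space N1 by fact
  interpret N2: prob_space N2 by fact
  have ne: "topspace X \<noteq> {}" using N1.not_empty N1(2) by simp
  obtain \<phi> :: "'a \<Rightarrow> nat \<Rightarrow> real" where \<phi>: "continuous_map X euclidean \<phi>" "inj_on \<phi> (topspace X)"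
    using compact_metrizable_embeds_in_cube[OF X ne] by metis
  have closed_eq: "emeasure N1 D = emeasure N2 D" if D: "closedin X D" for D
  proof (cases "D = {}")
    case False
    have Dsub: "D \<subseteq> topspace X" using D by (rule closedin_subset)
    have "compactin X D" using closedin_compact_space[OF X(1) D] .
    hence "compactin euclidean (\<phi> ` D)" using \<phi>(1) image_compactin by blast
    hence cl: "closed (\<phi> ` D)" by (simp add: compact_imp_closed)
    define h where "h x = infdist (\<phi> x) (\<phi> ` D)" for x
    have h0: "h x = 0 \<longleftrightarrow> x \<in> D" if "x \<in> topspace X" for x
      unfolding h_def using in_closed_iff_infdist_zero[OF cl, of "\<phi> x"] False \<phi>(2) that Dsub
      by (auto dest: inj_onD)
    have hn: "0 \<le> h x" for x by (simp add: h_def infdist_nonneg)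
    have hc: "continuous_map X euclidean h"
    proof -
      have "continuous_map euclidean euclidean (\<lambda>y. infdist y (\<phi> ` D))"
        by (simp add: continuous_map_iff_continuous2 continuous_on_infdist continuous_on_id)
      from continuous_map_compose[OF \<phi>(1) this] show ?thesis by (simp add: h_def[abs_def] o_def)
    qed
    define g where "g n x = max 0 (1 - real n * h x)" for n x
    have gc: "continuous_map X euclidean (g n)" for n
      unfolding g_def by (intro continuous_intros hc) auto
    have conv: "(\<lambda>n. LINT x|N. g n x) \<longlonglongrightarrow> (LINT x|N. indicator D x)"
      if N: "prob_space N" "space N = topspace X" "sets N = borel_sets_of X" for N :: "'a measure"
    proof (rule integral_dominated_convergence[where w = "\<lambda>_. 1"])
      interpret prob_space N by fact
      show "integrable N (\<lambda>_. 1 :: real)" by simp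
      show "g n \<in> borel_measurable N" for n by (rule continuous_map_borel_measurable[OF N(2,3) gc])
      show "indicator D \<in> borel_measurable N"
        using closedin_borel_sets_of[OF D] N(3) by (intro borel_measurable_indicator) simp
      show "AE x in N. norm (g n x) \<le> 1" for n using hn by (intro AE_I2) (auto simp: g_def)
      show "AE x in N. (\<lambda>n. g n x) \<longlonglongrightarrow> indicator D x"
      proof (rule AE_I2)
        fix x assume "x \<in> space N"
        hence x: "x \<in> topspace X" using N by simp
        show "(\<lambda>n. g n x) \<longlonglongrightarrow> indicator D x"
        proof (cases "x \<in> D")
          case True
          thus ?thesis using h0[OF x] by (simp add: g_def)
        next
          case False
          hence "0 < h x" using h0[OF x] hn[of x] by simp
          then obtain n0 :: nat where "1 < n0 * h x" using ex_less_of_nat_mult by blast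
          have "g n x = 0" if "n \<ge> n0" for n
          proof -
            have "real n0 * h x \<le> real n * h x" using that hn by (intro mult_right_mono) auto
            thus ?thesis using \<open>1 < n0 * h x\<close> by (simp add: g_def)
          qed
          thus ?thesis using False by (intro tendsto_eventually) (auto simp: eventually_sequentially)
        qed
      qed
    qed
    have "(LINT x|N1. indicator D x) = (LINT x|N2. indicator D x :: real)"
      using conv[OF N1] conv[OF N2] eq[OF gc] by (auto intro: LIMSEQ_unique)
    moreover have "D \<in> sets N1" "D \<in> sets N2" using closedin_borel_sets_of[OF D] N1 N2 by auto
    ultimately show ?thesis
      by (simp add: N1.emeasure_eq_measure N2.emeasure_eq_measure)
  qed simp
  have Pow: "{D. closedin X D} \<subseteq> Pow (topspace X)" by (auto dest: closedin_subset)
  have gen: "borel_sets_of X = sigma_sets (topspace X) {D. closedin X D}"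
    unfolding borel_sets_of_def
  proof (rule sigma_sets_eqI)
    fix U assume "U \<in> {U. openin X U}"
    hence U: "openin X U" by simp
    have "topspace X - (topspace X - U) \<in> sigma_sets (topspace X) {D. closedin X D}"
      using U by (intro sigma_sets.Compl sigma_sets.Basic) auto
    thus "U \<in> sigma_sets (topspace X) {D. closedin X D}" using openin_subset[OF U] by (simp add: double_diff)
  next
    fix D assume "D \<in> {D. closedin X D}"
    thus "D \<in> sigma_sets (topspace X) {U. openin X U}"
      using closedin_borel_sets_of[of X D] by (simp add: borel_sets_of_def)
  qed
  show "N1 = N2"
  proof (rule measure_eqI_generator_eq[where \<Omega> = "topspace X" and E = "{D. closedin X D}" and A = "\<lambda>_. topspace X"])
    show "Int_stable {D. closedin X D}" by (auto simp: Int_stable_def)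
    show "\<And>D. D \<in> {D. closedin X D} \<Longrightarrow> emeasure N1 D = emeasure N2 D" using closed_eq by simp
    show "sets N1 = sigma_sets (topspace X) {D. closedin X D}" using N1 gen by simp
    show "sets N2 = sigma_sets (topspace X) {D. closedin X D}" using N2 gen by simp
  qed (use Pow in auto)
qed

text \<open>
  The points of the sequence are lifted to a compact set \<open>C\<close> of real numbers that maps onto the cube
  in which the space is embedded. The empirical measures of the lifts are tight, so a subsequence
  converges weakly by Helly's theorem, and \<open>N\<close> is the image of the limit. The integrand \<open>g \<circ> \<pi>\<close> is only
  defined on a closed set \<open>D\<close> of lifts that carries the limit; Tietze's theorem extends it to the line.
\<close>
lemma empirical_measures_subsequential_limit:
  assumes X: "compact_space X" "metrizable_space X"
    and x: "\<And>i. x i \<in> topspace X" and r: "strict_mono (r :: nat \<Rightarrow> nat)"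
  obtains s N where "strict_mono (s :: nat \<Rightarrow> nat)" "prob_space N" "space N = topspace X"
    "sets N = borel_sets_of X"
    "\<And>g :: 'a \<Rightarrow> real. continuous_map X euclidean g \<Longrightarrow>
       (\<lambda>n. (\<Sum>i<Suc (r (s n)). g (x i)) / Suc (r (s n))) \<longlonglongrightarrow> (LINT y|N. g y)"
proof -
  let ?X = "topspace X"
  have ne: "?X \<noteq> {}" using x by auto
  obtain \<phi> :: "'a \<Rightarrow> nat \<Rightarrow> real" where \<phi>: "continuous_map X euclidean \<phi>" "inj_on \<phi> ?X"
      and \<phi>1: "\<And>x m. 0 \<le> \<phi> x m \<and> \<phi> x m < 1"
    using compact_metrizable_embeds_in_cube[OF X ne] by metis
  obtain C :: "real set" and \<psi> :: "real \<Rightarrow> nat \<Rightarrow> real" where C: "compact C" "continuous_on C \<psi>"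
      and surj: "\<And>y. (\<And>m. 0 \<le> y m \<and> y m < 1) \<Longrightarrow> \<exists>t\<in>C. \<psi> t = y"
    by (rule compact_real_parametrizes_cube) blast
  define pull where "pull E = {t \<in> C. \<psi> t \<in> \<phi> ` E}" for E
  have pull_closed: "closed (pull E)" if "closedin X E" for E
  proof -
    have "compactin X E" using closedin_compact_space[OF X(1) that] .
    hence "compactin euclidean (\<phi> ` E)" using \<phi>(1) image_compactin by blast
    hence "closed (\<phi> ` E)" by (simp add: compact_imp_closed)
    moreover have "pull E = C \<inter> \<psi> -` (\<phi> ` E)" by (auto simp: pull_def)
    ultimately show ?thesis
      using continuous_closed_preimage[OF C(2) compact_imp_closed[OF C(1)]] by simp
  qed
  define D where "D = pull ?X"
  define \<pi> where "\<pi> t = (if t \<in> D then inv_into ?X \<phi> (\<psi> t) else x 0)" for t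
  have D_closed: "closed D" unfolding D_def by (rule pull_closed) simp
  have \<pi>X: "\<pi> t \<in> ?X" for t using x by (auto simp: \<pi>_def D_def pull_def intro: inv_into_into)
  have \<phi>\<pi>: "\<phi> (\<pi> t) = \<psi> t" if "t \<in> D" for t
    using that by (auto simp: \<pi>_def D_def pull_def intro: f_inv_into_f)
  have pull_iff: "t \<in> pull E \<longleftrightarrow> \<pi> t \<in> E" if "E \<subseteq> ?X" "t \<in> D" for E t
  proof
    assume "t \<in> pull E"
    then obtain e where "e \<in> E" "\<psi> t = \<phi> e" by (auto simp: pull_def)
    hence "\<pi> t = e" using \<phi>\<pi>[OF that(2)] \<phi>(2) \<pi>X[of t] that(1) by (auto dest: inj_onD)
    thus "\<pi> t \<in> E" using \<open>e \<in> E\<close> by simp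
  next
    assume "\<pi> t \<in> E"
    hence "\<psi> t \<in> \<phi> ` E" using \<phi>\<pi>[OF that(2)] by (metis imageI)
    thus "t \<in> pull E" using that(2) by (simp add: pull_def D_def)
  qed
  have "\<forall>i. \<exists>t\<in>C. \<psi> t = \<phi> (x i)" using surj \<phi>1 by blast
  then obtain t where t: "\<And>i. t i \<in> C" "\<And>i. \<psi> (t i) = \<phi> (x i)" by metis
  have tD: "t i \<in> D" for i using t x by (auto simp: D_def pull_def)
  have \<pi>t: "\<pi> (t i) = x i" for i
    by (rule inj_onD[OF \<phi>(2) _ \<pi>X x]) (simp add: \<phi>\<pi>[OF tD] t(2))
  obtain B where B: "\<And>s. s \<in> C \<Longrightarrow> \<bar>s\<bar> \<le> B" using compact_imp_bounded[OF C(1)] by (auto simp: bounded_real)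
  have B0: "0 \<le> B" using B[OF t(1)[of 0]] by simp
  define \<mu> where "\<mu> n = distr (measure_pmf (pmf_of_set {..<Suc n})) borel t" for n
  have rd: "real_distribution (\<mu> n)" for n
    unfolding \<mu>_def real_distribution_def real_distribution_axioms_def
    by (auto intro!: prob_space.prob_space_distr measure_pmf.prob_space_axioms)
  have int\<mu>: "(LINT s|\<mu> n. h s) = (\<Sum>i<Suc n. h (t i)) / Suc n" if "h \<in> borel_measurable borel" for n and h :: "real \<Rightarrow> real"
  proof -
    have "(LINT s|\<mu> n. h s) = measure_pmf.expectation (pmf_of_set {..<Suc n}) (\<lambda>i. h (t i))"
      unfolding \<mu>_def using that by (subst integral_distr) auto
    also have "\<dots> = (\<Sum>i<Suc n. h (t i)) / card {..<Suc n}"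
      by (rule integral_pmf_of_set) auto
    finally show ?thesis by simp
  qed
  have "tight \<mu>"
    unfolding tight_def
  proof (intro conjI allI impI rd)
    fix \<epsilon> :: real assume e: "0 < \<epsilon>"
    have "measure (\<mu> n) {-B-1<..B} = 1" for n
    proof -
      interpret real_distribution "\<mu> n" by (rule rd)
      have "t i \<in> {-B-1<..B}" for i using B[OF t(1)[of i]] by auto
      hence "AE s in \<mu> n. s \<in> {-B-1<..B}"
        unfolding \<mu>_def by (subst AE_distr_iff) auto
      thus ?thesis by (simp add: prob_eq_1)
    qed
    thus "\<exists>a b. a < b \<and> (\<forall>n. 1 - \<epsilon> < measure (\<mu> n) {a<..b})"
      using e B0 by (intro exI[of _ "-B-1"] exI[of _ B]) auto
  qed
  then obtain s M where s: "strict_mono (s :: nat \<Rightarrow> nat)" and M: "real_distribution M"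
      and wc: "weak_conv_m (\<mu> \<circ> r \<circ> s) M"
    using tight_imp_convergent_subsubsequence[OF _ r] by blast
  interpret M: real_distribution M by fact
  have lim: "(\<lambda>n. (\<Sum>i<Suc (r (s n)). h (t i)) / Suc (r (s n))) \<longlonglongrightarrow> (LINT s|M. h s)"
    if h: "continuous_on UNIV h" "\<And>s. \<bar>h s\<bar> \<le> c" for h :: "real \<Rightarrow> real" and c
  proof -
    have "(\<lambda>n. integral\<^sup>L ((\<mu> \<circ> r \<circ> s) n) h) \<longlonglongrightarrow> (LINT s|M. h s)"
      by (rule weak_conv_imp_integral_bdd_continuous_conv[OF _ M wc, where B = c])
         (use rd h in \<open>auto simp: continuous_on_eq_continuous_at\<close>)
    thus ?thesis using int\<mu>[OF borel_measurable_continuous_onI[OF h(1)]] by (simp add: o_def)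
  qed
  \<comment> \<open>The distance to \<open>D\<close> vanishes at all lifts, so its truncation has integral 0 in the limit.\<close>
  have AE_D: "AE s in M. s \<in> D"
  proof -
    define h where "h s = min 1 (infdist s D)" for s
    have hn: "0 \<le> h s" "h s \<le> 1" for s by (auto simp: h_def infdist_nonneg)
    have hc: "continuous_on UNIV h" unfolding h_def by (intro continuous_intros)
    have h0: "h (t i) = 0" for i using tD[of i] by (simp add: h_def)
    have "(\<lambda>n. 0) \<longlonglongrightarrow> (LINT s|M. h s)"
      using lim[OF hc, of 1] hn h0 by (simp del: sum.lessThan_Suc)
    hence "(LINT s|M. h s) = 0" by (simp add: LIMSEQ_const_iff)
    moreover have "integrable M h"
      using hn borel_measurable_continuous_onI[OF hc]
      by (intro M.integrable_const_bound[where B = 1]) (auto intro!: AE_I2)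
    ultimately have "AE s in M. h s = 0"
      using hn by (subst integral_nonneg_eq_0_iff_AE[symmetric]) auto
    moreover have "h s \<noteq> 0" if "s \<notin> D" for s
      using in_closed_iff_infdist_zero[OF D_closed, of s] tD[of 0] that by (auto simp: h_def min_def)
    ultimately show ?thesis by (auto elim!: eventually_mono)
  qed
  let ?B = "sigma ?X {U. openin X U}"
  have \<pi>_meas: "\<pi> \<in> M \<rightarrow>\<^sub>M ?B"
  proof (rule measurable_measure_of)
    show "{U. openin X U} \<subseteq> Pow ?X" by (auto dest: openin_subset)
    show "\<pi> \<in> space M \<rightarrow> ?X" using \<pi>X by auto
    fix U assume "U \<in> {U. openin X U}"
    hence U: "openin X U" by simp
    hence "closed (pull (?X - U))" by (intro pull_closed) auto
    moreover have "\<pi> -` U \<inter> space M = (D - pull (?X - U)) \<union> (if x 0 \<in> U then - D else {})"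
    proof -
      have "s \<in> pull (?X - U) \<longleftrightarrow> \<pi> s \<notin> U" if "s \<in> D" for s
        using pull_iff[of "?X - U" s] that \<pi>X[of s] by auto
      moreover have "\<pi> s = x 0" if "s \<notin> D" for s using that by (simp add: \<pi>_def)
      ultimately have "\<pi> s \<in> U \<longleftrightarrow> s \<in> (D - pull (?X - U)) \<union> (if x 0 \<in> U then - D else {})" for s
        by (cases "s \<in> D") simp_all
      thus ?thesis by auto
    qed
    ultimately show "\<pi> -` U \<inter> space M \<in> sets M" using D_closed by auto
  qed
  define N where "N = distr M ?B \<pi>"
  have N: "prob_space N" "space N = ?X" "sets N = borel_sets_of X"
    unfolding N_def using borel_sets_of_sigma[of X] M.prob_space_distr[OF \<pi>_meas] by simp_all
  show ?thesis
  proof (rule that[OF s N])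
    fix g :: "'a \<Rightarrow> real" assume g: "continuous_map X euclidean g"
    obtain c where c: "0 \<le> c" "\<And>y. y \<in> ?X \<Longrightarrow> \<bar>g y\<bar> \<le> c" using continuous_map_bounded[OF X(1) g] by blast
    have "continuous_on D (\<lambda>s. g (\<pi> s))"
      unfolding continuous_on_closed_vimage[OF D_closed]
    proof (intro allI impI)
      fix K :: "real set" assume "closed K"
      hence cl: "closedin X {y \<in> ?X. g y \<in> K}"
        using g closedin_continuous_map_preimage[of X euclidean g K] by simp
      have "(\<lambda>s. g (\<pi> s)) -` K \<inter> D = pull {y \<in> ?X. g y \<in> K} \<inter> D"
        using pull_iff[of "{y \<in> ?X. g y \<in> K}"] \<pi>X by auto
      thus "closed ((\<lambda>s. g (\<pi> s)) -` K \<inter> D)" using pull_closed[OF cl] D_closed by auto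
    qed
    then obtain h where h: "continuous_on UNIV h" "\<And>s. s \<in> D \<Longrightarrow> h s = g (\<pi> s)" "\<And>s. \<bar>h s\<bar> \<le> c"
      using Tietze[of D "\<lambda>s. g (\<pi> s)" UNIV c] D_closed c \<pi>X by (auto simp: real_norm_def)
    have "(LINT y|N. g y) = (LINT s|M. g (\<pi> s))"
      unfolding N_def using \<pi>_meas
      by (rule integral_distr) (rule continuous_map_borel_measurable[OF borel_sets_of_sigma g])
    also have "\<dots> = (LINT s|M. h s)"
    proof (rule integral_cong_AE)
      show "(\<lambda>s. g (\<pi> s)) \<in> borel_measurable M"
        by (rule measurable_compose[OF \<pi>_meas continuous_map_borel_measurable[OF borel_sets_of_sigma g]])
      show "h \<in> borel_measurable M" using borel_measurable_continuous_onI[OF h(1)] by simp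
      show "AE s in M. g (\<pi> s) = h s" using AE_D by eventually_elim (simp add: h(2))
    qed
    finally show "(\<lambda>n. (\<Sum>i<Suc (r (s n)). g (x i)) / Suc (r (s n))) \<longlonglongrightarrow> (LINT y|N. g y)"
      using lim[OF h(1,3)] h(2)[OF tD] \<pi>t by (simp del: sum.lessThan_Suc)
  qed
qed

text \<open>
  Otherwise the averages stay away from the integral along a subsequence. Along a further subsequence
  the empirical measures of the orbit converge to a probability measure \<open>N\<close>. It is invariant, because
  shifting the orbit by one step changes the averages of a bounded function only by \<open>O(1/n)\<close>. By
  uniqueness \<open>N\<close> is the given measure, a contradiction.
\<close>
theorem uniquely_ergodic_birkhoff:
  fixes f :: "'a \<Rightarrow> real"
  assumes X: "compact_space X" "metrizable_space X" and T: "continuous_map X X T"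
    and ue: "uniquely_ergodic X T"
    and M: "prob_space M" "space M = topspace X" "sets M = borel_sets_of X" "measure_preserving_map M T"
    and f: "continuous_map X euclidean f" and \<omega>: "\<omega> \<in> topspace X"
  shows "(\<lambda>n. orbit_sum T f n \<omega> / n) \<longlonglongrightarrow> (LINT y|M. f y)"
proof (rule ccontr)
  let ?L = "LINT y|M. f y"
  let ?a = "\<lambda>n. orbit_sum T f (Suc n) \<omega> / Suc n"
  let ?x = "\<lambda>i. (T ^^ i) \<omega>"
  have x: "?x i \<in> topspace X" for i
  proof (induction i)
    case (Suc i)
    thus ?case using continuous_map_image_subset_topspace[OF T] by auto
  qed (simp add: \<omega>)
  assume "\<not> (\<lambda>n. orbit_sum T f n \<omega> / n) \<longlonglongrightarrow> ?L"
  hence "\<not> ?a \<longlonglongrightarrow> ?L" using filterlim_sequentially_Suc[of "\<lambda>n. orbit_sum T f n \<omega> / n" "nhds ?L"] by blast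
  then obtain e where e: "0 < e" "\<And>n0. \<exists>n\<ge>n0. e \<le> dist (?a n) ?L"
    by (auto simp: lim_sequentially not_less simp del: of_nat_Suc)
  hence "infinite {n. e \<le> dist (?a n) ?L}"
    unfolding infinite_nat_iff_unbounded_le by blast
  then obtain r :: "nat \<Rightarrow> nat" where r: "strict_mono r" "\<And>n. e \<le> dist (?a (r n)) ?L"
    using infinite_enumerate by blast
  obtain s N where s: "strict_mono (s :: nat \<Rightarrow> nat)"
    and N: "prob_space N" "space N = topspace X" "sets N = borel_sets_of X"
    and lim: "\<And>g :: 'a \<Rightarrow> real. continuous_map X euclidean g \<Longrightarrow>
       (\<lambda>n. (\<Sum>i<Suc (r (s n)). g (?x i)) / Suc (r (s n))) \<longlonglongrightarrow> (LINT y|N. g y)"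
    using empirical_measures_subsequential_limit[where x = ?x, OF X x r(1)] by blast
  have T_meas: "T \<in> N \<rightarrow>\<^sub>M N"
  proof -
    have "T \<in> M \<rightarrow>\<^sub>M M" using M by (simp add: measure_preserving_map_def)
    thus ?thesis using measurable_cong_sets[of N M N M] M N by auto
  qed
  have "distr N N T = N"
  proof (rule measure_eqI_continuous_integrals[OF X])
    show "prob_space (distr N N T)" by (rule prob_space.prob_space_distr[OF N(1) T_meas])
    show "space (distr N N T) = topspace X" "sets (distr N N T) = borel_sets_of X" using N by simp_all
    fix g :: "'a \<Rightarrow> real" assume g: "continuous_map X euclidean g"
    obtain c where c: "0 \<le> c" "\<And>y. y \<in> topspace X \<Longrightarrow> \<bar>g y\<bar> \<le> c" using continuous_map_bounded[OF X(1) g] by blast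
    have gT: "continuous_map X euclidean (\<lambda>y. g (T y))"
      using continuous_map_compose[OF T g] by (simp add: o_def)
    let ?n = "\<lambda>n. Suc (r (s n))"
    have "(\<lambda>n. (\<Sum>i<?n n. g (T (?x i))) / ?n n - (\<Sum>i<?n n. g (?x i)) / ?n n)
        \<longlonglongrightarrow> (LINT y|N. g (T y)) - (LINT y|N. g y)"
      by (intro tendsto_diff lim g gT)
    moreover have "(\<lambda>n. (\<Sum>i<?n n. g (T (?x i))) / ?n n - (\<Sum>i<?n n. g (?x i)) / ?n n) \<longlonglongrightarrow> 0"
    proof (rule Lim_null_comparison)
      have "strict_mono (\<lambda>n. r (s n))" using r(1) s by (simp add: strict_mono_def)
      hence ge: "n \<le> r (s n)" for n by (rule strict_mono_imp_increasing)
      have "norm ((\<Sum>i<?n n. g (T (?x i))) / ?n n - (\<Sum>i<?n n. g (?x i)) / ?n n) \<le> 2 * c / Suc n" for n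
      proof -
        have "(\<Sum>i<?n n. g (T (?x i))) = (\<Sum>i<?n n. g (?x (Suc i)))" by simp
        also have "\<dots> = (\<Sum>i<?n n. g (?x i)) + g (?x (?n n)) - g (?x 0)"
          using sum_lessThan_telescope[of "\<lambda>i. g (?x i)" "?n n"] by (simp add: sum_subtractf del: sum.lessThan_Suc)
        finally have "\<bar>(\<Sum>i<?n n. g (T (?x i))) - (\<Sum>i<?n n. g (?x i))\<bar> \<le> 2 * c"
          using c(2)[OF x[of "?n n"]] c(2)[OF x[of 0]] by linarith
        hence "\<bar>(\<Sum>i<?n n. g (T (?x i))) - (\<Sum>i<?n n. g (?x i))\<bar> / ?n n \<le> 2 * c / Suc n"
          using ge[of n] c(1) by (intro frac_le) auto
        thus ?thesis by (simp add: diff_divide_distrib[symmetric] abs_divide del: sum.lessThan_Suc)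
      qed
      thus "\<forall>\<^sub>F n in sequentially. norm ((\<Sum>i<?n n. g (T (?x i))) / ?n n - (\<Sum>i<?n n. g (?x i)) / ?n n) \<le> 2 * c / Suc n"
        by simp
      show "(\<lambda>n. 2 * c / Suc n) \<longlonglongrightarrow> 0" by (rule LIMSEQ_Suc[OF lim_const_over_n])
    qed
    ultimately have "(LINT y|N. g (T y)) = (LINT y|N. g y)" using LIMSEQ_unique by fastforce
    thus "(LINT y|distr N N T. g y) = (LINT y|N. g y)"
      by (subst integral_distr[OF T_meas continuous_map_borel_measurable[OF N(2,3) g]])
  qed (use N in auto)
  hence "measure_preserving_map N T" using T_meas by (simp add: measure_preserving_map_def)
  moreover from ue obtain N' where "\<And>N. prob_space N \<Longrightarrow> space N = topspace X \<Longrightarrow> sets N = borel_sets_of X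
      \<Longrightarrow> measure_preserving_map N T \<Longrightarrow> N = N'"
    unfolding uniquely_ergodic_def by (elim ex1E) blast
  ultimately have "N = N'" "M = N'" using N M by blast+
  hence "N = M" by simp
  hence "(\<lambda>n. ?a (r (s n))) \<longlonglongrightarrow> ?L" using lim[OF f] by (simp add: orbit_sum_def del: sum.lessThan_Suc)
  then obtain n where "dist (?a (r (s n))) ?L < e"
    using e(1) unfolding lim_sequentially by blast
  thus False using r(2)[of "s n"] by simp
qed

section \<open>Subadditive arrays\<close>

text \<open>
  In applications \<open>u i n\<close> is the value belonging to the orbit segment of length \<open>n\<close> that starts at time \<open>i\<close>.
\<close>
lemma subadditive_array_blocks:
  fixes u :: "nat \<Rightarrow> nat \<Rightarrow> real"
  assumes sub: "\<And>i a b. u i (a + b) \<le> u i a + u (i + a) b"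
  shows "u i (l * m + t) \<le> (\<Sum>q<l. u (i + q * m) m) + u (i + l * m) t"
proof (induction l arbitrary: t)
  case (Suc l)
  have "u i (Suc l * m + t) = u i (l * m + (m + t))" by (simp add: algebra_simps)
  also have "\<dots> \<le> (\<Sum>q<l. u (i + q * m) m) + u (i + l * m) (m + t)" by (rule Suc.IH)
  also have "u (i + l * m) (m + t) \<le> u (i + l * m) m + u (i + l * m + m) t" by (rule sub)
  finally show ?case by (simp add: algebra_simps)
qed simp

lemma subadditive_array_le_singles:
  fixes u :: "nat \<Rightarrow> nat \<Rightarrow> real"
  assumes sub: "\<And>i a b. u i (a + b) \<le> u i a + u (i + a) b"
  shows "u i (Suc t) \<le> (\<Sum>j\<in>{i..<i + Suc t}. u j 1)"
proof (induction t)
  case (Suc t)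
  have "u i (Suc t + 1) \<le> u i (Suc t) + u (i + Suc t) 1" by (rule sub)
  thus ?case using Suc by simp
qed simp

text \<open>
  For each offset \<open>i < m\<close> the segment is cut into an initial piece of length \<open>i\<close>, blocks of length \<open>m\<close> and a
  final piece. Summing over \<open>i\<close>, the blocks start at distinct times, and each final piece lies within
  the last \<open>2 m\<close> steps.
\<close>
lemma subadditive_array_average_bound:
  fixes u :: "nat \<Rightarrow> nat \<Rightarrow> real"
  assumes sub: "\<And>i a b. u i (a + b) \<le> u i a + u (i + a) b"
    and nonneg: "\<And>i a. 0 \<le> u i a" and m: "0 < m"
  shows "m * u 0 (k + 2 * m) \<le> (\<Sum>i<m. u 0 i) + (\<Sum>j<k + 2 * m. u j m)
     + m * ((\<Sum>j<k + 2 * m. u j 1) - (\<Sum>j<k. u j 1))"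
proof -
  define n where "n = k + 2 * m"
  \<comment> \<open>With one block less than would fit at offset 0, the final piece is nonempty for every offset below \<open>m\<close>.\<close>
  define l where "l = n div m - 1"
  have "2 \<le> n div m" using m by (simp add: n_def)
  hence nl: "n = l * m + m + n mod m" using div_mult_mod_eq[of n m] by (simp add: l_def diff_mult_distrib)
  have nmod: "n mod m < m" using m by simp
  have kl: "k \<le> l * m" using nl nmod n_def by linarith
  let ?\<tau> = "\<Sum>j\<in>{k..<n}. u j 1"
  have each: "u 0 n \<le> u 0 i + (\<Sum>q<l. u (i + q * m) m) + ?\<tau>" if i: "i < m" for i
  proof -
    obtain t where t: "n = i + (l * m + Suc t)"
    proof
      show "n = i + (l * m + Suc (n - i - l * m - 1))" using nl i by linarith
    qed
    have "u 0 n \<le> u 0 i + u i (l * m + Suc t)" using sub[of 0 i "l * m + Suc t"] by (simp add: t)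
    also have "u i (l * m + Suc t) \<le> (\<Sum>q<l. u (i + q * m) m) + u (i + l * m) (Suc t)"
      by (rule subadditive_array_blocks[where u = u, OF sub])
    also have "u (i + l * m) (Suc t) \<le> (\<Sum>j\<in>{i + l * m..<i + l * m + Suc t}. u j 1)"
      by (rule subadditive_array_le_singles[where u = u, OF sub])
    also have "\<dots> \<le> ?\<tau>"
      by (rule sum_mono2) (use kl t nonneg in auto)
    finally show ?thesis by simp
  qed
  have "m * u 0 n = (\<Sum>i<m. u 0 n)" by simp
  also have "\<dots> \<le> (\<Sum>i<m. u 0 i + (\<Sum>q<l. u (i + q * m) m) + ?\<tau>)"
    by (rule sum_mono) (use each in auto)
  also have "\<dots> = (\<Sum>i<m. u 0 i) + (\<Sum>i<m. \<Sum>q<l. u (i + q * m) m) + m * ?\<tau>"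
    by (simp add: sum.distrib)
  also have "(\<Sum>i<m. \<Sum>q<l. u (i + q * m) m) \<le> (\<Sum>j<n. u j m)"
  proof -
    have "(\<Sum>i<m. \<Sum>q<l. u (i + q * m) m) = (\<Sum>q<l. \<Sum>i<m. u (i + q * m) m)" by (rule sum.swap)
    also have "\<dots> = (\<Sum>q<l. \<Sum>j\<in>{q * m..<q * m + m}. u j m)"
    proof (rule sum.cong)
      fix q
      show "(\<Sum>i<m. u (i + q * m) m) = (\<Sum>j\<in>{q * m..<q * m + m}. u j m)"
        using sum.shift_bounds_nat_ivl[of "\<lambda>j. u j m" 0 "q * m" m]
        by (simp add: atLeast0LessThan add.commute)
    qed simp
    also have "\<dots> = (\<Sum>j<l * m. u j m)" by (rule sum.nat_group)
    also have "\<dots> \<le> (\<Sum>j<n. u j m)" by (rule sum_mono2) (use nl nonneg in auto)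
    finally show ?thesis .
  qed
  also have "?\<tau> = (\<Sum>j<n. u j 1) - (\<Sum>j<k. u j 1)"
    using sum_diff_nat_ivl[of 0 k n "\<lambda>j. u j 1"] by (simp add: n_def atLeast0LessThan)
  finally show ?thesis by (simp add: n_def)
qed

text \<open>
  In the previous bound, the contribution of the last \<open>2 m\<close> steps is \<open>o(n)\<close>: it is the difference of
  two orbit sums, of lengths \<open>k + 2 m\<close> and \<open>k\<close>, with the same asymptotic average.
\<close>
lemma subadditive_array_limsup:
  fixes u :: "nat \<Rightarrow> nat \<Rightarrow> real"
  assumes sub: "\<And>i a b. u i (a + b) \<le> u i a + u (i + a) b"
    and nonneg: "\<And>i a. 0 \<le> u i a" and m: "0 < m"
    and avg: "(\<lambda>n. (\<Sum>j<n. u j m) / n) \<longlonglongrightarrow> c"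
    and avg1: "(\<lambda>n. (\<Sum>j<n. u j 1) / n) \<longlonglongrightarrow> c1"
    and e: "0 < e"
  shows "\<forall>\<^sub>F n in sequentially. u 0 n / n < c / m + e"
proof -
  define C where "C = (\<Sum>i<m. u 0 i)"
  define A where "A n = (\<Sum>j<n. u j m) / real n" for n
  define S where "S n = (\<Sum>j<n. u j 1) / real n" for n
  define R where "R k = C / m / real (k + 2 * m) + A (k + 2 * m) / m
      + (S (k + 2 * m) - S k * (1 - real (2 * m) / real (k + 2 * m)))" for k
  have z: "(\<lambda>k. x / real (k + 2 * m)) \<longlonglongrightarrow> 0" for x
    by (rule LIMSEQ_ignore_initial_segment[OF lim_const_over_n])
  have A: "A \<longlonglongrightarrow> c" using avg by (simp add: A_def[abs_def])
  have S: "S \<longlonglongrightarrow> c1" using avg1 by (simp add: S_def[abs_def])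
  have "R \<longlonglongrightarrow> 0 + c / m + (c1 - c1 * (1 - 0))"
    unfolding R_def
    by (intro tendsto_add tendsto_diff tendsto_mult tendsto_const tendsto_divide z
          LIMSEQ_ignore_initial_segment[OF A] LIMSEQ_ignore_initial_segment[OF S] S) (use m in simp)
  hence ev: "\<forall>\<^sub>F k in sequentially. R k < c / m + e" using e by (intro order_tendstoD) auto
  have le: "u 0 (k + 2 * m) / real (k + 2 * m) \<le> R k" if k: "0 < k" for k
  proof -
    let ?n = "real (k + 2 * m)"
    have "u 0 (k + 2 * m) \<le> (C + (\<Sum>j<k + 2 * m. u j m)) / m + ((\<Sum>j<k + 2 * m. u j 1) - (\<Sum>j<k. u j 1))"
      using subadditive_array_average_bound[where u = u, OF sub nonneg m, of k] m
      by (simp add: C_def field_simps)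
    hence "u 0 (k + 2 * m) / ?n
      \<le> ((C + (\<Sum>j<k + 2 * m. u j m)) / m + ((\<Sum>j<k + 2 * m. u j 1) - (\<Sum>j<k. u j 1))) / ?n"
      by (rule divide_right_mono) simp
    also have "\<dots> = C / m / ?n + A (k + 2 * m) / m + (S (k + 2 * m) - (\<Sum>j<k. u j 1) / ?n)"
      by (simp add: A_def S_def add_divide_distrib diff_divide_distrib mult.commute)
    also have "(\<Sum>j<k. u j 1) / ?n = S k * (1 - real (2 * m) / ?n)"
      using k by (simp add: S_def field_simps)
    finally show ?thesis by (simp add: R_def)
  qed
  have "\<forall>\<^sub>F k in sequentially. u 0 (k + 2 * m) / real (k + 2 * m) < c / m + e"
    using ev eventually_gt_at_top[of "0::nat"]
    by eventually_elim (use le in \<open>meson le_less_trans\<close>)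
  thus ?thesis using eventually_sequentially_seg[of "\<lambda>n. u 0 n / real n < c / m + e" "2 * m"] by simp
qed

text \<open>
  A subadditive sequence is a subadditive array that does not depend on the starting time, and then the
  averages over starting times are trivial.
\<close>
lemma fekete_nonneg:
  fixes a :: "nat \<Rightarrow> real"
  assumes sub: "\<And>m n. a (m + n) \<le> a m + a n" and nonneg: "\<And>n. 0 \<le> a n"
  obtains L where "(\<lambda>n. a n / n) \<longlonglongrightarrow> L" "\<And>e. 0 < e \<Longrightarrow> \<exists>m>0. a m / m < L + e"
proof -
  define L where "L = (INF m\<in>{0<..}. a m / real m)"
  have bdd: "bdd_below ((\<lambda>m. a m / real m) ` {0<..})"
    by (rule bdd_belowI2[of _ 0]) (simp add: nonneg)
  have ex: "\<exists>m>0. a m / real m < L + e" if "0 < e" for e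
    using cINF_less_iff[OF _ bdd, of "L + e"] that by (force simp: L_def)
  have "(\<lambda>n. a n / n) \<longlonglongrightarrow> L"
  proof (rule order_tendstoI)
    fix x assume "x < L"
    have le: "L \<le> a n / n" if "n > 0" for n unfolding L_def by (rule cINF_lower[OF bdd]) (use that in simp)
    show "\<forall>\<^sub>F n in sequentially. x < a n / n"
      using eventually_gt_at_top[of "0::nat"]
      by eventually_elim (use le \<open>x < L\<close> in \<open>meson less_le_trans\<close>)
  next
    fix x assume x: "L < x"
    obtain m where m: "m > 0" "a m / m < L + (x - L) / 2" using ex[of "(x - L) / 2"] x by auto
    have const: "(\<lambda>n. (\<Sum>j<n. b) / real n) \<longlonglongrightarrow> b" for b :: real
      by (rule tendsto_eventually, rule eventually_mono[OF eventually_gt_at_top[of 0]]) simp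
    have "\<forall>\<^sub>F n in sequentially. a n / n < a m / m + (x - L) / 2"
      by (rule subadditive_array_limsup[where u = "\<lambda>_. a", OF sub nonneg m(1) const const]) (use x in simp)
    thus "\<forall>\<^sub>F n in sequentially. a n / n < x"
    proof eventually_elim
      case (elim n)
      have "x = L + (x - L) / 2 + (x - L) / 2" by (simp add: field_simps)
      thus ?case using elim m(2) by linarith
    qed
  qed
  thus ?thesis using ex that by blast
qed

text \<open>
  The tube lemma makes \<open>g x z\<close> close to \<open>g x0 z\<close> uniformly in \<open>z \<in> K\<close> for \<open>x\<close> near \<open>x0\<close>.
\<close>
lemma continuous_on_SUP_compact:
  fixes g :: "'a::t2_space \<Rightarrow> 'b::topological_space \<Rightarrow> real"
  assumes K: "compact K" "K \<noteq> {}" and g: "continuous_on UNIV (\<lambda>p. g (fst p) (snd p))"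
  shows "continuous_on UNIV (\<lambda>x. SUP z\<in>K. g x z)"
proof -
  have bdd: "bdd_above (g x ` K)" for x
  proof -
    have "continuous_on K (\<lambda>z. g (fst (x, z)) (snd (x, z)))"
      by (rule continuous_on_compose2[OF g]) (auto intro!: continuous_intros)
    hence "compact (g x ` K)" using K by (auto intro: compact_continuous_image)
    thus ?thesis by (intro bounded_imp_bdd_above compact_imp_bounded)
  qed
  have le: "(SUP z\<in>K. g x z) \<le> (SUP z\<in>K. g y z) + e" if "\<And>z. z \<in> K \<Longrightarrow> g x z \<le> g y z + e" for x y e
  proof (rule cSUP_least[OF K(2)])
    fix z assume z: "z \<in> K"
    have "g y z \<le> (SUP z\<in>K. g y z)" by (rule cSUP_upper[OF z bdd])
    thus "g x z \<le> (SUP z\<in>K. g y z) + e" using that[OF z] by linarith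
  qed
  have near: "\<exists>U. open U \<and> x0 \<in> U \<and> (\<forall>x\<in>U. \<forall>z\<in>K. \<bar>g x z - g x0 z\<bar> < e)" if e: "0 < e" for x0 and e :: real
  proof -
    have "\<exists>A B. open A \<and> open B \<and> x0 \<in> A \<and> z \<in> B \<and> (\<forall>x\<in>A. \<forall>y\<in>B. \<bar>g x y - g x0 z\<bar> < e / 2)" for z
    proof -
      have "open ((\<lambda>p. g (fst p) (snd p)) -` ball (g x0 z) (e / 2))"
        by (rule open_vimage[OF open_ball g])
      moreover have "(x0, z) \<in> (\<lambda>p. g (fst p) (snd p)) -` ball (g x0 z) (e / 2)" using e by simp
      ultimately obtain A B where "open A" "open B" "(x0, z) \<in> A \<times> B"
          and sub: "A \<times> B \<subseteq> (\<lambda>p. g (fst p) (snd p)) -` ball (g x0 z) (e / 2)"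
        by (rule open_prod_elim)
      moreover have "\<bar>g x y - g x0 z\<bar> < e / 2" if "x \<in> A" "y \<in> B" for x y
        using subsetD[OF sub, of "(x, y)"] that by (simp add: dist_real_def abs_minus_commute)
      ultimately show ?thesis by blast
    qed
    then obtain A B where AB: "\<And>z. open (A z)" "\<And>z. open (B z)" "\<And>z. x0 \<in> A z" "\<And>z. z \<in> B z"
      "\<And>z x y. x \<in> A z \<Longrightarrow> y \<in> B z \<Longrightarrow> \<bar>g x y - g x0 z\<bar> < e / 2" by metis
    obtain F where F: "F \<subseteq> K" "finite F" "K \<subseteq> (\<Union>z\<in>F. B z)"
      by (rule compactE_image[OF K(1), of K B]) (use AB in auto)
    have "\<bar>g x z - g x0 z\<bar> < e" if x: "x \<in> (\<Inter>z\<in>F. A z)" and z: "z \<in> K" for x z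
    proof -
      obtain w where w: "w \<in> F" "z \<in> B w" using F z by auto
      have "\<bar>g x z - g x0 w\<bar> < e / 2" "\<bar>g x0 z - g x0 w\<bar> < e / 2"
        using AB(5)[of x w z] AB(5)[of x0 w z] AB(3) w x by auto
      thus ?thesis by linarith
    qed
    moreover have "open (\<Inter>z\<in>F. A z)" "x0 \<in> (\<Inter>z\<in>F. A z)" using AB F by auto
    ultimately show ?thesis by blast
  qed
  show ?thesis
  proof (rule continuous_at_imp_continuous_on, rule ballI)
    fix x0
    show "isCont (\<lambda>x. SUP z\<in>K. g x z) x0"
      unfolding isCont_def
    proof (rule tendstoI)
      fix e :: real assume "0 < e"
      hence "0 < e / 2" by simp
      then obtain U where U: "open U" "x0 \<in> U" "\<And>x z. x \<in> U \<Longrightarrow> z \<in> K \<Longrightarrow> \<bar>g x z - g x0 z\<bar> < e / 2"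
        using near[of "e / 2" x0] by blast
      have "dist (SUP z\<in>K. g x z) (SUP z\<in>K. g x0 z) < e" if "x \<in> U" for x
      proof -
        have "(SUP z\<in>K. g x z) \<le> (SUP z\<in>K. g x0 z) + e / 2"
          by (rule le, drule U(3)[OF that]) linarith
        moreover have "(SUP z\<in>K. g x0 z) \<le> (SUP z\<in>K. g x z) + e / 2"
          by (rule le, drule U(3)[OF that]) linarith
        ultimately show ?thesis using \<open>0 < e\<close> by (simp add: dist_real_def abs_less_iff)
      qed
      thus "\<forall>\<^sub>F x in at x0. dist (SUP z\<in>K. g x z) (SUP z\<in>K. g x0 z) < e"
        using U by (auto simp: eventually_at_topological)
    qed
  qed
qed

section \<open>Suprema of the subadditive cocycle over sets of parameters\<close>

lemma limsup_le_0_I: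
  fixes f :: "nat \<Rightarrow> ereal"
  assumes "\<And>e::real. 0 < e \<Longrightarrow> \<forall>\<^sub>F n in sequentially. f n \<le> ereal e"
  shows "limsup f \<le> 0"
proof (rule ereal_le_epsilon2)
  fix e :: real assume "0 < e"
  hence "limsup f \<le> ereal e" by (intro Limsup_bounded assms)
  thus "limsup f \<le> 0 + ereal e" by simp
qed

locale ergodic_schroedinger = prob_space M for M :: "'a measure" +
  fixes T :: "'a \<Rightarrow> 'a" and F :: "'a \<Rightarrow> real^'w^'w"
  assumes ergodic: "ergodic_map M T"
    and F_measurable: "F \<in> M \<rightarrow>\<^sub>M borel"
    and log_integrable: "integrable M (\<lambda>\<omega>. log_plus (onorm (\<lambda>x. F \<omega> *v x)))"
begin

lemma T_preserving: "measure_preserving_map M T"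
  using ergodic by (simp add: ergodic_map_def)

lemma iterate_preserving: "measure_preserving_map M (T ^^ i)"
  by (rule measure_preserving_iterate[OF T_preserving])

lemma iterate_measurable [measurable]: "T ^^ i \<in> M \<rightarrow>\<^sub>M M"
  using iterate_preserving by (simp add: measure_preserving_map_def)

definition potentials :: "'a \<Rightarrow> nat \<Rightarrow> real^'w^'w" where
  "potentials \<omega> i = F ((T ^^ i) \<omega>)"

lemma cocycle_eq: "cocycle T F n \<omega> z = tproduct (potentials \<omega>) n z"
  by (simp add: cocycle_eq_tproduct potentials_def[abs_def])

lemma potentials_shift: "(\<lambda>i. potentials \<omega> (i + m)) = potentials ((T ^^ m) \<omega>)"
  by (simp add: potentials_def fun_eq_iff funpow_add)

lemma potentials_measurable: "potentials \<in> borel_measurable M"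
  unfolding potentials_def[abs_def]
  by (rule measurable_coordinatewise_then_product)
     (rule measurable_compose[OF iterate_measurable F_measurable])

definition sup_log :: "nat \<Rightarrow> nat \<Rightarrow> complex set \<Rightarrow> 'a \<Rightarrow> real" where
  "sup_log k n B \<omega> = (SUP z\<in>B. wedge_log k n (potentials \<omega>) z)"

lemma sup_log_singleton: "sup_log k n {z} \<omega> = wedge_log k n (potentials \<omega>) z"
  by (simp add: sup_log_def)

lemma continuous_on_sup_wedge_log:
  assumes "k \<le> CARD('w)" "compact B" "B \<noteq> {}"
  shows "continuous_on UNIV (\<lambda>v :: nat \<Rightarrow> real^'w^'w. SUP z\<in>B. wedge_log k n v z)"
  by (intro continuous_on_SUP_compact assms continuous_on_wedge_log continuous_intros)

lemma sup_log_measurable: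
  assumes "k \<le> CARD('w)" "compact B" "B \<noteq> {}"
  shows "sup_log k n B \<in> borel_measurable M"
  unfolding sup_log_def[abs_def]
  by (rule measurable_compose[OF potentials_measurable
        borel_measurable_continuous_onI[OF continuous_on_sup_wedge_log[OF assms]]])

lemma sup_log_continuous_map:
  assumes "k \<le> CARD('w)" "compact B" "B \<noteq> {}"
    and "continuous_map X X T" "continuous_map X euclidean F"
  shows "continuous_map X euclidean (sup_log k n B)"
proof -
  have TX: "continuous_map X X (T ^^ i)" for i
  proof (induction i)
    case (Suc i)
    thus ?case using continuous_map_compose[OF Suc assms(4)] by (simp add: o_def)
  qed simp
  have "continuous_map X euclidean (\<lambda>\<omega>. potentials \<omega> i)" for i
    using continuous_map_compose[OF TX[of i] assms(5)] by (simp add: potentials_def o_def)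
  hence "continuous_map X (product_topology (\<lambda>i. euclidean) UNIV) potentials"
    by (intro continuous_map_coordinatewise_then_product) auto
  hence "continuous_map X euclidean potentials" by (simp add: euclidean_product_topology)
  moreover have "continuous_map euclidean euclidean (\<lambda>v :: nat \<Rightarrow> real^'w^'w. SUP z\<in>B. wedge_log k n v z)"
    using continuous_on_sup_wedge_log[OF assms(1-3)] by (simp add: continuous_map_iff_continuous2)
  ultimately have "continuous_map X euclidean ((\<lambda>v. SUP z\<in>B. wedge_log k n v z) \<circ> potentials)"
    by (rule continuous_map_compose)
  thus ?thesis by (simp add: sup_log_def[abs_def] o_def)
qed

lemma bdd_above_wedge_log:
  fixes v :: "nat \<Rightarrow> real^'w^'w"
  assumes "k \<le> CARD('w)" "compact B"
  shows "bdd_above (wedge_log k n v ` B)"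
  by (intro bounded_imp_bdd_above compact_imp_bounded compact_continuous_image
      continuous_on_wedge_log assms continuous_intros)

lemma wedge_log_le_sup_log:
  assumes "k \<le> CARD('w)" "compact B" "z \<in> B"
  shows "wedge_log k n (potentials \<omega>) z \<le> sup_log k n B \<omega>"
  unfolding sup_log_def by (rule cSUP_upper[OF assms(3) bdd_above_wedge_log[OF assms(1,2)]])

lemma sup_log_nonneg:
  assumes "k \<le> CARD('w)" "compact B" "B \<noteq> {}"
  shows "0 \<le> sup_log k n B \<omega>"
proof -
  obtain z where "z \<in> B" using assms by blast
  thus ?thesis using wedge_log_le_sup_log[OF assms(1,2)] wedge_log_nonneg[OF assms(1)] order_trans by blast
qed

lemma sup_log_mono:
  assumes "k \<le> CARD('w)" "compact B" "A \<subseteq> B" "A \<noteq> {}"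
  shows "sup_log k n A \<omega> \<le> sup_log k n B \<omega>"
  unfolding sup_log_def
  by (rule cSUP_subset_mono[OF assms(4) bdd_above_wedge_log[OF assms(1,2)] assms(3)]) simp

lemma sup_log_subadditive:
  assumes "k \<le> CARD('w)" "compact B" "B \<noteq> {}"
  shows "sup_log k (m + n) B \<omega> \<le> sup_log k m B \<omega> + sup_log k n B ((T ^^ m) \<omega>)"
  unfolding sup_log_def[of k "m + n"]
proof (rule cSUP_least[OF assms(3)])
  fix z assume z: "z \<in> B"
  have "wedge_log k (m + n) (potentials \<omega>) z
      \<le> wedge_log k n (potentials ((T ^^ m) \<omega>)) z + wedge_log k m (potentials \<omega>) z"
    using wedge_log_subadditive[OF assms(1), of n m "potentials \<omega>" z]
    by (simp add: potentials_shift add.commute)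
  thus "wedge_log k (m + n) (potentials \<omega>) z \<le> sup_log k m B \<omega> + sup_log k n B ((T ^^ m) \<omega>)"
    using wedge_log_le_sup_log[OF assms(1,2) z, of m \<omega>]
      wedge_log_le_sup_log[OF assms(1,2) z, of n "(T ^^ m) \<omega>"] by linarith
qed

text \<open>
  By subadditivity everything reduces to one step, where the supremum is bounded in terms of
  \<open>log_plus\<close> of the norm of the potential. The function for \<open>n = 0\<close> is a constant.
\<close>
lemma sup_log_integrable:
  assumes k: "k \<le> CARD('w)" "compact B" "B \<noteq> {}"
  shows "integrable M (sup_log k n B)"
proof (induction n)
  case 0
  \<comment> \<open>The empty product does not see the potential, so any potential may stand for it.\<close>
  have "sup_log k 0 B = (\<lambda>_. SUP z\<in>B. wedge_log k 0 (\<lambda>_. 0 :: real^'w^'w) z)"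
    by (simp add: sup_log_def[abs_def] wedge_log_def)
  thus ?case by simp
next
  case (Suc n)
  have one: "integrable M (sup_log k 1 B)"
  proof -
    obtain R where R: "\<And>z. z \<in> B \<Longrightarrow> cmod z \<le> R"
      using compact_imp_bounded[OF k(2)] by (auto simp: bounded_iff)
    define g where "g \<omega> = k * (ln (2 * CARD('w) * (R + 2)) + log_plus (onorm ((*v) (F (T \<omega>)))))" for \<omega>
    have "integrable M (\<lambda>\<omega>. log_plus (onorm (\<lambda>x. F (T \<omega>) *v x)))"
      using measure_preserving_integrable[OF T_preserving log_integrable] .
    hence "integrable M g" unfolding g_def by simp
    moreover have "sup_log k 1 B \<omega> \<le> g \<omega>" for \<omega>
      unfolding sup_log_def
    proof (rule cSUP_least[OF k(3)])
      fix z assume "z \<in> B"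
      thus "wedge_log k 1 (potentials \<omega>) z \<le> g \<omega>"
        using wedge_log_one_le[OF k(1) R, of z "potentials \<omega>"] by (simp add: g_def potentials_def)
    qed
    ultimately show ?thesis
      using sup_log_nonneg[OF k, of 1] sup_log_measurable[OF k, of 1]
      by (intro Bochner_Integration.integrable_bound[where f = g and g = "sup_log k 1 B"])
         (auto intro!: AE_I2 simp: abs_if, (smt (verit))+)
  qed
  have "integrable M (\<lambda>\<omega>. sup_log k n B \<omega> + sup_log k 1 B ((T ^^ n) \<omega>))"
    using Suc measure_preserving_integrable[OF iterate_preserving one] by simp
  thus ?case
  proof (rule Bochner_Integration.integrable_bound)
    show "sup_log k (Suc n) B \<in> borel_measurable M" by (rule sup_log_measurable[OF k])
    show "AE \<omega> in M. norm (sup_log k (Suc n) B \<omega>) \<le> norm (sup_log k n B \<omega> + sup_log k 1 B ((T ^^ n) \<omega>))"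
    proof (rule AE_I2)
      fix \<omega>
      show "norm (sup_log k (Suc n) B \<omega>) \<le> norm (sup_log k n B \<omega> + sup_log k 1 B ((T ^^ n) \<omega>))"
        using sup_log_subadditive[OF k, of n 1 \<omega>] sup_log_nonneg[OF k, of "Suc n" \<omega>] by simp
    qed
  qed
qed

definition mean_log :: "nat \<Rightarrow> complex \<Rightarrow> nat \<Rightarrow> real" where
  "mean_log k z n = (LINT \<omega>|M. wedge_log k n (potentials \<omega>) z)"

lemma wedge_log_integrable:
  assumes "k \<le> CARD('w)"
  shows "integrable M (\<lambda>\<omega>. wedge_log k n (potentials \<omega>) z)"
  using sup_log_integrable[OF assms, of "{z}" n] by (simp add: sup_log_singleton[abs_def])

lemma mean_log_subadditive:
  assumes k: "k \<le> CARD('w)"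
  shows "mean_log k z (m + n) \<le> mean_log k z m + mean_log k z n"
proof -
  let ?w = "\<lambda>n \<omega>. wedge_log k n (potentials \<omega>) z"
  have i: "integrable M (?w n)" for n by (rule wedge_log_integrable[OF k])
  have iT: "integrable M (\<lambda>\<omega>. ?w n ((T ^^ m) \<omega>))"
    using measure_preserving_integrable[OF iterate_preserving i] .
  have "mean_log k z (m + n) \<le> (LINT \<omega>|M. ?w m \<omega> + ?w n ((T ^^ m) \<omega>))"
    unfolding mean_log_def
  proof (rule integral_mono)
    show "integrable M (\<lambda>\<omega>. ?w m \<omega> + ?w n ((T ^^ m) \<omega>))" using i iT by simp
    show "?w (m + n) \<omega> \<le> ?w m \<omega> + ?w n ((T ^^ m) \<omega>)" for \<omega>
      using sup_log_subadditive[OF k, of "{z}" m n \<omega>] by (simp add: sup_log_singleton)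
  qed (rule i)
  also have "\<dots> = mean_log k z m + (LINT \<omega>|M. ?w n ((T ^^ m) \<omega>))"
    unfolding mean_log_def by (rule Bochner_Integration.integral_add[OF i iT])
  also have "(LINT \<omega>|M. ?w n ((T ^^ m) \<omega>)) = mean_log k z n"
    unfolding mean_log_def
    by (rule measure_preserving_integral[OF iterate_preserving]) (use i in auto)
  finally show ?thesis .
qed

lemma mean_log_limit:
  assumes k: "k \<le> CARD('w)"
  obtains L where "(\<lambda>n. mean_log k z n / n) \<longlonglongrightarrow> L" "\<And>e. 0 < e \<Longrightarrow> \<exists>m>0. mean_log k z m / m < L + e"
proof -
  have nonneg: "0 \<le> mean_log k z n" for n
    unfolding mean_log_def by (rule Bochner_Integration.integral_nonneg) (rule wedge_log_nonneg[OF k])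
  show ?thesis
    by (rule fekete_nonneg[of "mean_log k z", OF mean_log_subadditive[OF k] nonneg]) (rule that)
qed

lemma singular_value_measurable:
  assumes "1 \<le> j" "j \<le> CARD('w)"
  shows "(\<lambda>\<omega>. singular_value j (tproduct (potentials \<omega>) n z)) \<in> borel_measurable M"
proof -
  have "continuous_on UNIV (\<lambda>v :: nat \<Rightarrow> real^'w^'w. singular_value j (tproduct v n z))"
    by (rule continuous_on_compose2[OF continuous_singular_value[of j]])
       (use assms in \<open>auto intro!: continuous_intros\<close>)
  thus ?thesis
    by (rule measurable_compose[OF potentials_measurable borel_measurable_continuous_onI])
qed

lemma ln_singular_prod_integrable:
  assumes k: "k \<le> CARD('w)"
  shows "integrable M (\<lambda>\<omega>. ln (singular_prod k (tproduct (potentials \<omega>) n z)))"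
proof (rule Bochner_Integration.integrable_bound[OF wedge_log_integrable[OF k, of n z]])
  have "(\<lambda>\<omega>. singular_prod k (tproduct (potentials \<omega>) n z)) \<in> borel_measurable M"
    unfolding singular_prod_def
    by (intro borel_measurable_prod singular_value_measurable) (use k in auto)
  thus "(\<lambda>\<omega>. ln (singular_prod k (tproduct (potentials \<omega>) n z))) \<in> borel_measurable M" by simp
  show "AE \<omega> in M. norm (ln (singular_prod k (tproduct (potentials \<omega>) n z)))
      \<le> norm (wedge_log k n (potentials \<omega>) z)"
    using wedge_log_singular_prod(1,2)[OF k] wedge_log_nonneg[OF k] by (intro AE_I2) simp
qed

text \<open>
  The two logarithms differ by at most the constant \<open>W ln 2\<close>, which disappears on division by \<open>n\<close>.
\<close>
lemma mean_ln_singular_prod_limit: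
  assumes k: "k \<le> CARD('w)" and L: "(\<lambda>n. mean_log k z n / n) \<longlonglongrightarrow> L"
  shows "(\<lambda>n. (LINT \<omega>|M. ln (singular_prod k (tproduct (potentials \<omega>) n z))) / n) \<longlonglongrightarrow> L"
proof -
  let ?c = "CARD('w) * ln 2 :: real"
  let ?p = "\<lambda>n. LINT \<omega>|M. ln (singular_prod k (tproduct (potentials \<omega>) n z))"
  have le: "?p n \<le> mean_log k z n" for n
    unfolding mean_log_def
    by (intro integral_mono ln_singular_prod_integrable wedge_log_integrable k ln_singular_prod_le)
  have ge: "mean_log k z n \<le> ?c + ?p n" for n
  proof -
    have "mean_log k z n \<le> (LINT \<omega>|M. ?c + ln (singular_prod k (tproduct (potentials \<omega>) n z)))"
      unfolding mean_log_def
      by (intro integral_mono Bochner_Integration.integrable_add ln_singular_prod_integrable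
          wedge_log_integrable k wedge_log_le) simp
    also have "\<dots> = ?c + ?p n"
      using ln_singular_prod_integrable[OF k] by (simp add: prob_space)
    finally show ?thesis .
  qed
  have lower: "(\<lambda>n. mean_log k z n / n - ?c / n) \<longlonglongrightarrow> L - 0"
    by (intro tendsto_diff L lim_const_over_n)
  show ?thesis
  proof (rule real_tendsto_sandwich[OF _ _ _ L])
    show "\<forall>\<^sub>F n in sequentially. mean_log k z n / n - ?c / n \<le> ?p n / n"
    proof (intro always_eventually allI)
      fix n
      have "(mean_log k z n - ?c) / n \<le> ?p n / n" using ge[of n] by (intro divide_right_mono) auto
      thus "mean_log k z n / n - ?c / n \<le> ?p n / n" by (simp only: diff_divide_distrib)
    qed
    show "\<forall>\<^sub>F n in sequentially. ?p n / n \<le> mean_log k z n / n"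
      using le by (intro always_eventually allI divide_right_mono) auto
  qed (use lower in simp)
qed

lemma singular_value_tproduct_pos:
  fixes v :: "nat \<Rightarrow> real^'w^'w"
  assumes "1 \<le> j" "j \<le> CARD('w)"
  shows "0 < singular_value j (tproduct v n z)"
  by (rule singular_value_pos[OF cmod_det_tproduct]) (use assms in auto)

text \<open>
  Since \<open>ln s\<^sub>j = ln (s\<^sub>1 \<cdots> s\<^sub>j) - ln (s\<^sub>1 \<cdots> s\<^sub>j\<^sub>-\<^sub>1)\<close> and both terms are integrable, each exponent is a
  difference of two limits provided by Fekete's lemma, and the sum telescopes.
\<close>
lemma mean_log_limit_lyapunov_sum:
  assumes k: "k \<le> CARD('w)"
  shows "(\<lambda>n. mean_log k z n / n) \<longlonglongrightarrow> lyapunov_sum M T F k z"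
proof -
  define L where "L j = lim (\<lambda>n. mean_log j z n / n)" for j
  have L: "(\<lambda>n. mean_log j z n / n) \<longlonglongrightarrow> L j" if j: "j \<le> CARD('w)" for j
  proof -
    obtain l where "(\<lambda>n. mean_log j z n / n) \<longlonglongrightarrow> l" using mean_log_limit[OF j] by blast
    thus ?thesis unfolding L_def by (simp add: limI)
  qed
  let ?p = "\<lambda>j n. LINT \<omega>|M. ln (singular_prod j (tproduct (potentials \<omega>) n z))"
  have P: "(\<lambda>n. ?p j n / n) \<longlonglongrightarrow> L j" if "j \<le> CARD('w)" for j
    by (rule mean_ln_singular_prod_limit[OF that L[OF that]])
  have "L 0 = 0" using P[of 0] by (simp add: singular_prod_def LIMSEQ_const_iff)
  have "lyapunov_exponent M T F (Suc j) z = L (Suc j) - L j" if j: "Suc j \<le> CARD('w)" for j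
  proof -
    have "(LINT \<omega>|M. ln (singular_value (Suc j) (tproduct (potentials \<omega>) n z))) = ?p (Suc j) n - ?p j n" for n
    proof -
      have "ln (singular_value (Suc j) (tproduct (potentials \<omega>) n z))
          = ln (singular_prod (Suc j) (tproduct (potentials \<omega>) n z)) - ln (singular_prod j (tproduct (potentials \<omega>) n z))" for \<omega>
      proof -
        have "singular_prod (Suc j) A = singular_prod j A * singular_value (Suc j) A" for A :: "complex^('w + 'w)^('w + 'w)"
          by (simp add: singular_prod_def)
        moreover have "1 \<le> singular_prod j (tproduct (potentials \<omega>) n z)"
          by (rule singular_prod_ge_1[OF cmod_det_tproduct]) (use j in simp)
        ultimately show ?thesis
          using singular_value_tproduct_pos[of "Suc j" "potentials \<omega>" n z] j by (simp add: ln_mult)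
      qed
      thus ?thesis
        using ln_singular_prod_integrable[OF j] ln_singular_prod_integrable[of j] j by simp
    qed
    hence "(\<lambda>n. 1 / real n * (LINT \<omega>|M. ln (singular_value (Suc j) (cocycle T F n \<omega> z)))) \<longlonglongrightarrow> L (Suc j) - L j"
      using tendsto_diff[OF P[OF j] P[of j]] j by (simp add: cocycle_eq diff_divide_distrib)
    thus ?thesis unfolding lyapunov_exponent_def by (rule limI)
  qed
  hence "lyapunov_sum M T F j z = L j" if "j \<le> CARD('w)" for j
    using that by (induction j) (auto simp: lyapunov_sum_def \<open>L 0 = 0\<close>)
  thus ?thesis using L[OF k] k by simp
qed

lemma mean_log_near_lyapunov_sum:
  assumes k: "k \<le> CARD('w)" and e: "0 < e"
  shows "\<exists>m>0. mean_log k z m / m < lyapunov_sum M T F k z + e"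
proof -
  obtain L where L: "(\<lambda>n. mean_log k z n / n) \<longlonglongrightarrow> L" "\<And>e. 0 < e \<Longrightarrow> \<exists>m>0. mean_log k z m / m < L + e"
    using mean_log_limit[OF k] by blast
  have "L = lyapunov_sum M T F k z" by (rule LIMSEQ_unique[OF L(1) mean_log_limit_lyapunov_sum[OF k]])
  thus ?thesis using L(2)[OF e] by simp
qed

section \<open>Shrinking discs and generic points\<close>

lemma sup_log_small_disc_tendsto:
  assumes k: "k \<le> CARD('w)"
  shows "(\<lambda>j. sup_log k m (cball z (1 / Suc j)) \<omega>) \<longlonglongrightarrow> wedge_log k m (potentials \<omega>) z"
proof (rule order_tendstoI)
  fix x assume "x < wedge_log k m (potentials \<omega>) z"
  thus "\<forall>\<^sub>F j in sequentially. x < sup_log k m (cball z (1 / Suc j)) \<omega>"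
    by (intro always_eventually allI less_le_trans[OF _ wedge_log_le_sup_log[OF k]]) auto
next
  fix x assume x: "wedge_log k m (potentials \<omega>) z < x"
  define y where "y = (wedge_log k m (potentials \<omega>) z + x) / 2"
  have y: "wedge_log k m (potentials \<omega>) z < y" "y < x" using x by (auto simp: y_def)
  have "open {w. wedge_log k m (potentials \<omega>) w < y}"
    by (intro open_Collect_less continuous_on_wedge_log k continuous_intros)
  then obtain r where r: "0 < r" "cball z r \<subseteq> {w. wedge_log k m (potentials \<omega>) w < y}"
    using y(1) unfolding open_contains_cball by blast
  have "(\<lambda>j. 1 / real (Suc j)) \<longlonglongrightarrow> 0" by (rule LIMSEQ_Suc[OF lim_const_over_n])
  hence "\<forall>\<^sub>F j in sequentially. 1 / real (Suc j) < r" using r(1) by (intro order_tendstoD) auto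
  thus "\<forall>\<^sub>F j in sequentially. sup_log k m (cball z (1 / Suc j)) \<omega> < x"
  proof eventually_elim
    case (elim j)
    have "sup_log k m (cball z (1 / Suc j)) \<omega> \<le> y"
      unfolding sup_log_def
    proof (rule cSUP_least)
      fix w assume "w \<in> cball z (1 / Suc j)"
      hence "w \<in> cball z r" using elim by simp
      thus "wedge_log k m (potentials \<omega>) w \<le> y" using r(2) by force
    qed simp
    thus ?case using y(2) by simp
  qed
qed

text \<open>
  First a time \<open>m\<close> is chosen with \<open>1/m\<close> times the mean close to \<open>\<Gamma>\<^sub>k(z)\<close>, then a small disc around \<open>z\<close>, by
  dominated convergence.
\<close>
lemma sup_log_mean_near_lyapunov_sum:
  assumes k: "k \<le> CARD('w)" and e: "0 < e"
  obtains m r where "0 < m" "0 < r"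
    "\<And>B. compact B \<Longrightarrow> B \<noteq> {} \<Longrightarrow> B \<subseteq> cball z r \<Longrightarrow>
       (LINT \<omega>|M. sup_log k m B \<omega>) / m < lyapunov_sum M T F k z + e"
proof -
  obtain m where m: "m > 0" "mean_log k z m / m < lyapunov_sum M T F k z + e"
    using mean_log_near_lyapunov_sum[OF k e] by blast
  have c: "compact (cball z (1 / Suc j))" "cball z (1 / Suc j) \<noteq> {}" for j by auto
  have "(\<lambda>j. LINT \<omega>|M. sup_log k m (cball z (1 / Suc j)) \<omega>) \<longlonglongrightarrow> (LINT \<omega>|M. wedge_log k m (potentials \<omega>) z)"
  proof (rule integral_dominated_convergence[where w = "sup_log k m (cball z 1)"])
    show "(\<lambda>\<omega>. wedge_log k m (potentials \<omega>) z) \<in> borel_measurable M" using wedge_log_integrable[OF k] by auto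
    show "sup_log k m (cball z (1 / Suc j)) \<in> borel_measurable M" for j by (rule sup_log_measurable[OF k c])
    show "integrable M (sup_log k m (cball z 1))" by (rule sup_log_integrable[OF k]) auto
    show "AE \<omega> in M. (\<lambda>j. sup_log k m (cball z (1 / Suc j)) \<omega>) \<longlonglongrightarrow> wedge_log k m (potentials \<omega>) z"
      by (intro AE_I2 sup_log_small_disc_tendsto k)
    show "AE \<omega> in M. norm (sup_log k m (cball z (1 / Suc j)) \<omega>) \<le> sup_log k m (cball z 1) \<omega>" for j
    proof (rule AE_I2)
      fix \<omega>
      have "cball z (1 / Suc j) \<subseteq> cball z 1" by (rule subset_cball) simp
      thus "norm (sup_log k m (cball z (1 / Suc j)) \<omega>) \<le> sup_log k m (cball z 1) \<omega>"
        using sup_log_nonneg[OF k c, of m j \<omega>] sup_log_mono[OF k compact_cball _ c(2)] by simp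
    qed
  qed
  hence "(\<lambda>j. (LINT \<omega>|M. sup_log k m (cball z (1 / Suc j)) \<omega>) / m) \<longlonglongrightarrow> mean_log k z m / m"
    unfolding mean_log_def by (intro tendsto_divide tendsto_const) (use m in auto)
  hence "\<forall>\<^sub>F j in sequentially. (LINT \<omega>|M. sup_log k m (cball z (1 / Suc j)) \<omega>) / m < lyapunov_sum M T F k z + e"
    using m(2) by (rule order_tendstoD)
  then obtain j where j: "(LINT \<omega>|M. sup_log k m (cball z (1 / Suc j)) \<omega>) / m < lyapunov_sum M T F k z + e"
    using eventually_happens trivial_limit_sequentially by blast
  show ?thesis
  proof (rule that[OF m(1), of "1 / Suc j"])
    fix B assume B: "compact B" "B \<noteq> {}" "B \<subseteq> cball z (1 / Suc j)"
    have "(LINT \<omega>|M. sup_log k m B \<omega>) \<le> (LINT \<omega>|M. sup_log k m (cball z (1 / Suc j)) \<omega>)"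
      by (intro integral_mono sup_log_integrable k B c sup_log_mono)
    hence "(LINT \<omega>|M. sup_log k m B \<omega>) / m \<le> (LINT \<omega>|M. sup_log k m (cball z (1 / Suc j)) \<omega>) / m"
      by (rule divide_right_mono) simp
    thus "(LINT \<omega>|M. sup_log k m B \<omega>) / m < lyapunov_sum M T F k z + e" using j by linarith
  qed simp
qed

definition disc_centres :: "complex set" where
  "disc_centres = (SOME D. countable D \<and> (\<forall>X. open X \<longrightarrow> X \<noteq> {} \<longrightarrow> (\<exists>d\<in>D. d \<in> X)))"

lemma disc_centres: "countable disc_centres" "open X \<Longrightarrow> X \<noteq> {} \<Longrightarrow> \<exists>d\<in>disc_centres. d \<in> X"
  using someI_ex[OF countable_dense_exists[where 'a = complex]]
  unfolding disc_centres_def by blast+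

definition generic_point :: "nat \<Rightarrow> 'a \<Rightarrow> bool" where
  "generic_point k \<omega> \<longleftrightarrow> (\<forall>c\<in>disc_centres. \<forall>j m.
     (\<lambda>n. orbit_sum T (sup_log k m (cball c (1 / Suc j))) n \<omega> / n)
       \<longlonglongrightarrow> (LINT \<omega>|M. sup_log k m (cball c (1 / Suc j)) \<omega>))"

lemma almost_star_surely_generic:
  assumes k: "k \<le> CARD('w)"
  shows "almost_star_surely M T F (generic_point k)"
  unfolding almost_star_surely_def
proof (intro conjI impI ballI)
  have c: "compact (cball c (1 / Suc j))" "cball c (1 / Suc j) \<noteq> {}" for c :: complex and j by auto
  show "AE \<omega> in M. generic_point k \<omega>"
    unfolding generic_point_def AE_ball_countable[OF disc_centres(1)] AE_all_countable
    by (intro ballI allI birkhoff_ergodic prob_space_axioms ergodic sup_log_integrable k c)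
  fix \<omega> assume "\<exists>X. uniquely_ergodic_case X M T F" and \<omega>: "\<omega> \<in> space M"
  then obtain X where "uniquely_ergodic_case X M T F" by blast
  hence X: "topspace X = space M" "sets M = borel_sets_of X" "compact_space X" "metrizable_space X"
    "continuous_map X X T" "uniquely_ergodic X T" "continuous_map X euclidean F"
    by (auto simp: uniquely_ergodic_case_def)
  show "generic_point k \<omega>"
    unfolding generic_point_def
    by (intro ballI allI uniquely_ergodic_birkhoff[of X] X prob_space_axioms T_preserving
        sup_log_continuous_map k c) (use X \<omega> in auto)
qed

text \<open>
  By density, \<open>z\<close> lies in one of the countably many discs that is contained in the small disc around \<open>z\<close>
  given by the previous estimate of means.
\<close>
lemma generic_point_local_bound:
  assumes k: "k \<le> CARD('w)" and gen: "generic_point k \<omega>" and e: "0 < e"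
  obtains U where "open U" "z \<in> U"
    "\<forall>\<^sub>F n in sequentially. \<forall>w\<in>U. wedge_log k n (potentials \<omega>) w / n < lyapunov_sum M T F k z + e"
proof -
  obtain m r where m: "0 < m" and r: "0 < r"
    and mean: "\<And>B. compact B \<Longrightarrow> B \<noteq> {} \<Longrightarrow> B \<subseteq> cball z r \<Longrightarrow>
       (LINT \<omega>|M. sup_log k m B \<omega>) / m < lyapunov_sum M T F k z + e / 2"
    using sup_log_mean_near_lyapunov_sum[OF k, of "e / 2" z] e by (metis half_gt_zero)
  obtain j :: nat where j: "1 / Suc j < r / 2" using nat_approx_posE[of "r / 2"] r by auto
  obtain c where c: "c \<in> disc_centres" "c \<in> ball z (1 / Suc j)"
    using disc_centres(2)[of "ball z (1 / Suc j)"] by auto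
  define B where "B = cball c (1 / Suc j)"
  have B: "compact B" "B \<noteq> {}" by (auto simp: B_def)
  have "B \<subseteq> cball z r"
  proof
    fix w assume "w \<in> B"
    hence "dist z w \<le> dist z c + 1 / Suc j" using dist_triangle[of z w c] by (simp add: B_def)
    thus "w \<in> cball z r" using c(2) j by simp
  qed
  hence B_mean: "(LINT \<omega>|M. sup_log k m B \<omega>) / m < lyapunov_sum M T F k z + e / 2" by (rule mean[OF B])
  have avg: "(\<lambda>n. (\<Sum>i<n. sup_log k l B ((T ^^ i) \<omega>)) / n) \<longlonglongrightarrow> (LINT \<omega>|M. sup_log k l B \<omega>)" for l
    using gen c(1) unfolding generic_point_def orbit_sum_def B_def by blast
  have "\<forall>\<^sub>F n in sequentially. sup_log k n B ((T ^^ 0) \<omega>) / n < (LINT \<omega>|M. sup_log k m B \<omega>) / m + e / 2"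
  proof (rule subadditive_array_limsup[where u = "\<lambda>i n. sup_log k n B ((T ^^ i) \<omega>)", OF _ _ m avg avg])
    show "sup_log k (a + b) B ((T ^^ i) \<omega>) \<le> sup_log k a B ((T ^^ i) \<omega>) + sup_log k b B ((T ^^ (i + a)) \<omega>)" for i a b
      using sup_log_subadditive[OF k B, of a b "(T ^^ i) \<omega>"] by (simp add: funpow_add[symmetric] add.commute flip: funpow_add o_apply[of "T ^^ a"])
  qed (use e sup_log_nonneg[OF k B] in auto)
  hence "\<forall>\<^sub>F n in sequentially. \<forall>w\<in>ball c (1 / Suc j). wedge_log k n (potentials \<omega>) w / n < lyapunov_sum M T F k z + e"
  proof eventually_elim
    case (elim n)
    show ?case
    proof
      fix w assume "w \<in> ball c (1 / Suc j)"
      hence "w \<in> B" by (simp add: B_def)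
      hence "wedge_log k n (potentials \<omega>) w / n \<le> sup_log k n B \<omega> / n"
        by (intro divide_right_mono wedge_log_le_sup_log k B) simp_all
      thus "wedge_log k n (potentials \<omega>) w / n < lyapunov_sum M T F k z + e" using elim B_mean by simp
    qed
  qed
  thus ?thesis using that[of "ball c (1 / Suc j)"] c(2) by (simp add: dist_commute)
qed

lemma sum_ln_singular_values_le:
  assumes k: "k \<le> CARD('w)"
  shows "(\<Sum>j=1..k. 1 / real n * ln (singular_value j (cocycle T F n \<omega> z)))
    \<le> wedge_log k n (potentials \<omega>) z / n"
proof -
  have "(\<Sum>j=1..k. ln (singular_value j (cocycle T F n \<omega> z))) = ln (singular_prod k (cocycle T F n \<omega> z))"
    unfolding singular_prod_def cocycle_eq
    by (rule ln_prod[symmetric]) (use k singular_value_tproduct_pos in \<open>auto simp: less_imp_neq[symmetric]\<close>)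
  also have "\<dots> \<le> wedge_log k n (potentials \<omega>) z"
    unfolding cocycle_eq by (rule ln_singular_prod_le[OF k])
  finally show ?thesis
    by (simp add: sum_divide_distrib[symmetric] divide_right_mono)
qed

lemma generic_pointwise:
  assumes k: "k \<le> CARD('w)" and gen: "generic_point k \<omega>"
  shows "limsup (\<lambda>n. ereal ((\<Sum>j=1..k. 1 / real n * ln (singular_value j (cocycle T F n \<omega> z)))
                               - lyapunov_sum M T F k z)) \<le> 0"
proof (rule limsup_le_0_I)
  fix e :: real assume "0 < e"
  then obtain U where U: "open U" "z \<in> U"
    "\<forall>\<^sub>F n in sequentially. \<forall>w\<in>U. wedge_log k n (potentials \<omega>) w / n < lyapunov_sum M T F k z + e"
    by (rule generic_point_local_bound[OF k gen])
  from U(3) show "\<forall>\<^sub>F n in sequentially. ereal ((\<Sum>j=1..k. 1 / real n * ln (singular_value j (cocycle T F n \<omega> z)))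
      - lyapunov_sum M T F k z) \<le> ereal e"
  proof eventually_elim
    case (elim n)
    hence "wedge_log k n (potentials \<omega>) z / n < lyapunov_sum M T F k z + e" using U(2) by blast
    thus ?case using sum_ln_singular_values_le[OF k, of n \<omega> z] by simp
  qed
qed

text \<open>
  Continuity of \<open>\<Gamma>\<^sub>k\<close> on \<open>K\<close> allows replacing the value at the centre of a neighbourhood by the value at the
  point under consideration; finitely many neighbourhoods cover \<open>K\<close>.
\<close>
lemma generic_uniform:
  assumes k: "k \<le> CARD('w)" and gen: "generic_point k \<omega>"
    and K: "compact K" and cont: "continuous_on K (lyapunov_sum M T F k)"
  shows "limsup (\<lambda>n. SUP z\<in>K. ereal ((\<Sum>j=1..k. 1 / real n * ln (singular_value j (cocycle T F n \<omega> z)))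
                               - lyapunov_sum M T F k z)) \<le> 0"
proof (rule limsup_le_0_I)
  fix e :: real assume e: "0 < e"
  let ?\<Gamma> = "lyapunov_sum M T F k"
  have local: "\<exists>U. open U \<and> z \<in> U \<and>
      (\<forall>\<^sub>F n in sequentially. \<forall>w\<in>U \<inter> K. wedge_log k n (potentials \<omega>) w / n < ?\<Gamma> w + e)" if z: "z \<in> K" for z
  proof -
    have e2: "0 < e / 2" using e by simp
    obtain U where U: "open U" "z \<in> U"
      "\<forall>\<^sub>F n in sequentially. \<forall>w\<in>U. wedge_log k n (potentials \<omega>) w / n < ?\<Gamma> z + e / 2"
      by (rule generic_point_local_bound[OF k gen e2, of z])
    obtain d where d: "0 < d" "\<And>w. w \<in> K \<Longrightarrow> dist w z < d \<Longrightarrow> dist (?\<Gamma> w) (?\<Gamma> z) < e / 2"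
      using cont z e2 unfolding continuous_on_iff by blast
    have ev: "\<forall>\<^sub>F n in sequentially. \<forall>w\<in>(U \<inter> ball z d) \<inter> K. wedge_log k n (potentials \<omega>) w / n < ?\<Gamma> w + e"
      using U(3)
    proof eventually_elim
      case (elim n)
      show ?case
      proof
        fix w assume w: "w \<in> (U \<inter> ball z d) \<inter> K"
        hence "dist (?\<Gamma> w) (?\<Gamma> z) < e / 2" using d(2)[of w] by (simp add: dist_commute)
        hence "?\<Gamma> z < ?\<Gamma> w + e / 2" unfolding dist_real_def by linarith
        moreover have "wedge_log k n (potentials \<omega>) w / n < ?\<Gamma> z + e / 2" using elim w by blast
        ultimately show "wedge_log k n (potentials \<omega>) w / n < ?\<Gamma> w + e" by linarith
      qed
    qed
    show ?thesis
      by (rule exI[of _ "U \<inter> ball z d"], intro conjI ev) (use U(1,2) d(1) in auto)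
  qed
  have "\<forall>z\<in>K. \<exists>U. open U \<and> z \<in> U \<and>
      (\<forall>\<^sub>F n in sequentially. \<forall>w\<in>U \<inter> K. wedge_log k n (potentials \<omega>) w / n < ?\<Gamma> w + e)"
    by (rule ballI, rule local)
  from bchoice[OF this] obtain U where U: "\<forall>z\<in>K. open (U z) \<and> z \<in> U z \<and>
      (\<forall>\<^sub>F n in sequentially. \<forall>w\<in>U z \<inter> K. wedge_log k n (potentials \<omega>) w / n < ?\<Gamma> w + e)"
    by (rule exE)
  obtain C where C: "C \<subseteq> K" "finite C" "K \<subseteq> (\<Union>z\<in>C. U z)"
    by (rule compactE_image[OF K, of K U]) (use U in auto)
  have "\<forall>\<^sub>F n in sequentially. \<forall>z\<in>C. \<forall>w\<in>U z \<inter> K. wedge_log k n (potentials \<omega>) w / n < ?\<Gamma> w + e"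
    by (rule eventually_ball_finite[OF C(2)]) (use U C(1) in blast)
  thus "\<forall>\<^sub>F n in sequentially. (SUP z\<in>K. ereal ((\<Sum>j=1..k. 1 / real n * ln (singular_value j (cocycle T F n \<omega> z)))
      - ?\<Gamma> z)) \<le> ereal e"
  proof eventually_elim
    case (elim n)
    show ?case
    proof (rule SUP_least)
      fix z assume z: "z \<in> K"
      hence "wedge_log k n (potentials \<omega>) z / n < ?\<Gamma> z + e" using elim C(3) by blast
      thus "ereal ((\<Sum>j=1..k. 1 / real n * ln (singular_value j (cocycle T F n \<omega> z))) - ?\<Gamma> z) \<le> ereal e"
        using sum_ln_singular_values_le[OF k, of n \<omega> z] by simp
    qed
  qed
qed

end

lemma almost_star_surely_mono:
  assumes "almost_star_surely M T F P" "\<And>\<omega>. P \<omega> \<Longrightarrow> Q \<omega>"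
  shows "almost_star_surely M T F Q"
  using assms by (auto simp: almost_star_surely_def elim!: eventually_mono)

theorem corollary1p7:
  fixes M :: "'a measure"
    and T :: "'a \<Rightarrow> 'a"
    and F :: "'a \<Rightarrow> real^'w^'w"
    and k :: nat
  assumes "prob_space M"
    and "ergodic_map M T"
    and "F \<in> M \<rightarrow>\<^sub>M borel"
    and "\<forall>\<omega>\<in>space M. F \<omega> \<in> sym_matrices"
    and "integrable M (\<lambda>\<omega>. log_plus (onorm (\<lambda>x. F \<omega> *v x)))"
    and "1 \<le> k"
    and "k \<le> CARD('w)"
  shows "almost_star_surely M T F (\<lambda>\<omega>. \<forall>z.
           limsup (\<lambda>n. ereal ((\<Sum>j=1..k. 1 / real n * ln (singular_value j (cocycle T F n \<omega> z)))
                               - lyapunov_sum M T F k z)) \<le> 0)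
       \<and> (\<forall>K. compact K \<and> continuous_on K (lyapunov_sum M T F k) \<longrightarrow>
            almost_star_surely M T F (\<lambda>\<omega>.
              limsup (\<lambda>n. SUP z\<in>K.
                ereal ((\<Sum>j=1..k. 1 / real n * ln (singular_value j (cocycle T F n \<omega> z)))
                       - lyapunov_sum M T F k z)) \<le> 0))"
proof -
  interpret ergodic_schroedinger M T F
    using assms by (intro ergodic_schroedinger.intro ergodic_schroedinger_axioms.intro)
  note generic = almost_star_surely_generic[OF assms(7)]
  show ?thesis
  proof (intro conjI allI impI)
    show "almost_star_surely M T F (\<lambda>\<omega>. \<forall>z.
           limsup (\<lambda>n. ereal ((\<Sum>j=1..k. 1 / real n * ln (singular_value j (cocycle T F n \<omega> z)))
                               - lyapunov_sum M T F k z)) \<le> 0)"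
      by (rule almost_star_surely_mono[OF generic]) (intro allI generic_pointwise[OF assms(7)])
    fix K assume "compact K \<and> continuous_on K (lyapunov_sum M T F k)"
    thus "almost_star_surely M T F (\<lambda>\<omega>.
              limsup (\<lambda>n. SUP z\<in>K.
                ereal ((\<Sum>j=1..k. 1 / real n * ln (singular_value j (cocycle T F n \<omega> z)))
                       - lyapunov_sum M T F k z)) \<le> 0)"
      by (intro almost_star_surely_mono[OF generic] generic_uniform[OF assms(7)]) simp_all
  qed
qed

end
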